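(* If $\mathcal{C}$ is a type-theoretic fibration category, then the category $(\mathcal{C}^{\mathbf 2})_{\mathbf f}$ of Reedy fibrant objects of the arrow category of $\mathcal{C}$, with the Reedy fibrations as its fibrations, is also a type-theoretic fibration category.
   Context: A type-theoretic fibration category is a category $\mathcal{C}$ with the following structure. (1) A terminal object $1$. (2) A subcategory $\mathcal{F}\subset\mathcal{C}$ containing all objects, all isomorphisms, and all morphisms with codomain $1$; morphisms of $\mathcal{F}$ are called fibrations, and a morphism is called an acyclic cofibration if it has the left lifting property with respect to all fibrations. (3) All pullbacks of fibrations (along arbitrary morphisms) exist and are fibrations. (4) For every fibration $g:A\to B$, the pullback functor $g^*:\mathcal{C}/B\to\mathcal{C}/A$ has a partial right adjoint $\Pi_g$, defined at all fibrations over $A$, whose values are fibrations over $B$. (5) Every morphism factors as an acyclic cofibration followed by a fibration. (6) If $A\to C$ and $B\to C$ are fibrations, $A\to B$ is an acyclic cofibration over $C$, and $Z\to C$ is any morphism, then the induced map $Z\times_C A\to Z\times_C B$ is an acyclic cofibration. $\mathcal{C}^{\mathbf 2}$ is the category of arrows $(\alpha:A_1\to A_0)$ of $\mathcal{C}$, with commutative squares as morphisms. A morphism $f=(f_1,f_0):(A_1\to A_0)\to(B_1\to B_0)$ in $\mathcal{C}^{\mathbf 2}$ is a Reedy fibration if $f_0:A_0\to B_0$ is a fibration and the induced map $A_1\to A_0\times_{B_0}B_1$ is a fibration. An object $(\alpha:A_1\to A_0)$ is Reedy fibrant if its map to the terminal object is a Reedy fibration, i.e. if $\alpha$ is a fibration.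 $(\mathcal{C}^{\mathbf 2})_{\mathbf f}$ is the full subcategory of $\mathcal{C}^{\mathbf 2}$ on the Reedy fibrant objects. *)

theory Defs
  imports Main
begin

section \<open>Categories\<close>

record ('o, 'a) cat =
  Obj :: "'o set"
  Arr :: "'a set"
  Dom :: "'a \<Rightarrow> 'o"
  Cod :: "'a \<Rightarrow> 'o"
  Ident :: "'o \<Rightarrow> 'a"
  Comp :: "'a \<Rightarrow> 'a \<Rightarrow> 'a"  (infixr \<open>\<bullet>\<index>\<close> 75)

text \<open>The fields of a record are only meaningful on objects, arrows and composable pairs;
  \<open>g \<bullet> f\<close> is \<open>g\<close> after \<open>f\<close>.\<close>

definition Hom :: "('o, 'a, 'm) cat_scheme \<Rightarrow> 'o \<Rightarrow> 'o \<Rightarrow> 'a set" where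
  "Hom C A B = {f \<in> Arr C. Dom C f = A \<and> Cod C f = B}"

locale category =
  fixes C :: "('o, 'a, 'm) cat_scheme" (structure)
  assumes Dom_Obj: "f \<in> Arr C \<Longrightarrow> Dom C f \<in> Obj C"
    and Cod_Obj: "f \<in> Arr C \<Longrightarrow> Cod C f \<in> Obj C"
    and Ident_Hom: "A \<in> Obj C \<Longrightarrow> Ident C A \<in> Hom C A A"
    and Comp_Hom: "\<lbrakk>f \<in> Hom C A B; g \<in> Hom C B D\<rbrakk> \<Longrightarrow> g \<bullet> f \<in> Hom C A D"
    and Comp_Ident: "f \<in> Hom C A B \<Longrightarrow> f \<bullet> Ident C A = f"
    and Ident_Comp: "f \<in> Hom C A B \<Longrightarrow> Ident C B \<bullet> f = f"
    and Comp_assoc: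
      "\<lbrakk>f \<in> Hom C A B; g \<in> Hom C B D; h \<in> Hom C D E\<rbrakk> \<Longrightarrow> (h \<bullet> g) \<bullet> f = h \<bullet> (g \<bullet> f)"

definition terminal :: "('o, 'a, 'm) cat_scheme \<Rightarrow> 'o \<Rightarrow> bool" where
  "terminal C T \<longleftrightarrow> T \<in> Obj C \<and> (\<forall>A \<in> Obj C. \<exists>!f. f \<in> Hom C A T)"

definition iso :: "('o, 'a, 'm) cat_scheme \<Rightarrow> 'a \<Rightarrow> bool" where
  "iso C f \<longleftrightarrow> f \<in> Arr C \<and>
    (\<exists>g \<in> Hom C (Cod C f) (Dom C f).
      Comp C g f = Ident C (Dom C f) \<and> Comp C f g = Ident C (Cod C f))"

definition full_subcat :: "('o, 'a, 'm) cat_scheme \<Rightarrow> 'o set \<Rightarrow> ('o, 'a) cat" where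
  "full_subcat C S =
    \<lparr>Obj = Obj C \<inter> S,
     Arr = {f \<in> Arr C. Dom C f \<in> S \<and> Cod C f \<in> S},
     Dom = Dom C, Cod = Cod C, Ident = Ident C, Comp = Comp C\<rparr>"

locale cat_functor = dom: category C + cod: category D
  for C :: "('o, 'a, 'm) cat_scheme" and D :: "('p, 'b, 'n) cat_scheme" +
  fixes Fo :: "'o \<Rightarrow> 'p" and Fa :: "'a \<Rightarrow> 'b"
  assumes map_Obj: "A \<in> Obj C \<Longrightarrow> Fo A \<in> Obj D"
    and map_Hom: "f \<in> Hom C A B \<Longrightarrow> Fa f \<in> Hom D (Fo A) (Fo B)"
    and map_Ident: "A \<in> Obj C \<Longrightarrow> Fa (Ident C A) = Ident D (Fo A)"
    and map_Comp:
      "\<lbrakk>f \<in> Hom C A B; g \<in> Hom C B B'\<rbrakk> \<Longrightarrow> Fa (Comp C g f) = Comp D (Fa g) (Fa f)"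

text \<open>A right adjoint of the functor \<open>(Fo, Fa)\<close> that is defined only on the full subcategory of
  \<open>E\<close> on the set of objects \<open>S\<close>; \<open>\<phi>\<close> is the adjunction bijection, natural in both variables.\<close>

locale partial_right_adjoint =
    left: cat_functor D E Fo Fa + right: cat_functor "full_subcat E S" D Ro Ra
  for D :: "('o, 'a, 'm) cat_scheme" and E :: "('p, 'b, 'n) cat_scheme"
    and Fo :: "'o \<Rightarrow> 'p" and Fa :: "'a \<Rightarrow> 'b"
    and S :: "'p set" and Ro :: "'p \<Rightarrow> 'o" and Ra :: "'b \<Rightarrow> 'a" +
  fixes \<phi> :: "'o \<Rightarrow> 'p \<Rightarrow> 'b \<Rightarrow> 'a"
  assumes subset_Obj: "S \<subseteq> Obj E"
    and bij: "\<lbrakk>Y \<in> Obj D; X \<in> S\<rbrakk> \<Longrightarrow> bij_betw (\<phi> Y X) (Hom E (Fo Y) X) (Hom D Y (Ro X))"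
    and natural: "\<lbrakk>X \<in> S; X' \<in> S; y \<in> Hom D Y' Y; k \<in> Hom E (Fo Y) X; x \<in> Hom E X X'\<rbrakk> \<Longrightarrow>
      \<phi> Y' X' (Comp E x (Comp E k (Fa y))) = Comp D (Ra x) (Comp D (\<phi> Y X k) y)"

section \<open>Slices and pullbacks\<close>

text \<open>An arrow \<open>(h, k, u)\<close> of the slice is \<open>u\<close> regarded as a morphism from \<open>h\<close> to \<open>k\<close>.\<close>

definition slice :: "('o, 'a, 'm) cat_scheme \<Rightarrow> 'o \<Rightarrow> ('a, 'a \<times> 'a \<times> 'a) cat" where
  "slice C B =
    \<lparr>Obj = {h \<in> Arr C. Cod C h = B},
     Arr = {(h, k, u). h \<in> Arr C \<and> Cod C h = B \<and> k \<in> Arr C \<and> Cod C k = B \<and>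
       u \<in> Hom C (Dom C h) (Dom C k) \<and> Comp C k u = h},
     Dom = (\<lambda>(h, k, u). h),
     Cod = (\<lambda>(h, k, u). k),
     Ident = (\<lambda>h. (h, h, Ident C (Dom C h))),
     Comp = (\<lambda>(k', l, v) (h, k, u). (h, l, Comp C v u))\<rparr>"

text \<open>\<open>p\<close> and \<open>q\<close> are the projections to the domains of \<open>f\<close> and \<open>g\<close>, respectively.\<close>

definition pullback :: "('o, 'a, 'm) cat_scheme \<Rightarrow> 'a \<Rightarrow> 'a \<Rightarrow> 'a \<Rightarrow> 'a \<Rightarrow> bool" where
  "pullback C f g p q \<longleftrightarrow>
    f \<in> Arr C \<and> g \<in> Arr C \<and> Cod C f = Cod C g \<and>
    p \<in> Hom C (Dom C p) (Dom C f) \<and> q \<in> Hom C (Dom C p) (Dom C g) \<and>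
    Comp C f p = Comp C g q \<and>
    (\<forall>T x y. x \<in> Hom C T (Dom C f) \<and> y \<in> Hom C T (Dom C g) \<and> Comp C f x = Comp C g y \<longrightarrow>
      (\<exists>!u. u \<in> Hom C T (Dom C p) \<and> Comp C p u = x \<and> Comp C q u = y))"

text \<open>The pullback functor from the slice over \<open>Cod C g\<close> to the slice over \<open>Dom C g\<close>,
  with respect to a fixed choice of pullbacks along \<open>g\<close>. It is only meaningful if these exist.\<close>

definition chosen_pullback :: "('o, 'a, 'm) cat_scheme \<Rightarrow> 'a \<Rightarrow> 'a \<Rightarrow> 'a \<times> 'a" where
  "chosen_pullback C g h = (SOME (p, q). pullback C g h p q)"

definition pullback_obj :: "('o, 'a, 'm) cat_scheme \<Rightarrow> 'a \<Rightarrow> 'a \<Rightarrow> 'a" where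
  "pullback_obj C g h = fst (chosen_pullback C g h)"

definition pullback_arr ::
  "('o, 'a, 'm) cat_scheme \<Rightarrow> 'a \<Rightarrow> 'a \<times> 'a \<times> 'a \<Rightarrow> 'a \<times> 'a \<times> 'a" where
  "pullback_arr C g = (\<lambda>(h, k, u).
    let (p, q) = chosen_pullback C g h; (p', q') = chosen_pullback C g k
    in (p, p', THE w. w \<in> Hom C (Dom C p) (Dom C p') \<and>
                      Comp C p' w = p \<and> Comp C q' w = Comp C u q))"

section \<open>Type-theoretic fibration categories\<close>

record ('o, 'a) fibcat = "('o, 'a) cat" +
  One :: 'o
  Fib :: "'a set"

definition acyclic_cofibration :: "('o, 'a, 'm) fibcat_scheme \<Rightarrow> 'a \<Rightarrow> bool" where
  "acyclic_cofibration C i \<longleftrightarrow> i \<in> Arr C \<and>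
    (\<forall>p u v. p \<in> Fib C \<and> u \<in> Hom C (Dom C i) (Dom C p) \<and> v \<in> Hom C (Cod C i) (Cod C p) \<and>
        Comp C p u = Comp C v i \<longrightarrow>
      (\<exists>l \<in> Hom C (Cod C i) (Dom C p). Comp C l i = u \<and> Comp C p l = v))"

locale type_theoretic_fibration_category = category C
  for C :: "('o, 'a, 'm) fibcat_scheme" (structure) +
  assumes terminal_One: "terminal C (One C)"
    and Fib_Arr: "Fib C \<subseteq> Arr C"
    and Fib_Ident: "A \<in> Obj C \<Longrightarrow> Ident C A \<in> Fib C"
    and Fib_Comp: "\<lbrakk>f \<in> Fib C; g \<in> Fib C; Cod C f = Dom C g\<rbrakk> \<Longrightarrow> g \<bullet> f \<in> Fib C"
    and Fib_iso: "iso C f \<Longrightarrow> f \<in> Fib C"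
    and Fib_One: "\<lbrakk>f \<in> Arr C; Cod C f = One C\<rbrakk> \<Longrightarrow> f \<in> Fib C"
    and pullback_exists:
      "\<lbrakk>g \<in> Fib C; f \<in> Arr C; Cod C f = Cod C g\<rbrakk> \<Longrightarrow> \<exists>p q. pullback C f g p q"
    and pullback_Fib: "\<lbrakk>g \<in> Fib C; pullback C f g p q\<rbrakk> \<Longrightarrow> p \<in> Fib C"
    and Pi_exists:
      "g \<in> Fib C \<Longrightarrow> \<exists>Pi_obj Pi_arr \<phi>.
        partial_right_adjoint (slice C (Cod C g)) (slice C (Dom C g))
          (pullback_obj C g) (pullback_arr C g)
          {f \<in> Fib C. Cod C f = Dom C g} Pi_obj Pi_arr \<phi> \<and>
        (\<forall>f \<in> Fib C. Cod C f = Dom C g \<longrightarrow> Pi_obj f \<in> Fib C)"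
    and factorization:
      "f \<in> Arr C \<Longrightarrow> \<exists>i p. acyclic_cofibration C i \<and> p \<in> Fib C \<and>
        Dom C i = Dom C f \<and> Cod C i = Dom C p \<and> Cod C p = Cod C f \<and> f = p \<bullet> i"
    and acyclic_cofibration_pullback:
      "\<lbrakk>a \<in> Fib C; b \<in> Fib C; Cod C a = Cod C b;
        acyclic_cofibration C i; i \<in> Hom C (Dom C a) (Dom C b); b \<bullet> i = a;
        z \<in> Arr C; Cod C z = Cod C a; pullback C z a p q; pullback C z b p' q';
        k \<in> Hom C (Dom C p) (Dom C p'); p' \<bullet> k = p; q' \<bullet> k = i \<bullet> q\<rbrakk>
        \<Longrightarrow> acyclic_cofibration C k"

section \<open>The arrow category and Reedy fibrations\<close>

text \<open>The arrow \<open>(\<alpha>, \<beta>, f\<^sub>1, f\<^sub>0)\<close> of the arrow category is the commutative square \<open>(f\<^sub>1, f\<^sub>0)\<close>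
  regarded as a morphism from \<open>\<alpha> : A\<^sub>1 \<rightarrow> A\<^sub>0\<close> to \<open>\<beta> : B\<^sub>1 \<rightarrow> B\<^sub>0\<close>.\<close>

definition arrow_cat :: "('o, 'a, 'm) cat_scheme \<Rightarrow> ('a, 'a \<times> 'a \<times> 'a \<times> 'a) cat" where
  "arrow_cat C =
    \<lparr>Obj = Arr C,
     Arr = {(\<alpha>, \<beta>, f1, f0). \<alpha> \<in> Arr C \<and> \<beta> \<in> Arr C \<and>
       f1 \<in> Hom C (Dom C \<alpha>) (Dom C \<beta>) \<and> f0 \<in> Hom C (Cod C \<alpha>) (Cod C \<beta>) \<and>
       Comp C f0 \<alpha> = Comp C \<beta> f1},
     Dom = (\<lambda>(\<alpha>, \<beta>, f1, f0). \<alpha>),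
     Cod = (\<lambda>(\<alpha>, \<beta>, f1, f0). \<beta>),
     Ident = (\<lambda>\<alpha>. (\<alpha>, \<alpha>, Ident C (Dom C \<alpha>), Ident C (Cod C \<alpha>))),
     Comp = (\<lambda>(\<beta>', \<gamma>, g1, g0) (\<alpha>, \<beta>, f1, f0). (\<alpha>, \<gamma>, Comp C g1 f1, Comp C g0 f0))\<rparr>"

text \<open>The pullback of \<open>f\<^sub>0\<close> along \<open>\<beta>\<close> exists if \<open>f\<^sub>0\<close> is a fibration; \<open>k\<close> is the induced map
  from \<open>A\<^sub>1\<close> into it. As isomorphisms are fibrations, the choice of the pullback does not matter.\<close>

definition reedy_fibrations ::
  "('o, 'a, 'm) fibcat_scheme \<Rightarrow> ('a \<times> 'a \<times> 'a \<times> 'a) set" where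
  "reedy_fibrations C = {(\<alpha>, \<beta>, f1, f0). (\<alpha>, \<beta>, f1, f0) \<in> Arr (arrow_cat C) \<and> f0 \<in> Fib C \<and>
    (\<forall>p q k. pullback C f0 \<beta> p q \<and> k \<in> Hom C (Dom C \<alpha>) (Dom C p) \<and>
      Comp C p k = \<alpha> \<and> Comp C q k = f1 \<longrightarrow> k \<in> Fib C)}"

text \<open>The terminal object of the arrow category is the identity of the terminal object,
  see \<open>terminal_arrow_cat\<close> below.\<close>

definition reedy_fibrant :: "('o, 'a, 'm) fibcat_scheme \<Rightarrow> 'a \<Rightarrow> bool" where
  "reedy_fibrant C \<alpha> \<longleftrightarrow> \<alpha> \<in> Obj (arrow_cat C) \<and>
    (\<exists>f \<in> Hom (arrow_cat C) \<alpha> (Ident C (One C)). f \<in> reedy_fibrations C)"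

lemma terminal_arrow_cat:
  assumes "category C" "terminal C T"
  shows "terminal (arrow_cat C) (Ident C T)"
proof -
  interpret category C by fact
  have T: "T \<in> Obj C" and u: "\<And>A. A \<in> Obj C \<Longrightarrow> \<exists>!f. f \<in> Hom C A T" using assms(2) by (auto simp: terminal_def)
  have i: "Ident C T \<in> Arr C" "Dom C (Ident C T) = T" "Cod C (Ident C T) = T"
    using Ident_Hom[OF T] by (auto simp: Hom_def)
  show ?thesis unfolding terminal_def
  proof (intro conjI ballI)
    show "Ident C T \<in> Obj (arrow_cat C)" using i by (simp add: arrow_cat_def)
    fix \<alpha> assume "\<alpha> \<in> Obj (arrow_cat C)"
    then have a: "\<alpha> \<in> Arr C" by (simp add: arrow_cat_def)
    obtain f0 where f0: "f0 \<in> Hom C (Cod C \<alpha>) T" using u Cod_Obj[OF a] by blast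
    obtain f1 where f1: "f1 \<in> Hom C (Dom C \<alpha>) T" using u Dom_Obj[OF a] by blast
    have h: "\<alpha> \<in> Hom C (Dom C \<alpha>) (Cod C \<alpha>)" using a by (simp add: Hom_def)
    have c: "Comp C f0 \<alpha> = Comp C (Ident C T) f1"
      using Comp_Hom[OF h f0] Ident_Comp[OF f1] f1 u[OF Dom_Obj[OF a]] by metis
    show "\<exists>!f. f \<in> Hom (arrow_cat C) \<alpha> (Ident C T)"
    proof (rule ex1I[of _ "(\<alpha>, Ident C T, f1, f0)"])
      show "(\<alpha>, Ident C T, f1, f0) \<in> Hom (arrow_cat C) \<alpha> (Ident C T)"
        using a f0 f1 c i by (auto simp: arrow_cat_def Hom_def)
      fix g assume "g \<in> Hom (arrow_cat C) \<alpha> (Ident C T)"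
      then obtain g1 g0 where "g = (\<alpha>, Ident C T, g1, g0)" "g1 \<in> Hom C (Dom C \<alpha>) T" "g0 \<in> Hom C (Cod C \<alpha>) T"
        using i by (auto simp: arrow_cat_def Hom_def)
      then show "g = (\<alpha>, Ident C T, f1, f0)" using f0 f1 u Cod_Obj[OF a] Dom_Obj[OF a] by blast
    qed
  qed
qed

lemma (in type_theoretic_fibration_category) reedy_fibrant_iff:
  "reedy_fibrant C \<alpha> \<longleftrightarrow> \<alpha> \<in> Fib C"
proof (cases "\<alpha> \<in> Arr C")
  case False then show ?thesis using Fib_Arr by (auto simp: reedy_fibrant_def arrow_cat_def)
next
  case a: True
  let ?T = "One C"
  have T: "?T \<in> Obj C" and u: "\<And>A. A \<in> Obj C \<Longrightarrow> \<exists>!f. f \<in> Hom C A ?T"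
    using terminal_One by (auto simp: terminal_def)
  have uq: "x = y" if "x \<in> Hom C A ?T" "y \<in> Hom C A ?T" for A x y
  proof -
    have "A \<in> Obj C" using that(1) Dom_Obj by (auto simp: Hom_def)
    from u[OF this] that show ?thesis by blast
  qed
  have i: "Ident C ?T \<in> Arr C" "Dom C (Ident C ?T) = ?T" "Cod C (Ident C ?T) = ?T"
    and iH: "Ident C ?T \<in> Hom C ?T ?T"
    using Ident_Hom[OF T] by (auto simp: Hom_def)
  have aO: "\<alpha> \<in> Obj (arrow_cat C)" using a by (simp add: arrow_cat_def)
  have ex1: "\<exists>!f. f \<in> Hom (arrow_cat C) \<alpha> (Ident C ?T)"
    using terminal_arrow_cat[OF category_axioms terminal_One] aO unfolding terminal_def by blast
  then obtain f where f: "f \<in> Hom (arrow_cat C) \<alpha> (Ident C ?T)" by blast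
  have uf: "g = f" if "g \<in> Hom (arrow_cat C) \<alpha> (Ident C ?T)" for g
    using ex1 f that by blast
  obtain f1 f0 where ff: "f = (\<alpha>, Ident C ?T, f1, f0)" and f1: "f1 \<in> Hom C (Dom C \<alpha>) ?T"
     and f0: "f0 \<in> Hom C (Cod C \<alpha>) ?T"
    using f i by (auto simp: arrow_cat_def Hom_def)
  have f0F: "f0 \<in> Fib C" using f0 Fib_One by (auto simp: Hom_def)
  have A0: "Cod C \<alpha> \<in> Obj C" and A1: "Dom C \<alpha> \<in> Obj C" using a Cod_Obj Dom_Obj by auto
  have h: "\<alpha> \<in> Hom C (Dom C \<alpha>) (Cod C \<alpha>)" using a by (simp add: Hom_def)
  have id0: "Ident C (Cod C \<alpha>) \<in> Hom C (Cod C \<alpha>) (Cod C \<alpha>)" using Ident_Hom A0 by auto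
  have pb: "pullback C f0 (Ident C ?T) (Ident C (Cod C \<alpha>)) f0"
  proof -
    have "\<exists>!v. v \<in> Hom C S (Cod C \<alpha>) \<and> Ident C (Cod C \<alpha>) \<bullet> v = x \<and> f0 \<bullet> v = y"
      if x: "x \<in> Hom C S (Cod C \<alpha>)" and y: "y \<in> Hom C S ?T" for S x y
    proof -
      have S: "S \<in> Obj C" using x Dom_Obj by (auto simp: Hom_def)
      have "f0 \<bullet> x = y" using uq[OF Comp_Hom[OF x f0] y] .
      then show ?thesis using Ident_Comp[OF x] x
        by (intro ex1I[of _ x]) (simp, metis Ident_Comp)
    qed
    then show ?thesis unfolding pullback_def
      using f0 id0 i iH Comp_Ident[OF f0] Ident_Comp[OF f0]
      by (auto simp: Hom_def)
  qed
  have kk: "Ident C (Cod C \<alpha>) \<bullet> \<alpha> = \<alpha>" "f0 \<bullet> \<alpha> = f1"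
    using Ident_Comp[OF h] uq[OF Comp_Hom[OF h f0] f1] by auto
  have id0': "Dom C (Ident C (Cod C \<alpha>)) = Cod C \<alpha>" using id0 by (auto simp: Hom_def)
  have fw: "\<alpha> \<in> Fib C" if "f \<in> reedy_fibrations C"
    proof -
    have "\<forall>p q k. pullback C f0 (Ident C ?T) p q \<and> k \<in> Hom C (Dom C \<alpha>) (Dom C p) \<and>
        p \<bullet> k = \<alpha> \<and> q \<bullet> k = f1 \<longrightarrow> k \<in> Fib C"
      using that unfolding reedy_fibrations_def ff by blast
    then show ?thesis using pb kk h id0' by metis
  qed
  have bw: "f \<in> reedy_fibrations C" if F: "\<alpha> \<in> Fib C"
  proof -
    have "k \<in> Fib C" if pq: "pullback C f0 (Ident C ?T) p q" and k: "k \<in> Hom C (Dom C \<alpha>) (Dom C p)"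
       and pk: "p \<bullet> k = \<alpha>" and qk: "q \<bullet> k = f1" for p q k
    proof -
      have f0d: "Dom C f0 = Cod C \<alpha>" using f0 by (auto simp: Hom_def)
      have p: "p \<in> Hom C (Dom C p) (Cod C \<alpha>)" and q: "q \<in> Hom C (Dom C p) ?T"
        using pq i f0d by (auto simp: pullback_def)
      have P: "Dom C p \<in> Obj C" using p Dom_Obj by (auto simp: Hom_def)
      have un: "\<exists>!v. v \<in> Hom C S (Dom C p) \<and> p \<bullet> v = x \<and> q \<bullet> v = y"
        if "x \<in> Hom C S (Cod C \<alpha>)" "y \<in> Hom C S ?T" "f0 \<bullet> x = Ident C ?T \<bullet> y" for S x y
        using pq that i f0d unfolding pullback_def by auto
      obtain v where v: "v \<in> Hom C (Cod C \<alpha>) (Dom C p)" "p \<bullet> v = Ident C (Cod C \<alpha>)" "q \<bullet> v = f0"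
        using un[OF id0 f0] Comp_Ident[OF f0] Ident_Comp[OF f0] by auto
      have c: "f0 \<bullet> p = Ident C ?T \<bullet> q" using pq by (auto simp: pullback_def)
      have vp: "v \<bullet> p \<in> Hom C (Dom C p) (Dom C p)" using Comp_Hom p v by blast
      have 1: "p \<bullet> (v \<bullet> p) = p" using Comp_assoc[OF p v(1) p] v Ident_Comp[OF p] by simp
      have 2: "q \<bullet> (v \<bullet> p) = q" using uq[OF Comp_Hom[OF vp q] q] .
      have "v \<bullet> p = Ident C (Dom C p)"
        using un[OF p q c] vp 1 2 Ident_Hom[OF P] Comp_Ident[OF p] Comp_Ident[OF q] by blast
      then have "iso C v" using v p unfolding iso_def by (auto simp: Hom_def)
      then have vF: "v \<in> Fib C" by (rule Fib_iso)
      have "v \<bullet> \<alpha> = k" using Comp_assoc[OF k p v(1)] pk \<open>v \<bullet> p = _\<close> Ident_Comp[OF k] by simp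
      then show ?thesis using Fib_Comp[OF F vF] v(1) by (auto simp: Hom_def)
    qed
    then show ?thesis using f f0F unfolding reedy_fibrations_def ff by (auto simp: Hom_def)
  qed
  show ?thesis using fw bw f uf aO unfolding reedy_fibrant_def by blast
qed

definition reedy_fibrant_cat ::
  "('o, 'a, 'm) fibcat_scheme \<Rightarrow> ('a, 'a \<times> 'a \<times> 'a \<times> 'a) fibcat" where
  "reedy_fibrant_cat C =
    (let K = full_subcat (arrow_cat C) {\<alpha>. reedy_fibrant C \<alpha>}
     in cat.extend K (fibcat.fields (Ident C (One C)) (reedy_fibrations C \<inter> Arr K)))"

end

theory Submission
  imports Defs
begin

text \<open>Pullbacks of Reedy fibrations are computed levelwise, with gap maps of pullbacks
  and composites being pullbacks of gap maps. Since the two evaluations have right adjoints that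
  preserve fibrations, and lifts against a Reedy fibration are built first at level \<open>0\<close> and then along the
  gap map, the acyclic cofibrations are the levelwise ones; this reduces factorizations and their
  stability under pullback to \<open>C\<close>. A dependent product is a dependent product of \<open>C\<close> at level \<open>0\<close> and,
  at level \<open>1\<close>, a dependent product of a pullback of the gap map. Partial right adjoints are
  exchanged for universal arrows, so that the choice of pullbacks plays no role.\<close>

section \<open>Arrows and pullbacks in a category\<close>

text \<open>Condition (4) is the obstacle. It speaks of pullback functors whose pullbacks are chosen
  by \<open>SOME\<close>, and the choices made in the category \<open>K\<close> of Reedy fibrant
  objects and in \<open>C\<close> are unrelated: a chosen square of \<open>K\<close> consists of
  pullbacks of \<open>C\<close>, but in general not of the chosen ones. The adjunctions of
  \<open>C\<close> therefore cannot be applied level by level. What passes between the two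
  categories is the universal property of a single counit, quantified over all pullback squares
  along \<open>g\<close>. In \<open>K\<close> only one such counit per fibration has to be found;
  the action of the adjoint on arrows and the natural bijection are recovered formally. Fibrancy of
  the objects enters through the gap maps. Since the structure map \<beta> of a codomain is a
  fibration, its pullback along any bottom component \<open>f0\<close> exists, and the projection of
  that pullback to the domain of \<open>f0\<close> is again a fibration. An object with a fibration
  as gap map into such a pullback is therefore fibrant itself, which keeps pullbacks, middle objects
  of factorizations and dependent products inside \<open>K\<close>.\<close>

lemma in_HomD:
  assumes "f \<in> Hom C A B"
  shows "f \<in> Arr C" "Dom C f = A" "Cod C f = B"
  using assms by (auto simp: Hom_def)

lemma in_HomI: "\<lbrakk>f \<in> Arr C; Dom C f = A; Cod C f = B\<rbrakk> \<Longrightarrow> f \<in> Hom C A B"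
  by (auto simp: Hom_def)

context category
begin

text \<open>Typing by equations between \<open>Dom\<close> and \<open>Cod\<close> instead of
  membership in \<open>Hom\<close> lets the simplifier compute the ends of composites and discharge
  composability.\<close>

lemma comp_simps [simp]:
  assumes "f \<in> Arr C" "g \<in> Arr C" "Cod C f = Dom C g"
  shows "g \<bullet> f \<in> Arr C" "Dom C (g \<bullet> f) = Dom C f" "Cod C (g \<bullet> f) = Cod C g"
  using Comp_Hom[of f "Dom C f" "Cod C f" g "Cod C g"] assms by (auto simp: Hom_def)

lemma comp_assoc [simp]:
  assumes "f \<in> Arr C" "g \<in> Arr C" "h \<in> Arr C" "Cod C f = Dom C g" "Cod C g = Dom C h"
  shows "(h \<bullet> g) \<bullet> f = h \<bullet> (g \<bullet> f)"
  using Comp_assoc[of f "Dom C f" "Cod C f" g "Cod C g" h "Cod C h"] assms by (auto simp: Hom_def)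

text \<open>\<open>comp_assoc\<close> nests composites to the right, which hides the left-hand side
  of an equation such as \<open>g \<bullet> f = h\<close> inside
  \<open>g \<bullet> f \<bullet> x\<close>. This rule and \<open>comp_rewrite\<close> apply such an
  equation there.\<close>

lemma comp_reduce:
  assumes "g \<bullet> f = h" "f \<in> Arr C" "g \<in> Arr C" "Cod C f = Dom C g" "x \<in> Arr C" "Cod C x = Dom C f"
  shows "g \<bullet> (f \<bullet> x) = h \<bullet> x"
  using assms comp_assoc[of x f g] by simp

lemma comp_rewrite:
  assumes "g \<bullet> f = g' \<bullet> f'" "f \<in> Arr C" "g \<in> Arr C" "Cod C f = Dom C g"
    "f' \<in> Arr C" "g' \<in> Arr C" "Cod C f' = Dom C g'" "Dom C f' = Dom C f"
    "x \<in> Arr C" "Cod C x = Dom C f"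
  shows "g \<bullet> (f \<bullet> x) = g' \<bullet> (f' \<bullet> x)"
  using assms comp_assoc[of x f g] comp_assoc[of x f' g'] by simp

lemma ident_simps [simp]:
  assumes "A \<in> Obj C"
  shows "Ident C A \<in> Arr C" "Dom C (Ident C A) = A" "Cod C (Ident C A) = A"
  using Ident_Hom[OF assms] by (auto simp: Hom_def)

lemma Dom_Cod_Obj [simp]: "f \<in> Arr C \<Longrightarrow> Dom C f \<in> Obj C" "f \<in> Arr C \<Longrightarrow> Cod C f \<in> Obj C"
  by (rule Dom_Obj Cod_Obj; assumption)+

lemma comp_ident [simp]: "f \<in> Arr C \<Longrightarrow> Dom C f = A \<Longrightarrow> f \<bullet> Ident C A = f"
  using Comp_Ident[of f] by (auto simp: Hom_def)

lemma ident_comp [simp]: "f \<in> Arr C \<Longrightarrow> Cod C f = A \<Longrightarrow> Ident C A \<bullet> f = f"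
  using Ident_Comp[of f] by (auto simp: Hom_def)

lemma isoI:
  assumes "f \<in> Hom C A B" "g \<in> Hom C B A" "g \<bullet> f = Ident C A" "f \<bullet> g = Ident C B"
  shows "iso C f"
  using assms unfolding iso_def by (auto simp: Hom_def)

lemma terminal_unique:
  assumes "terminal C T" "f \<in> Hom C A T" "g \<in> Hom C A T"
  shows "f = g"
  using assms Dom_Obj unfolding terminal_def Hom_def by blast

lemma terminal_obtain:
  assumes "terminal C T" "A \<in> Obj C"
  obtains f where "f \<in> Arr C" "Dom C f = A" "Cod C f = T"
  using assms unfolding terminal_def Hom_def by blast

section \<open>Universal property of pullbacks, uniqueness and pasting\<close>

text \<open>As a rewrite rule, \<open>Cod C f = Cod C g\<close> loops with hypotheses such as \<open>Cod C h = Cod C g\<close>; it is the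
  fact skipped by selections such as \<open>(1-4,6-8)\<close>.\<close>

lemma pullback_arrs:
  assumes "pullback C f g p q"
  shows "f \<in> Arr C" "g \<in> Arr C" "p \<in> Arr C" "q \<in> Arr C"
    "Cod C f = Cod C g" "Dom C q = Dom C p" "Cod C p = Dom C f" "Cod C q = Dom C g"
  using assms unfolding pullback_def Hom_def by auto

lemma pullback_comm:
  "pullback C f g p q \<Longrightarrow> f \<bullet> p = g \<bullet> q"
  unfolding pullback_def by blast

lemma pullback_obtain:
  assumes "pullback C f g p q" "x \<in> Arr C" "y \<in> Arr C" "Cod C x = Dom C f" "Cod C y = Dom C g"
    "Dom C x = Dom C y" "f \<bullet> x = g \<bullet> y"
  obtains u where "u \<in> Arr C" "Dom C u = Dom C x" "Cod C u = Dom C p" "p \<bullet> u = x" "q \<bullet> u = y"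
proof -
  have "x \<in> Hom C (Dom C x) (Dom C f)" "y \<in> Hom C (Dom C x) (Dom C g)"
    using assms by (auto simp: Hom_def)
  then obtain u where "u \<in> Hom C (Dom C x) (Dom C p)" "p \<bullet> u = x" "q \<bullet> u = y"
    using assms(1,7) unfolding pullback_def by metis
  then show ?thesis using that by (auto simp: Hom_def)
qed

lemma pullback_cancel:
  assumes "pullback C f g p q" "u \<in> Arr C" "v \<in> Arr C" "Cod C u = Dom C p" "Cod C v = Dom C p"
    "Dom C u = Dom C v" "p \<bullet> u = p \<bullet> v" "q \<bullet> u = q \<bullet> v"
  shows "u = v"
proof -
  note a = pullback_arrs[OF assms(1)]
  have "f \<bullet> (p \<bullet> u) = g \<bullet> (q \<bullet> u)"
    using a assms(2-) by (intro comp_rewrite pullback_comm[OF assms(1)]) auto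
  moreover have "p \<bullet> u \<in> Hom C (Dom C u) (Dom C f)" "q \<bullet> u \<in> Hom C (Dom C u) (Dom C g)"
    using a assms(2-) by (auto simp: Hom_def)
  ultimately have "\<exists>!w. w \<in> Hom C (Dom C u) (Dom C p) \<and> p \<bullet> w = p \<bullet> u \<and> q \<bullet> w = q \<bullet> u"
    using assms(1) unfolding pullback_def by blast
  moreover have "u \<in> Hom C (Dom C u) (Dom C p)" "v \<in> Hom C (Dom C u) (Dom C p)"
    using assms(2-) by (auto simp: Hom_def)
  ultimately show ?thesis using assms(7,8) by metis
qed

lemma pullbackI:
  assumes "f \<in> Arr C" "g \<in> Arr C" "p \<in> Arr C" "q \<in> Arr C"
    "Cod C f = Cod C g" "Dom C q = Dom C p" "Cod C p = Dom C f" "Cod C q = Dom C g"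
    and comm: "f \<bullet> p = g \<bullet> q"
    and ex: "\<And>x y. \<lbrakk>x \<in> Arr C; y \<in> Arr C; Dom C x = Dom C y; Cod C x = Dom C f; Cod C y = Dom C g;
      f \<bullet> x = g \<bullet> y\<rbrakk> \<Longrightarrow> \<exists>u. u \<in> Arr C \<and> Dom C u = Dom C x \<and> Cod C u = Dom C p \<and> p \<bullet> u = x \<and> q \<bullet> u = y"
    and un: "\<And>u v. \<lbrakk>u \<in> Arr C; v \<in> Arr C; Dom C u = Dom C v; Cod C u = Dom C p; Cod C v = Dom C p;
      p \<bullet> u = p \<bullet> v; q \<bullet> u = q \<bullet> v\<rbrakk> \<Longrightarrow> u = v"
  shows "pullback C f g p q"
  unfolding pullback_def
proof (intro conjI allI impI)
  fix T x y
  assume *: "x \<in> Hom C T (Dom C f) \<and> y \<in> Hom C T (Dom C g) \<and> f \<bullet> x = g \<bullet> y"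
  then obtain u where "u \<in> Arr C \<and> Dom C u = Dom C x \<and> Cod C u = Dom C p \<and> p \<bullet> u = x \<and> q \<bullet> u = y"
    using ex[of x y] by (auto simp: Hom_def)
  then have u: "u \<in> Hom C T (Dom C p) \<and> p \<bullet> u = x \<and> q \<bullet> u = y"
    using * by (auto simp: Hom_def)
  show "\<exists>!u. u \<in> Hom C T (Dom C p) \<and> p \<bullet> u = x \<and> q \<bullet> u = y"
  proof (rule ex1I, rule u)
    fix v
    assume v: "v \<in> Hom C T (Dom C p) \<and> p \<bullet> v = x \<and> q \<bullet> v = y"
    show "v = u" by (rule un) (use u v in \<open>simp_all add: Hom_def\<close>)
  qed
qed (use assms in \<open>auto simp: Hom_def\<close>)

lemma pullback_sym:
  assumes "pullback C f g p q"
  shows "pullback C g f q p"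
proof -
  note [simp] = pullback_arrs[OF assms]
  show ?thesis
  proof (rule pullbackI)
    fix x y
    assume *: "x \<in> Arr C" "y \<in> Arr C" "Dom C x = Dom C y" "Cod C x = Dom C g" "Cod C y = Dom C f"
      "g \<bullet> x = f \<bullet> y"
    obtain u where "u \<in> Arr C" "Dom C u = Dom C y" "Cod C u = Dom C p" "p \<bullet> u = y" "q \<bullet> u = x"
      by (rule pullback_obtain[OF assms, of y x]) (use * in auto)
    then show "\<exists>u. u \<in> Arr C \<and> Dom C u = Dom C x \<and> Cod C u = Dom C q \<and> q \<bullet> u = x \<and> p \<bullet> u = y"
      using * by auto
  next
    fix u v
    assume "u \<in> Arr C" "v \<in> Arr C" "Dom C u = Dom C v" "Cod C u = Dom C q" "Cod C v = Dom C q"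
      "q \<bullet> u = q \<bullet> v" "p \<bullet> u = p \<bullet> v"
    then show "u = v" by - (rule pullback_cancel[OF assms], auto)
  qed (auto simp: pullback_comm[OF assms])
qed

lemma pullback_Ident_right:
  assumes "f \<in> Arr C"
  shows "pullback C f (Ident C (Cod C f)) (Ident C (Dom C f)) f"
proof -
  note [simp] = assms
  show ?thesis
  proof (rule pullbackI)
    fix x y
    assume "x \<in> Arr C" "y \<in> Arr C" "Cod C x = Dom C f" "Cod C y = Dom C (Ident C (Cod C f))"
      "f \<bullet> x = Ident C (Cod C f) \<bullet> y"
    then show "\<exists>u. u \<in> Arr C \<and> Dom C u = Dom C x \<and> Cod C u = Dom C (Ident C (Dom C f)) \<and>
        Ident C (Dom C f) \<bullet> u = x \<and> f \<bullet> u = y"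
      by (intro exI[of _ x]) auto
  qed auto
qed

lemma pullback_iso:
  assumes P: "pullback C f g p q" and P': "pullback C f g p' q'"
  obtains c d where "c \<in> Arr C" "Dom C c = Dom C p" "Cod C c = Dom C p'"
    "d \<in> Arr C" "Dom C d = Dom C p'" "Cod C d = Dom C p"
    "p' \<bullet> c = p" "q' \<bullet> c = q" "p \<bullet> d = p'" "q \<bullet> d = q'"
    "d \<bullet> c = Ident C (Dom C p)" "c \<bullet> d = Ident C (Dom C p')"
proof -
  note [simp] = pullback_arrs[OF P] pullback_arrs[OF P']
  obtain c where c [simp]: "c \<in> Arr C" "Dom C c = Dom C p" "Cod C c = Dom C p'" "p' \<bullet> c = p" "q' \<bullet> c = q"
    by (rule pullback_obtain[OF P', of p q]) (auto simp: pullback_comm[OF P])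
  obtain d where d [simp]: "d \<in> Arr C" "Dom C d = Dom C p'" "Cod C d = Dom C p" "p \<bullet> d = p'" "q \<bullet> d = q'"
    by (rule pullback_obtain[OF P, of p' q']) (auto simp: pullback_comm[OF P'])
  have "d \<bullet> c = Ident C (Dom C p)"
    by (rule pullback_cancel[OF P]) (auto simp: comp_reduce[OF d(4)] comp_reduce[OF d(5)])
  moreover have "c \<bullet> d = Ident C (Dom C p')"
    by (rule pullback_cancel[OF P']) (auto simp: comp_reduce[OF c(4)] comp_reduce[OF c(5)])
  ultimately show ?thesis using that[OF c(1-3) d(1-3) c(4,5) d(4,5)] by blast
qed

text \<open>An object isomorphic to the apex of a pullback is an apex as well. This carries
  levelwise pullbacks from a constructed square of the arrow category to an arbitrary one.\<close>

lemma pullback_transport: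
  assumes P: "pullback C f g p q"
    and c: "c \<in> Arr C" "Cod C c = Dom C p" "d \<in> Arr C" "Dom C d = Dom C p" "Cod C d = Dom C c"
      "d \<bullet> c = Ident C (Dom C c)" "c \<bullet> d = Ident C (Dom C p)"
  shows "pullback C f g (p \<bullet> c) (q \<bullet> c)"
proof -
  note [simp] = pullback_arrs[OF P] c(1-5)
  show ?thesis
  proof (rule pullbackI)
    show "f \<bullet> p \<bullet> c = g \<bullet> q \<bullet> c"
      by (rule comp_rewrite[OF pullback_comm[OF P]]) auto
  next
    fix x y
    assume *: "x \<in> Arr C" "y \<in> Arr C" "Dom C x = Dom C y" "Cod C x = Dom C f" "Cod C y = Dom C g"
      "f \<bullet> x = g \<bullet> y"
    obtain u where u: "u \<in> Arr C" "Dom C u = Dom C x" "Cod C u = Dom C p" "p \<bullet> u = x" "q \<bullet> u = y"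
      by (rule pullback_obtain[OF P, of x y]) (use * in auto)
    then show "\<exists>u. u \<in> Arr C \<and> Dom C u = Dom C x \<and> Cod C u = Dom C (p \<bullet> c) \<and>
        (p \<bullet> c) \<bullet> u = x \<and> (q \<bullet> c) \<bullet> u = y"
      by (intro exI[of _ "d \<bullet> u"]) (auto simp: comp_reduce[OF c(7)])
  next
    fix u v
    assume [simp]: "u \<in> Arr C" "v \<in> Arr C" "Dom C u = Dom C v" "Cod C u = Dom C (p \<bullet> c)"
      "Cod C v = Dom C (p \<bullet> c)" and e: "(p \<bullet> c) \<bullet> u = (p \<bullet> c) \<bullet> v" "(q \<bullet> c) \<bullet> u = (q \<bullet> c) \<bullet> v"
    have "c \<bullet> u = c \<bullet> v"
      by (rule pullback_cancel[OF P]) (use e in auto)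
    then have "d \<bullet> c \<bullet> u = d \<bullet> c \<bullet> v" by simp
    then show "u = v" by (simp add: comp_reduce[OF c(6)])
  qed auto
qed

text \<open>The leg \<open>g\<close> is fixed: pulling back a composite \<open>b \<bullet> r\<close>
  along \<open>g\<close> amounts to pulling back \<open>r\<close> along the projection
  \<open>q\<close> that belongs to \<open>b\<close>.\<close>

lemma pullback_paste:
  assumes R: "pullback C g b a q" and L: "pullback C q r x y"
  shows "pullback C g (b \<bullet> r) (a \<bullet> x) y"
proof -
  note [simp] = pullback_arrs[OF R] pullback_arrs[OF L]
  note cR = pullback_comm[OF R] and cL = pullback_comm[OF L]
  have [simp]: "Dom C b = Cod C r"
    using pullback_arrs(8)[OF R] pullback_arrs(5)[OF L] by simp
  show ?thesis
  proof (rule pullbackI)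
    have "g \<bullet> a \<bullet> x = b \<bullet> q \<bullet> x" by (rule comp_rewrite[OF cR]) auto
    then show "g \<bullet> a \<bullet> x = (b \<bullet> r) \<bullet> y" by (simp add: cL)
  next
    fix s t
    assume [simp]: "s \<in> Arr C" "t \<in> Arr C" "Dom C s = Dom C t" "Cod C s = Dom C g" "Cod C t = Dom C (b \<bullet> r)"
      and e: "g \<bullet> s = (b \<bullet> r) \<bullet> t"
    obtain u where u[simp]: "u \<in> Arr C" "Dom C u = Dom C s" "Cod C u = Dom C a" "a \<bullet> u = s" "q \<bullet> u = r \<bullet> t"
      by (rule pullback_obtain[OF R, of s "r \<bullet> t"]) (use e in auto)
    obtain v where v: "v \<in> Arr C" "Dom C v = Dom C u" "Cod C v = Dom C x" "x \<bullet> v = u" "y \<bullet> v = t"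
      by (rule pullback_obtain[OF L, of u t]) auto
    then show "\<exists>u. u \<in> Arr C \<and> Dom C u = Dom C s \<and> Cod C u = Dom C (a \<bullet> x) \<and> (a \<bullet> x) \<bullet> u = s \<and> y \<bullet> u = t"
      by (intro exI[of _ v]) auto
  next
    fix u v
    assume [simp]: "u \<in> Arr C" "v \<in> Arr C" "Dom C u = Dom C v" "Cod C u = Dom C (a \<bullet> x)"
      "Cod C v = Dom C (a \<bullet> x)" and e: "(a \<bullet> x) \<bullet> u = (a \<bullet> x) \<bullet> v" "y \<bullet> u = y \<bullet> v"
    have cu: "q \<bullet> x \<bullet> u = r \<bullet> y \<bullet> u" and cv: "q \<bullet> x \<bullet> v = r \<bullet> y \<bullet> v"
      by (rule comp_rewrite[OF cL]; simp)+
    have "x \<bullet> u = x \<bullet> v"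
      by (rule pullback_cancel[OF R]) (use e cu cv in auto)
    then show "u = v" by - (rule pullback_cancel[OF L], use e in auto)
  qed auto
qed

text \<open>A map into the outer pullback is known from its composite with \<open>x\<close>, because
  \<open>a'\<close> factors through \<open>x\<close>. The purpose is to recognize a given pullback
  along \<open>g\<close> as a pullback along \<open>q\<close>, so that a dependent product along
  \<open>q\<close> can be applied to it.\<close>

lemma pullback_unpaste:
  assumes R: "pullback C g b a q" and O: "pullback C g (b \<bullet> r) a' y"
    and r: "r \<in> Arr C" "Cod C r = Dom C b"
    and x: "x \<in> Arr C" "Dom C x = Dom C y" "Cod C x = Dom C a" "a \<bullet> x = a'" "q \<bullet> x = r \<bullet> y"
  shows "pullback C q r x y"
proof -
  note [simp] = pullback_arrs(1-4)[OF R] pullback_arrs(5-)[OF R] r x(1-3) 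
  note [simp] = pullback_arrs[OF O, simplified]
  have oc: "g \<bullet> a' = b \<bullet> r \<bullet> y" using pullback_comm[OF O] by simp
  show ?thesis
  proof (rule pullbackI)
    fix s t
    assume [simp]: "s \<in> Arr C" "t \<in> Arr C" "Dom C s = Dom C t" "Cod C s = Dom C q" "Cod C t = Dom C r"
      and e: "q \<bullet> s = r \<bullet> t"
    have e': "g \<bullet> a \<bullet> s = b \<bullet> q \<bullet> s" by (rule comp_rewrite[OF pullback_comm[OF R]]) auto
    obtain u where u: "u \<in> Arr C" "Dom C u = Dom C (a \<bullet> s)" "Cod C u = Dom C a'" "a' \<bullet> u = a \<bullet> s" "y \<bullet> u = t"
      by (rule pullback_obtain[OF O, of "a \<bullet> s" t]) (use e e' in auto)
    have [simp]: "u \<in> Arr C" "Dom C u = Dom C t" "Cod C u = Dom C a'" using u by auto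
    have "x \<bullet> u = s"
    proof (rule pullback_cancel[OF R])
      show "a \<bullet> x \<bullet> u = a \<bullet> s" using u comp_reduce[OF x(4), of u] by auto
      show "q \<bullet> x \<bullet> u = q \<bullet> s" using u e comp_rewrite[OF x(5), of u] by auto
    qed auto
    then show "\<exists>u. u \<in> Arr C \<and> Dom C u = Dom C s \<and> Cod C u = Dom C x \<and> x \<bullet> u = s \<and> y \<bullet> u = t"
      using u by (intro exI[of _ u]) auto
  next
    fix u v
    assume [simp]: "u \<in> Arr C" "v \<in> Arr C" "Dom C u = Dom C v" "Cod C u = Dom C x"
      "Cod C v = Dom C x" and e: "x \<bullet> u = x \<bullet> v" "y \<bullet> u = y \<bullet> v"
    show "u = v"
      by (rule pullback_cancel[OF O])
        (use e comp_reduce[OF x(4), of u] comp_reduce[OF x(4), of v] in auto)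
  qed (use x in auto)
qed

end

section \<open>Partial right adjoints from universal arrows\<close>

text \<open>A terminal object of the comma category of the functor over \<open>X\<close>. A partial
  right adjoint amounts to one of these for each object of its domain, with no bijection or action
  on arrows to carry along.\<close>

definition couniversal ::
  "('o, 'a, 'm) cat_scheme \<Rightarrow> ('p, 'b, 'n) cat_scheme \<Rightarrow> ('o \<Rightarrow> 'p) \<Rightarrow> ('a \<Rightarrow> 'b) \<Rightarrow> 'p \<Rightarrow> 'o \<Rightarrow> 'b \<Rightarrow> bool" where
  "couniversal D E Fo Fa X R e \<longleftrightarrow> R \<in> Obj D \<and> e \<in> Hom E (Fo R) X \<and>
    (\<forall>Y \<in> Obj D. \<forall>k \<in> Hom E (Fo Y) X. \<exists>!y. y \<in> Hom D Y R \<and> Comp E e (Fa y) = k)"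

lemma (in category) category_full_subcat: "category (full_subcat C S)"
  by unfold_locales (auto simp: full_subcat_def Hom_def)

text \<open>The counit is the preimage of the identity under the adjunction bijection. Naturality at
  the counit, with an identity in the other variable, makes \<open>\<phi>\<close> a left inverse of
  composition with it; injectivity of \<open>\<phi>\<close> gives the other direction.\<close>

lemma couniversal_of_partial_right_adjoint:
  assumes "partial_right_adjoint D E Fo Fa S Ro Ra \<phi>" "X \<in> S"
  shows "\<exists>e. couniversal D E Fo Fa X (Ro X) e"
proof -
  interpret partial_right_adjoint D E Fo Fa S Ro Ra \<phi> by fact
  have XE: "X \<in> Obj E" and Xs: "X \<in> Obj (full_subcat E S)"
    using assms(2) subset_Obj by (auto simp: full_subcat_def)
  have R: "Ro X \<in> Obj D" by (rule right.map_Obj[OF Xs])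
  define e where "e = inv_into (Hom E (Fo (Ro X)) X) (\<phi> (Ro X) X) (Ident D (Ro X))"
  have b: "bij_betw (\<phi> (Ro X) X) (Hom E (Fo (Ro X)) X) (Hom D (Ro X) (Ro X))"
    by (rule bij[OF R assms(2)])
  have i: "Ident D (Ro X) \<in> Hom D (Ro X) (Ro X)" by (rule left.dom.Ident_Hom[OF R])
  have e: "e \<in> Hom E (Fo (Ro X)) X" and \<phi>e: "\<phi> (Ro X) X e = Ident D (Ro X)"
    unfolding e_def using b i by (auto simp: bij_betw_def inv_into_into f_inv_into_f)
  have iX: "Ident E X \<in> Hom E X X" by (rule left.cod.Ident_Hom[OF XE])
  have RaI: "Ra (Ident E X) = Ident D (Ro X)"
    using right.map_Ident[OF Xs] by (simp add: full_subcat_def)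
  have key: "\<phi> Y X (Comp E e (Fa y)) = y" if y: "y \<in> Hom D Y (Ro X)" for Y y
  proof -
    have "Comp E e (Fa y) \<in> Hom E (Fo Y) X"
      by (rule left.cod.Comp_Hom[OF left.map_Hom[OF y] e])
    then show ?thesis
      using natural[OF assms(2) assms(2) y e iX] \<phi>e RaI left.cod.Ident_Comp
        left.dom.Ident_Comp[OF y] by metis
  qed
  have "\<exists>!y. y \<in> Hom D Y (Ro X) \<and> Comp E e (Fa y) = k"
    if Y: "Y \<in> Obj D" and k: "k \<in> Hom E (Fo Y) X" for Y k
  proof (rule ex1I)
    have b: "bij_betw (\<phi> Y X) (Hom E (Fo Y) X) (Hom D Y (Ro X))" by (rule bij[OF Y assms(2)])
    have y: "\<phi> Y X k \<in> Hom D Y (Ro X)" using b k by (auto simp: bij_betw_def)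
    have "Comp E e (Fa (\<phi> Y X k)) \<in> Hom E (Fo Y) X"
      by (rule left.cod.Comp_Hom[OF left.map_Hom[OF y] e])
    then show "\<phi> Y X k \<in> Hom D Y (Ro X) \<and> Comp E e (Fa (\<phi> Y X k)) = k"
      using y key[OF y] b k by (auto simp: bij_betw_def inj_on_def)
  qed (use key in auto)
  then show ?thesis using R e unfolding couniversal_def by blast
qed

text \<open>\<open>\<phi>\<close> sends an arrow to its unique factorization through the counit, and
  \<open>Ra x\<close> is the factorization of \<open>x\<close> after the counit. Functoriality and
  naturality are then instances of uniqueness, packaged in \<open>Ra_eq\<close> and
  \<open>\<phi>_eq\<close>.\<close>

lemma partial_right_adjoint_of_couniversal:
  assumes F: "cat_functor D E Fo Fa" and S: "S \<subseteq> Obj E"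
    and u: "\<And>X. X \<in> S \<Longrightarrow> couniversal D E Fo Fa X (Ro X) (e X)"
  shows "\<exists>Ra \<phi>. partial_right_adjoint D E Fo Fa S Ro Ra \<phi>"
proof -
  interpret cat_functor D E Fo Fa by fact
  interpret full: category "full_subcat E S" by (rule cod.category_full_subcat)
  define \<phi> where "\<phi> Y X k = (THE y. y \<in> Hom D Y (Ro X) \<and> Comp E (e X) (Fa y) = k)" for Y X k
  define Ra where "Ra x = \<phi> (Ro (Dom E x)) (Cod E x) (Comp E x (e (Dom E x)))" for x
  have R: "Ro X \<in> Obj D" and e: "e X \<in> Hom E (Fo (Ro X)) X" if "X \<in> S" for X
    using u[OF that] unfolding couniversal_def by auto
  have ex1: "\<exists>!y. y \<in> Hom D Y (Ro X) \<and> Comp E (e X) (Fa y) = k"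
    if "X \<in> S" "Y \<in> Obj D" "k \<in> Hom E (Fo Y) X" for X Y k
    using u[OF that(1)] that(2,3) unfolding couniversal_def by blast
  have \<phi>: "\<phi> Y X k \<in> Hom D Y (Ro X)" "Comp E (e X) (Fa (\<phi> Y X k)) = k"
    if "X \<in> S" "Y \<in> Obj D" "k \<in> Hom E (Fo Y) X" for X Y k
    using theI'[OF ex1[OF that]] unfolding \<phi>_def by auto
  have \<phi>_eq: "\<phi> Y X k = y"
    if X: "X \<in> S" and y: "y \<in> Hom D Y (Ro X)" and k: "Comp E (e X) (Fa y) = k" for X Y k y
  proof -
    have "Y \<in> Obj D" using y dom.Dom_Obj by (auto simp: Hom_def)
    moreover have "k \<in> Hom E (Fo Y) X"
      using cod.Comp_Hom[OF map_Hom[OF y] e[OF X]] k by simp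
    ultimately show ?thesis using \<phi>[OF X] ex1[OF X] y k by blast
  qed
  have Ra: "Ra x \<in> Hom D (Ro X) (Ro X')" "Comp E (e X') (Fa (Ra x)) = Comp E x (e X)"
    if "X \<in> S" "X' \<in> S" "x \<in> Hom E X X'" for x X X'
    using \<phi>[OF that(2) R[OF that(1)] cod.Comp_Hom[OF e[OF that(1)] that(3)]] in_HomD[OF that(3)]
    by (simp_all add: Ra_def)
  have Ra_eq: "Ra x = r"
    if "X \<in> S" "X' \<in> S" "x \<in> Hom E X X'" "r \<in> Hom D (Ro X) (Ro X')"
      "Comp E (e X') (Fa r) = Comp E x (e X)" for x X X' r
    using \<phi>_eq[OF that(2,4,5)] in_HomD[OF that(3)] by (simp add: Ra_def)
  have "partial_right_adjoint D E Fo Fa S Ro Ra \<phi>"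
  proof unfold_locales
    fix X assume "X \<in> Obj (full_subcat E S)"
    then have X: "X \<in> S" "X \<in> Obj E" by (auto simp: full_subcat_def)
    show "Ro X \<in> Obj D" by (rule R[OF X(1)])
    show "Ra (Ident (full_subcat E S) X) = Ident D (Ro X)"
      using Ra_eq[OF X(1) X(1) cod.Ident_Hom[OF X(2)] dom.Ident_Hom[OF R[OF X(1)]]]
        map_Ident[OF R[OF X(1)]] cod.Ident_Comp[OF e[OF X(1)]] cod.Comp_Ident[OF e[OF X(1)]]
      by (simp add: full_subcat_def)
  next
    fix f A B assume "f \<in> Hom (full_subcat E S) A B"
    then have "A \<in> S" "B \<in> S" "f \<in> Hom E A B" by (auto simp: full_subcat_def Hom_def)
    then show "Ra f \<in> Hom D (Ro A) (Ro B)" by (rule Ra)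
  next
    fix f A B g B' assume "f \<in> Hom (full_subcat E S) A B" "g \<in> Hom (full_subcat E S) B B'"
    then have *: "A \<in> S" "B \<in> S" "B' \<in> S" and f: "f \<in> Hom E A B" and g: "g \<in> Hom E B B'"
      by (auto simp: full_subcat_def Hom_def)
    note rf = Ra[OF *(1,2) f] and rg = Ra[OF *(2,3) g]
    have "Comp E (e B') (Fa (Comp D (Ra g) (Ra f))) = Comp E (Comp E g f) (e A)"
      using map_Comp[OF rf(1) rg(1)] cod.Comp_assoc[OF map_Hom[OF rf(1)] map_Hom[OF rg(1)] e[OF *(3)]]
        cod.Comp_assoc[OF map_Hom[OF rf(1)] e[OF *(2)] g] cod.Comp_assoc[OF e[OF *(1)] f g] rf(2) rg(2)
      by simp
    from Ra_eq[OF *(1,3) cod.Comp_Hom[OF f g] dom.Comp_Hom[OF rf(1) rg(1)] this]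
    show "Ra (Comp (full_subcat E S) g f) = Comp D (Ra g) (Ra f)" by (simp add: full_subcat_def)
  next
    fix Y X assume Y: "Y \<in> Obj D" and X: "X \<in> S"
    show "bij_betw (\<phi> Y X) (Hom E (Fo Y) X) (Hom D Y (Ro X))"
      by (rule bij_betw_byWitness[where f' = "\<lambda>y. Comp E (e X) (Fa y)"])
        (use \<phi>[OF X Y] \<phi>_eq[OF X] cod.Comp_Hom[OF map_Hom e[OF X]] in auto)
  next
    fix X X' y Y' Y k x
    assume X: "X \<in> S" "X' \<in> S" and y: "y \<in> Hom D Y' Y" and k: "k \<in> Hom E (Fo Y) X"
      and x: "x \<in> Hom E X X'"
    have Y: "Y \<in> Obj D" using y dom.Cod_Obj by (auto simp: Hom_def)
    note rx = Ra[OF X x] and p = \<phi>[OF X(1) Y k]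
    note py = dom.Comp_Hom[OF y p(1)]
    show "\<phi> Y' X' (Comp E x (Comp E k (Fa y))) = Comp D (Ra x) (Comp D (\<phi> Y X k) y)"
      by (rule \<phi>_eq[OF X(2)])
        (use rx p py dom.Comp_Hom[OF py rx(1)] map_Comp[OF py rx(1)] map_Comp[OF y p(1)]
          cod.Comp_assoc[OF cod.Comp_Hom[OF map_Hom[OF y] map_Hom[OF p(1)]] map_Hom[OF rx(1)] e[OF X(2)]]
          cod.Comp_assoc[OF cod.Comp_Hom[OF map_Hom[OF y] map_Hom[OF p(1)]] e[OF X(1)] x]
          cod.Comp_assoc[OF map_Hom[OF y] map_Hom[OF p(1)] e[OF X(1)]]
         in auto)
  qed (rule S)
  then show ?thesis by blast
qed

section \<open>Dependent products\<close>

lemma Hom_slice: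
  "Hom (slice C B) h k = {(h, k, u) |u. h \<in> Arr C \<and> Cod C h = B \<and> k \<in> Arr C \<and> Cod C k = B \<and>
    u \<in> Arr C \<and> Dom C u = Dom C h \<and> Cod C u = Dom C k \<and> Comp C k u = h}"
  by (auto simp: slice_def Hom_def)

lemma Comp_slice: "Comp (slice C B) (k', l, v) (h, k, u) = (h, l, Comp C v u)"
  by (simp add: slice_def)

text \<open>The map \<open>\<epsilon> : g\<^sup>*\<pi> \<rightarrow> f\<close> over \<open>Dom C g\<close> is the counit of a dependent product \<open>\<pi>\<close> of \<open>f\<close> along \<open>g\<close>.
  Its universal property is stated for arbitrary pullbacks along \<open>g\<close> instead of the chosen ones.\<close>

definition dependent_product ::
  "('o, 'a, 'm) cat_scheme \<Rightarrow> 'a \<Rightarrow> 'a \<Rightarrow> 'a \<Rightarrow> 'a \<Rightarrow> 'a \<Rightarrow> 'a \<Rightarrow> bool" where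
  "dependent_product C g f \<pi> p q \<epsilon> \<longleftrightarrow> f \<in> Arr C \<and> Cod C f = Dom C g \<and> pullback C g \<pi> p q \<and>
    \<epsilon> \<in> Hom C (Dom C p) (Dom C f) \<and> Comp C f \<epsilon> = p \<and>
    (\<forall>z p' q' h. pullback C g z p' q' \<and> h \<in> Hom C (Dom C p') (Dom C f) \<and> Comp C f h = p' \<longrightarrow>
      (\<exists>!s. s \<in> Hom C (Dom C z) (Dom C \<pi>) \<and> Comp C \<pi> s = z \<and>
        (\<forall>w \<in> Hom C (Dom C p') (Dom C p).
          Comp C p w = p' \<and> Comp C q w = Comp C s q' \<longrightarrow> Comp C \<epsilon> w = h)))"

lemma dependent_productD:
  assumes "dependent_product C g f \<pi> p q \<epsilon>"
  shows "f \<in> Arr C" "Cod C f = Dom C g" "pullback C g \<pi> p q"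
    "\<epsilon> \<in> Arr C" "Dom C \<epsilon> = Dom C p" "Cod C \<epsilon> = Dom C f" "Comp C f \<epsilon> = p"
proof -
  have "\<epsilon> \<in> Hom C (Dom C p) (Dom C f)" using assms unfolding dependent_product_def by blast
  then show "\<epsilon> \<in> Arr C" "Dom C \<epsilon> = Dom C p" "Cod C \<epsilon> = Dom C f" by (auto simp: Hom_def)
qed (use assms in \<open>unfold dependent_product_def, blast+\<close>)

context category
begin

lemma category_slice: "category (slice C B)"
proof
  fix f assume "f \<in> Arr (slice C B)"
  then show "Dom (slice C B) f \<in> Obj (slice C B)" "Cod (slice C B) f \<in> Obj (slice C B)"
    by (auto simp: slice_def)
next
  fix A assume "A \<in> Obj (slice C B)"
  then show "Ident (slice C B) A \<in> Hom (slice C B) A A"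
    by (auto simp: slice_def Hom_def)
next
  fix f A B' g D
  assume "f \<in> Hom (slice C B) A B'" "g \<in> Hom (slice C B) B' D"
  then obtain u v where *: "f = (A, B', u)" "g = (B', D, v)" "A \<in> Arr C" "Cod C A = B" "B' \<in> Arr C"
    "D \<in> Arr C" "Cod C D = B" "u \<in> Arr C" "Dom C u = Dom C A" "Cod C u = Dom C B'" "B' \<bullet> u = A"
    "v \<in> Arr C" "Dom C v = Dom C B'" "Cod C v = Dom C D" "D \<bullet> v = B'"
    unfolding Hom_slice by blast
  then have "D \<bullet> v \<bullet> u = A" using comp_reduce[of D v B' u] by simp
  then show "Comp (slice C B) g f \<in> Hom (slice C B) A D"
    using * unfolding Hom_slice by (simp add: slice_def)
next
  fix f A B'
  assume "f \<in> Hom (slice C B) A B'"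
  then obtain u where "f = (A, B', u)" "u \<in> Arr C" "Dom C u = Dom C A" "Cod C u = Dom C B'"
    unfolding Hom_slice by blast
  then show "Comp (slice C B) f (Ident (slice C B) A) = f" "Comp (slice C B) (Ident (slice C B) B') f = f"
    by (simp_all add: slice_def)
next
  fix f g h A B' D E
  assume "f \<in> Hom (slice C B) A B'" "g \<in> Hom (slice C B) B' D" "h \<in> Hom (slice C B) D E"
  then obtain u v w where "f = (A, B', u)" "g = (B', D, v)" "h = (D, E, w)"
    "u \<in> Arr C" "Cod C u = Dom C B'" "v \<in> Arr C" "Dom C v = Dom C B'" "Cod C v = Dom C D"
    "w \<in> Arr C" "Dom C w = Dom C D"
    unfolding Hom_slice by blast
  then show "Comp (slice C B) (Comp (slice C B) h g) f = Comp (slice C B) h (Comp (slice C B) g f)"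
    by (simp add: slice_def)
qed

text \<open>The definition only constrains comparison maps \<open>w\<close> between the two
  pullbacks. One always exists, as the map into \<open>p\<close> and \<open>q\<close> induced by
  \<open>p'\<close> and \<open>s \<bullet> q'\<close>, so it can be delivered together with
  \<open>s\<close>.\<close>

lemma dependent_product_obtain:
  assumes dp: "dependent_product C g f \<pi> p q \<epsilon>" and P: "pullback C g z p' q'"
    and h: "h \<in> Arr C" "Dom C h = Dom C p'" "Cod C h = Dom C f" "f \<bullet> h = p'"
  obtains s w where "s \<in> Arr C" "Dom C s = Dom C z" "Cod C s = Dom C \<pi>" "\<pi> \<bullet> s = z"
    "w \<in> Arr C" "Dom C w = Dom C p'" "Cod C w = Dom C p" "p \<bullet> w = p'" "q \<bullet> w = s \<bullet> q'" "\<epsilon> \<bullet> w = h"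
proof -
  note R = dependent_productD(3)[OF dp]
  note [simp] = pullback_arrs[OF R] pullback_arrs[OF P]
  have "\<exists>!s. s \<in> Hom C (Dom C z) (Dom C \<pi>) \<and> \<pi> \<bullet> s = z \<and>
        (\<forall>w \<in> Hom C (Dom C p') (Dom C p). p \<bullet> w = p' \<and> q \<bullet> w = s \<bullet> q' \<longrightarrow> \<epsilon> \<bullet> w = h)"
    using dp P in_HomI[OF h(1-3)] h(4) unfolding dependent_product_def by blast
  then obtain s where s: "s \<in> Hom C (Dom C z) (Dom C \<pi>)" "\<pi> \<bullet> s = z"
     and sw: "\<And>w. \<lbrakk>w \<in> Hom C (Dom C p') (Dom C p); p \<bullet> w = p'; q \<bullet> w = s \<bullet> q'\<rbrakk> \<Longrightarrow> \<epsilon> \<bullet> w = h"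
    by blast
  note [simp] = in_HomD[OF s(1)]
  obtain w where w: "w \<in> Arr C" "Dom C w = Dom C p'" "Cod C w = Dom C p" "p \<bullet> w = p'" "q \<bullet> w = s \<bullet> q'"
    by (rule pullback_obtain[OF R, of p' "s \<bullet> q'"])
       (auto simp: pullback_comm[OF P] comp_reduce[OF s(2)])
  show ?thesis
    by (rule that[of s w]) (use s w sw[OF in_HomI[OF w(1-3)] w(4,5)] in auto)
qed

text \<open>The comparison map of a given \<open>s\<close> is unique. Hence agreement on the single
  maps \<open>v\<close> and \<open>w\<close> already says that \<open>s\<close> and \<open>t\<close>
  are both transposes of \<open>\<epsilon> \<bullet> v\<close>.\<close>

lemma dependent_product_cancel:
  assumes dp: "dependent_product C g f \<pi> p q \<epsilon>" and P: "pullback C g z p' q'"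
    and s: "s \<in> Arr C" "Dom C s = Dom C z" "Cod C s = Dom C \<pi>" "\<pi> \<bullet> s = z"
    and t: "t \<in> Arr C" "Dom C t = Dom C z" "Cod C t = Dom C \<pi>" "\<pi> \<bullet> t = z"
    and v: "v \<in> Arr C" "Dom C v = Dom C p'" "Cod C v = Dom C p" "p \<bullet> v = p'" "q \<bullet> v = s \<bullet> q'"
    and w: "w \<in> Arr C" "Dom C w = Dom C p'" "Cod C w = Dom C p" "p \<bullet> w = p'" "q \<bullet> w = t \<bullet> q'"
    and e: "\<epsilon> \<bullet> v = \<epsilon> \<bullet> w"
  shows "s = t"
proof -
  have R: "pullback C g \<pi> p q" and f: "f \<in> Arr C" "Cod C f = Dom C g"
    and \<epsilon>: "\<epsilon> \<in> Arr C" "Dom C \<epsilon> = Dom C p" "Cod C \<epsilon> = Dom C f" "f \<bullet> \<epsilon> = p"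
    using dependent_productD[OF dp] by simp_all
  note [simp] = pullback_arrs[OF R] pullback_arrs[OF P] f \<epsilon>(1-3)
  have h: "\<epsilon> \<bullet> v \<in> Hom C (Dom C p') (Dom C f)" "f \<bullet> \<epsilon> \<bullet> v = p'"
    using v comp_reduce[OF \<epsilon>(4), of v] by (auto simp: Hom_def)
  have "\<exists>!s. s \<in> Hom C (Dom C z) (Dom C \<pi>) \<and> \<pi> \<bullet> s = z \<and>
        (\<forall>w \<in> Hom C (Dom C p') (Dom C p). p \<bullet> w = p' \<and> q \<bullet> w = s \<bullet> q' \<longrightarrow> \<epsilon> \<bullet> w = \<epsilon> \<bullet> v)"
    using dp P h unfolding dependent_product_def by blast
  moreover have "v' = v" if "v' \<in> Hom C (Dom C p') (Dom C p)" "p \<bullet> v' = p'" "q \<bullet> v' = s \<bullet> q'" for v'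
    by (rule pullback_cancel[OF R]) (use in_HomD[OF that(1)] that v in auto)
  moreover have "w' = w" if "w' \<in> Hom C (Dom C p') (Dom C p)" "p \<bullet> w' = p'" "q \<bullet> w' = t \<bullet> q'" for w'
    by (rule pullback_cancel[OF R]) (use in_HomD[OF that(1)] that w in auto)
  ultimately show ?thesis using in_HomI[OF s(1-3)] in_HomI[OF t(1-3)] s(4) t(4) e by metis
qed

text \<open>Since comparison maps are unique, exhibiting one for each \<open>s\<close> replaces the
  inner universal quantifier of the definition, and uniqueness of transposes becomes a cancellation
  law.\<close>

lemma dependent_productI:
  assumes f: "f \<in> Arr C" "Cod C f = Dom C g" and P: "pullback C g \<pi> p q"
    and \<epsilon>: "\<epsilon> \<in> Arr C" "Dom C \<epsilon> = Dom C p" "Cod C \<epsilon> = Dom C f" "f \<bullet> \<epsilon> = p"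
    and ex: "\<And>z p' q' h. \<lbrakk>pullback C g z p' q'; h \<in> Arr C; Dom C h = Dom C p'; Cod C h = Dom C f; f \<bullet> h = p'\<rbrakk> \<Longrightarrow>
      \<exists>s w. s \<in> Arr C \<and> Dom C s = Dom C z \<and> Cod C s = Dom C \<pi> \<and> \<pi> \<bullet> s = z \<and>
    w \<in> Arr C \<and> Dom C w = Dom C p' \<and> Cod C w = Dom C p \<and> p \<bullet> w = p' \<and> q \<bullet> w = s \<bullet> q' \<and> \<epsilon> \<bullet> w = h"
    and un: "\<And>z p' q' s t v w. \<lbrakk>pullback C g z p' q';
      s \<in> Arr C; Dom C s = Dom C z; Cod C s = Dom C \<pi>; \<pi> \<bullet> s = z;
      t \<in> Arr C; Dom C t = Dom C z; Cod C t = Dom C \<pi>; \<pi> \<bullet> t = z;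
      v \<in> Arr C; Dom C v = Dom C p'; Cod C v = Dom C p; p \<bullet> v = p'; q \<bullet> v = s \<bullet> q';
      w \<in> Arr C; Dom C w = Dom C p'; Cod C w = Dom C p; p \<bullet> w = p'; q \<bullet> w = t \<bullet> q';
      \<epsilon> \<bullet> v = \<epsilon> \<bullet> w\<rbrakk> \<Longrightarrow> s = t"
  shows "dependent_product C g f \<pi> p q \<epsilon>"
  unfolding dependent_product_def
proof (intro conjI allI impI)
  fix z p' q' h
  assume "pullback C g z p' q' \<and> h \<in> Hom C (Dom C p') (Dom C f) \<and> f \<bullet> h = p'"
  then have P': "pullback C g z p' q'" and h: "h \<in> Hom C (Dom C p') (Dom C f)" "f \<bullet> h = p'" by auto
  note [simp] = pullback_arrs[OF P] pullback_arrs[OF P']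
  obtain s w where s: "s \<in> Arr C" "Dom C s = Dom C z" "Cod C s = Dom C \<pi>" "\<pi> \<bullet> s = z"
    and w: "w \<in> Arr C" "Dom C w = Dom C p'" "Cod C w = Dom C p" "p \<bullet> w = p'" "q \<bullet> w = s \<bullet> q'" "\<epsilon> \<bullet> w = h"
    using ex[OF P' in_HomD[OF h(1)] h(2)] by blast
  have wu: "w' = w" if "w' \<in> Hom C (Dom C p') (Dom C p)" "p \<bullet> w' = p'" "q \<bullet> w' = s \<bullet> q'" for w'
    by (rule pullback_cancel[OF P]) (use in_HomD[OF that(1)] that w in auto)
  show "\<exists>!s. s \<in> Hom C (Dom C z) (Dom C \<pi>) \<and> \<pi> \<bullet> s = z \<and>
        (\<forall>w \<in> Hom C (Dom C p') (Dom C p). p \<bullet> w = p' \<and> q \<bullet> w = s \<bullet> q' \<longrightarrow> \<epsilon> \<bullet> w = h)"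
  proof (rule ex1I[of _ s])
    show "s \<in> Hom C (Dom C z) (Dom C \<pi>) \<and> \<pi> \<bullet> s = z \<and>
        (\<forall>w \<in> Hom C (Dom C p') (Dom C p). p \<bullet> w = p' \<and> q \<bullet> w = s \<bullet> q' \<longrightarrow> \<epsilon> \<bullet> w = h)"
      using in_HomI[OF s(1-3)] s(4) wu w(6) by blast
    fix t
    assume "t \<in> Hom C (Dom C z) (Dom C \<pi>) \<and> \<pi> \<bullet> t = z \<and>
        (\<forall>w \<in> Hom C (Dom C p') (Dom C p). p \<bullet> w = p' \<and> q \<bullet> w = t \<bullet> q' \<longrightarrow> \<epsilon> \<bullet> w = h)"
    then have tH: "t \<in> Hom C (Dom C z) (Dom C \<pi>)" and t4: "\<pi> \<bullet> t = z"
      and te: "\<And>w. \<lbrakk>w \<in> Hom C (Dom C p') (Dom C p); p \<bullet> w = p'; q \<bullet> w = t \<bullet> q'\<rbrakk> \<Longrightarrow> \<epsilon> \<bullet> w = h"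
      by blast+
    note t = in_HomD[OF tH] t4
    note [simp] = t(1-3)
    obtain v where v: "v \<in> Arr C" "Dom C v = Dom C p'" "Cod C v = Dom C p" "p \<bullet> v = p'" "q \<bullet> v = t \<bullet> q'"
      by (rule pullback_obtain[OF P, of p' "t \<bullet> q'"])
        (auto simp: pullback_comm[OF P'] comp_reduce[OF t(4)])
    show "t = s"
      by (rule un[OF P' t s v w(1-5)]) (use te[OF in_HomI[OF v(1-3)] v(4,5)] w in auto)
  qed
qed (use assms in \<open>auto simp: Hom_def\<close>)

end

text \<open>The pullback functor requires of \<open>g\<close> that pullbacks along it exist.
  Isolating this lets the results below be interpreted in \<open>C\<close> and also in
  \<open>K\<close>, before \<open>K\<close> is known to be a type-theoretic fibration
  category.\<close>

locale pullback_along = category C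
  for C :: "('o, 'a, 'm) cat_scheme" (structure) +
  fixes g :: 'a
  assumes g: "g \<in> Arr C"
    and pullback_ex: "\<lbrakk>h \<in> Arr C; Cod C h = Cod C g\<rbrakk> \<Longrightarrow> \<exists>p q. pullback C g h p q"
begin

definition pullback_top where "pullback_top h = snd (chosen_pullback C g h)"

lemma chosen:
  assumes "h \<in> Arr C" "Cod C h = Cod C g"
  shows "pullback C g h (pullback_obj C g h) (pullback_top h)"
proof -
  have "\<exists>x. (case x of (p, q) \<Rightarrow> pullback C g h p q)" using pullback_ex[OF assms] by auto
  from someI_ex[OF this] show ?thesis
    unfolding pullback_obj_def pullback_top_def chosen_pullback_def by (simp add: case_prod_unfold)
qed

text \<open>Eliminates the description \<open>THE\<close> in \<open>pullback_arr\<close> once and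
  for all: any map with the right projections is the value.\<close>

lemma pullback_arr_eq:
  assumes k: "k \<in> Arr C" "Cod C k = Cod C g" and u: "u \<in> Arr C" "Cod C u = Dom C k" "k \<bullet> u = h"
    and w: "w \<in> Arr C" "Dom C w = Dom C (pullback_obj C g h)" "Cod C w = Dom C (pullback_obj C g k)"
      "pullback_obj C g k \<bullet> w = pullback_obj C g h" "pullback_top k \<bullet> w = u \<bullet> pullback_top h"
  shows "pullback_arr C g (h, k, u) = (pullback_obj C g h, pullback_obj C g k, w)"
proof -
  have "(THE w. w \<in> Hom C (Dom C (pullback_obj C g h)) (Dom C (pullback_obj C g k)) \<and>
      pullback_obj C g k \<bullet> w = pullback_obj C g h \<and> pullback_top k \<bullet> w = u \<bullet> pullback_top h) = w"
  proof (rule the_equality)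
    show "w \<in> Hom C (Dom C (pullback_obj C g h)) (Dom C (pullback_obj C g k)) \<and>
      pullback_obj C g k \<bullet> w = pullback_obj C g h \<and> pullback_top k \<bullet> w = u \<bullet> pullback_top h"
      using w by (auto simp: Hom_def)
    fix v
    assume "v \<in> Hom C (Dom C (pullback_obj C g h)) (Dom C (pullback_obj C g k)) \<and>
      pullback_obj C g k \<bullet> v = pullback_obj C g h \<and> pullback_top k \<bullet> v = u \<bullet> pullback_top h"
    then show "v = w"
      using w by - (rule pullback_cancel[OF chosen[OF k]], auto simp: Hom_def)
  qed
  then show ?thesis
    unfolding pullback_arr_def by (simp add: case_prod_beta pullback_obj_def pullback_top_def Let_def)
qed

lemma pullback_arr_obtain:
  assumes k: "k \<in> Arr C" "Cod C k = Cod C g" and u: "u \<in> Arr C" "Cod C u = Dom C k" "k \<bullet> u = h"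
  obtains w where "w \<in> Arr C" "Dom C w = Dom C (pullback_obj C g h)" "Cod C w = Dom C (pullback_obj C g k)"
      "pullback_obj C g k \<bullet> w = pullback_obj C g h" "pullback_top k \<bullet> w = u \<bullet> pullback_top h"
      "pullback_arr C g (h, k, u) = (pullback_obj C g h, pullback_obj C g k, w)"
proof -
  have h: "h \<in> Arr C" "Cod C h = Cod C g" "Dom C h = Dom C u" using k u by auto
  note P = chosen[OF k] and P' = chosen[OF h(1,2)]
  note [simp] = pullback_arrs(1-4,6-8)[OF P] pullback_arrs(1-4,6-8)[OF P'] u(1,2) h
  obtain w where w: "w \<in> Arr C" "Dom C w = Dom C (pullback_obj C g h)" "Cod C w = Dom C (pullback_obj C g k)"
      "pullback_obj C g k \<bullet> w = pullback_obj C g h" "pullback_top k \<bullet> w = u \<bullet> pullback_top h"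
    by (rule pullback_obtain[OF P, of "pullback_obj C g h" "u \<bullet> pullback_top h"])
      (auto simp: pullback_comm[OF P'] comp_reduce[OF u(3)])
  show ?thesis by (rule that[OF w pullback_arr_eq[OF k u w]])
qed

lemma pullback_functor:
  "cat_functor (slice C (Cod C g)) (slice C (Dom C g)) (pullback_obj C g) (pullback_arr C g)"
proof -
  interpret B: category "slice C (Cod C g)" by (rule category_slice)
  interpret A: category "slice C (Dom C g)" by (rule category_slice)
  show ?thesis
  proof
    fix h assume "h \<in> Obj (slice C (Cod C g))"
    then have h: "h \<in> Arr C" "Cod C h = Cod C g" by (auto simp: slice_def)
    note P = chosen[OF h]
    note [simp] = h pullback_arrs(1-4,6-8)[OF P]
    show "pullback_obj C g h \<in> Obj (slice C (Dom C g))" by (simp add: slice_def)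
    show "pullback_arr C g (Ident (slice C (Cod C g)) h) = Ident (slice C (Dom C g)) (pullback_obj C g h)"
      using pullback_arr_eq[OF h, of "Ident C (Dom C h)" h "Ident C (Dom C (pullback_obj C g h))"]
      by (simp add: slice_def)
  next
    fix f h k assume "f \<in> Hom (slice C (Cod C g)) h k"
    then obtain u where f: "f = (h, k, u)" and h: "h \<in> Arr C" "Cod C h = Cod C g"
      and k: "k \<in> Arr C" "Cod C k = Cod C g"
      and u: "u \<in> Arr C" "Cod C u = Dom C k" "k \<bullet> u = h" unfolding Hom_slice by blast
    note [simp] = h k pullback_arrs(1-4,6-8)[OF chosen[OF h]] pullback_arrs(1-4,6-8)[OF chosen[OF k]]
    show "pullback_arr C g f \<in> Hom (slice C (Dom C g)) (pullback_obj C g h) (pullback_obj C g k)"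
      by (rule pullback_arr_obtain[OF k u]) (simp add: f Hom_slice)
  next
    fix f h k f' l
    assume "f \<in> Hom (slice C (Cod C g)) h k" "f' \<in> Hom (slice C (Cod C g)) k l"
    then obtain u v where f: "f = (h, k, u)" "f' = (k, l, v)" and h: "h \<in> Arr C" "Cod C h = Cod C g"
      and k: "k \<in> Arr C" "Cod C k = Cod C g" and l: "l \<in> Arr C" "Cod C l = Cod C g"
      and u: "u \<in> Arr C" "Cod C u = Dom C k" "k \<bullet> u = h" and du: "Dom C u = Dom C h"
      and v: "v \<in> Arr C" "Cod C v = Dom C l" "l \<bullet> v = k" and dv: "Dom C v = Dom C k"
      unfolding Hom_slice by blast
    note [simp] = h k pullback_arrs(1-4,6-8)[OF chosen[OF h]] pullback_arrs(1-4,6-8)[OF chosen[OF k]] pullback_arrs(1-4,6-8)[OF chosen[OF l]]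
      u(1,2) v(1,2) du dv
    obtain w where w: "w \<in> Arr C" "Dom C w = Dom C (pullback_obj C g h)" "Cod C w = Dom C (pullback_obj C g k)"
      "pullback_obj C g k \<bullet> w = pullback_obj C g h" "pullback_top k \<bullet> w = u \<bullet> pullback_top h"
      "pullback_arr C g (h, k, u) = (pullback_obj C g h, pullback_obj C g k, w)"
      by (rule pullback_arr_obtain[OF k u])
    obtain w' where w': "w' \<in> Arr C" "Dom C w' = Dom C (pullback_obj C g k)" "Cod C w' = Dom C (pullback_obj C g l)"
      "pullback_obj C g l \<bullet> w' = pullback_obj C g k" "pullback_top l \<bullet> w' = v \<bullet> pullback_top k"
      "pullback_arr C g (k, l, v) = (pullback_obj C g k, pullback_obj C g l, w')"
      by (rule pullback_arr_obtain[OF l v])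
    note [simp] = w(1-3) w'(1-3)
    have e1: "pullback_top l \<bullet> w' \<bullet> w = v \<bullet> u \<bullet> pullback_top h"
      using comp_rewrite[OF w'(5), of w] w(5) by simp
    have e2: "pullback_obj C g l \<bullet> w' \<bullet> w = pullback_obj C g h"
      using comp_reduce[OF w'(4), of w] w(4) by simp
    have "pullback_arr C g (h, l, v \<bullet> u) = (pullback_obj C g h, pullback_obj C g l, w' \<bullet> w)"
      by (rule pullback_arr_eq[OF l]) (use e1 e2 u v in \<open>auto simp: comp_reduce[OF v(3)]\<close>)
    then show "pullback_arr C g (Comp (slice C (Cod C g)) f' f) =
        Comp (slice C (Dom C g)) (pullback_arr C g f') (pullback_arr C g f)"
      using w w' unfolding f by (simp add: slice_def)
  qed
qed

text \<open>The chosen pullback of \<open>\<pi>\<close> serves as the one of the dependent product.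
  A test map on an arbitrary pullback of \<open>z\<close> is moved to the chosen one along the
  comparison isomorphism \<open>c\<close>, \<open>d\<close>, transposed there, and the resulting
  comparison map is moved back.\<close>

lemma dependent_product_of_couniversal:
  assumes f: "f \<in> Arr C" "Cod C f = Dom C g"
    and "couniversal (slice C (Cod C g)) (slice C (Dom C g)) (pullback_obj C g) (pullback_arr C g) f \<pi> e"
  shows "\<exists>p q \<epsilon>. dependent_product C g f \<pi> p q \<epsilon>"
proof -
  have \<pi>: "\<pi> \<in> Arr C" "Cod C \<pi> = Cod C g" 
    and eH: "e \<in> Hom (slice C (Dom C g)) (pullback_obj C g \<pi>) f"
    and un: "\<And>z k. \<lbrakk>z \<in> Arr C; Cod C z = Cod C g; k \<in> Hom (slice C (Dom C g)) (pullback_obj C g z) f\<rbrakk> \<Longrightarrow>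
      \<exists>!y. y \<in> Hom (slice C (Cod C g)) z \<pi> \<and> Comp (slice C (Dom C g)) e (pullback_arr C g y) = k"
    using assms(3) unfolding couniversal_def by (auto simp: slice_def)
  obtain \<epsilon> where e: "e = (pullback_obj C g \<pi>, f, \<epsilon>)" and \<epsilon>: "\<epsilon> \<in> Arr C" "Dom C \<epsilon> = Dom C (pullback_obj C g \<pi>)"
    "Cod C \<epsilon> = Dom C f" "f \<bullet> \<epsilon> = pullback_obj C g \<pi>"
    using eH unfolding Hom_slice by blast
  note P = chosen[OF \<pi>]
  have "dependent_product C g f \<pi> (pullback_obj C g \<pi>) (pullback_top \<pi>) \<epsilon>"
  proof (rule dependent_productI[OF f P \<epsilon>])
    fix z p' q' h
    assume P': "pullback C g z p' q'" and h: "h \<in> Arr C" "Dom C h = Dom C p'" "Cod C h = Dom C f" "f \<bullet> h = p'"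
    have z: "z \<in> Arr C" "Cod C z = Cod C g" using pullback_arrs[OF P'] by auto
    note Z = chosen[OF z]
    note [simp] = f \<pi> z \<epsilon>(1-3) pullback_arrs(1-4,6-8)[OF P] pullback_arrs(1-4,6-8)[OF P'] pullback_arrs(1-4,6-8)[OF Z] h(1-3)
    obtain c d where c [simp]: "c \<in> Arr C" "Dom C c = Dom C p'" "Cod C c = Dom C (pullback_obj C g z)"
      "d \<in> Arr C" "Dom C d = Dom C (pullback_obj C g z)" "Cod C d = Dom C p'"
      "pullback_obj C g z \<bullet> c = p'" "pullback_top z \<bullet> c = q'" "p' \<bullet> d = pullback_obj C g z" "q' \<bullet> d = pullback_top z"
      "d \<bullet> c = Ident C (Dom C p')"
      by (rule pullback_iso[OF P' Z])
    have "(pullback_obj C g z, f, h \<bullet> d) \<in> Hom (slice C (Dom C g)) (pullback_obj C g z) f"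
      unfolding Hom_slice by (auto simp: comp_reduce[OF h(4)])
    from un[OF z this] obtain s where "(z, \<pi>, s) \<in> Hom (slice C (Cod C g)) z \<pi>"
      and es: "Comp (slice C (Dom C g)) e (pullback_arr C g (z, \<pi>, s)) = (pullback_obj C g z, f, h \<bullet> d)"
      by (auto simp: Hom_slice)
    then have s: "s \<in> Arr C" "Dom C s = Dom C z" "Cod C s = Dom C \<pi>" "\<pi> \<bullet> s = z"
      by (auto simp: Hom_slice)
    obtain w where w: "w \<in> Arr C" "Dom C w = Dom C (pullback_obj C g z)" "Cod C w = Dom C (pullback_obj C g \<pi>)"
      "pullback_obj C g \<pi> \<bullet> w = pullback_obj C g z" "pullback_top \<pi> \<bullet> w = s \<bullet> pullback_top z"
      "pullback_arr C g (z, \<pi>, s) = (pullback_obj C g z, pullback_obj C g \<pi>, w)"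
      by (rule pullback_arr_obtain[OF \<pi> s(1,3,4)])
    have ew: "\<epsilon> \<bullet> w = h \<bullet> d" using es w by (simp add: e slice_def)
    note [simp] = s(1-3) w(1-3)
    show "\<exists>s w. s \<in> Arr C \<and> Dom C s = Dom C z \<and> Cod C s = Dom C \<pi> \<and> \<pi> \<bullet> s = z \<and>
        w \<in> Arr C \<and> Dom C w = Dom C p' \<and> Cod C w = Dom C (pullback_obj C g \<pi>) \<and>
        pullback_obj C g \<pi> \<bullet> w = p' \<and> pullback_top \<pi> \<bullet> w = s \<bullet> q' \<and> \<epsilon> \<bullet> w = h"
      by (rule exI[of _ s], rule exI[of _ "w \<bullet> c"])
        (simp add: s comp_reduce[OF w(4)] comp_rewrite[OF w(5)] comp_rewrite[OF ew])
  next
    fix z p' q' s t v w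
    assume P': "pullback C g z p' q'" and s: "s \<in> Arr C" "Dom C s = Dom C z" "Cod C s = Dom C \<pi>" "\<pi> \<bullet> s = z"
      and t: "t \<in> Arr C" "Dom C t = Dom C z" "Cod C t = Dom C \<pi>" "\<pi> \<bullet> t = z"
      and v: "v \<in> Arr C" "Dom C v = Dom C p'" "Cod C v = Dom C (pullback_obj C g \<pi>)"
        "pullback_obj C g \<pi> \<bullet> v = p'" "pullback_top \<pi> \<bullet> v = s \<bullet> q'"
      and w: "w \<in> Arr C" "Dom C w = Dom C p'" "Cod C w = Dom C (pullback_obj C g \<pi>)"
        "pullback_obj C g \<pi> \<bullet> w = p'" "pullback_top \<pi> \<bullet> w = t \<bullet> q'"
      and vw: "\<epsilon> \<bullet> v = \<epsilon> \<bullet> w"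
    have z: "z \<in> Arr C" "Cod C z = Cod C g" using pullback_arrs[OF P'] by auto
    note Z = chosen[OF z]
    note [simp] = f \<pi> z \<epsilon>(1-3) pullback_arrs(1-4,6-8)[OF P] pullback_arrs(1-4,6-8)[OF P'] pullback_arrs(1-4,6-8)[OF Z]
      s(1-3) t(1-3) v(1-3) w(1-3)
    obtain c d where c [simp]: "c \<in> Arr C" "Dom C c = Dom C p'" "Cod C c = Dom C (pullback_obj C g z)"
      "d \<in> Arr C" "Dom C d = Dom C (pullback_obj C g z)" "Cod C d = Dom C p'"
      "pullback_obj C g z \<bullet> c = p'" "pullback_top z \<bullet> c = q'" "p' \<bullet> d = pullback_obj C g z" "q' \<bullet> d = pullback_top z"
      by (rule pullback_iso[OF P' Z])
    have pv: "pullback_arr C g (z, \<pi>, s) = (pullback_obj C g z, pullback_obj C g \<pi>, v \<bullet> d)"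
      by (rule pullback_arr_eq[OF \<pi> s(1,3,4)]) (auto simp: comp_reduce[OF v(4)] comp_rewrite[OF v(5)])
    have pw: "pullback_arr C g (z, \<pi>, t) = (pullback_obj C g z, pullback_obj C g \<pi>, w \<bullet> d)"
      by (rule pullback_arr_eq[OF \<pi> t(1,3,4)]) (auto simp: comp_reduce[OF w(4)] comp_rewrite[OF w(5)])
    let ?k = "(pullback_obj C g z, f, \<epsilon> \<bullet> v \<bullet> d)"
    have "?k \<in> Hom (slice C (Dom C g)) (pullback_obj C g z) f"
      unfolding Hom_slice by (auto simp: comp_reduce[OF \<epsilon>(4)] comp_reduce[OF v(4)])
    moreover have "Comp (slice C (Dom C g)) e (pullback_arr C g (z, \<pi>, s)) = ?k"
      unfolding pv by (simp add: e slice_def)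
    moreover have "Comp (slice C (Dom C g)) e (pullback_arr C g (z, \<pi>, t)) = ?k"
      unfolding pw by (simp add: e slice_def comp_rewrite[OF vw])
    moreover have "(z, \<pi>, s) \<in> Hom (slice C (Cod C g)) z \<pi>" "(z, \<pi>, t) \<in> Hom (slice C (Cod C g)) z \<pi>"
      using s t by (auto simp: Hom_slice)
    ultimately have "(z, \<pi>, s) = (z, \<pi>, t)" using un[OF z] by blast
    then show "s = t" by simp
  qed
  then show ?thesis by blast
qed

text \<open>Here the pullback of \<open>\<pi>\<close> that comes with the dependent product may
  differ from the chosen one, so the counit is corrected by the comparison isomorphism
  \<open>c\<close>.\<close>

lemma couniversal_of_dependent_product:
  assumes dp: "dependent_product C g f \<pi> p q \<epsilon>"
  shows "\<exists>e. couniversal (slice C (Cod C g)) (slice C (Dom C g)) (pullback_obj C g) (pullback_arr C g) f \<pi> e"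
proof -
  have P: "pullback C g \<pi> p q" and f: "f \<in> Arr C" "Cod C f = Dom C g"
    and \<epsilon>: "\<epsilon> \<in> Arr C" "Dom C \<epsilon> = Dom C p" "Cod C \<epsilon> = Dom C f" "f \<bullet> \<epsilon> = p"
    using dependent_productD[OF dp] by simp_all
  have \<pi>: "\<pi> \<in> Arr C" "Cod C \<pi> = Cod C g" using pullback_arrs[OF P] by auto
  note P' = chosen[OF \<pi>]
  note [simp] = f \<pi> \<epsilon>(1-3) pullback_arrs(1-4,6-8)[OF P] pullback_arrs(1-4,6-8)[OF P']
  obtain c d where c [simp]: "c \<in> Arr C" "Dom C c = Dom C (pullback_obj C g \<pi>)" "Cod C c = Dom C p"
    "d \<in> Arr C" "Dom C d = Dom C p" "Cod C d = Dom C (pullback_obj C g \<pi>)"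
    "p \<bullet> c = pullback_obj C g \<pi>" "q \<bullet> c = pullback_top \<pi>" "pullback_obj C g \<pi> \<bullet> d = p" "pullback_top \<pi> \<bullet> d = q"
    "d \<bullet> c = Ident C (Dom C (pullback_obj C g \<pi>))" "c \<bullet> d = Ident C (Dom C p)"
    by (rule pullback_iso[OF P' P])
  define e where "e = (pullback_obj C g \<pi>, f, \<epsilon> \<bullet> c)"
  have "\<exists>!y. y \<in> Hom (slice C (Cod C g)) z \<pi> \<and> Comp (slice C (Dom C g)) e (pullback_arr C g y) = k"
    if z: "z \<in> Arr C" "Cod C z = Cod C g" and k: "k \<in> Hom (slice C (Dom C g)) (pullback_obj C g z) f" for z k
  proof -
    note Z = chosen[OF z]
    obtain h where kh: "k = (pullback_obj C g z, f, h)" and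
      h: "h \<in> Arr C" "Dom C h = Dom C (pullback_obj C g z)" "Cod C h = Dom C f" "f \<bullet> h = pullback_obj C g z"
      using k unfolding Hom_slice by blast
    note [simp] = pullback_arrs(1-4,6-8)[OF Z] h(1-3)
    obtain s w where s: "s \<in> Arr C" "Dom C s = Dom C z" "Cod C s = Dom C \<pi>" "\<pi> \<bullet> s = z"
      and w: "w \<in> Arr C" "Dom C w = Dom C (pullback_obj C g z)" "Cod C w = Dom C p" "p \<bullet> w = pullback_obj C g z"
        "q \<bullet> w = s \<bullet> pullback_top z" and ew: "\<epsilon> \<bullet> w = h"
      by (rule dependent_product_obtain[OF dp Z h])
    note [simp] = s(1-3) w(1-3)
    have pw: "pullback_arr C g (z, \<pi>, s) = (pullback_obj C g z, pullback_obj C g \<pi>, d \<bullet> w)"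
      by (rule pullback_arr_eq[OF \<pi> s(1,3,4)])
        (use w in \<open>auto simp: comp_reduce[OF c(9)] comp_reduce[OF c(10)]\<close>)
    show ?thesis
    proof (rule ex1I)
      show "(z, \<pi>, s) \<in> Hom (slice C (Cod C g)) z \<pi> \<and>
          Comp (slice C (Dom C g)) e (pullback_arr C g (z, \<pi>, s)) = k"
        using s z ew unfolding pw by (simp add: Hom_slice e_def kh Comp_slice comp_reduce[OF c(12)])
      fix y
      assume y: "y \<in> Hom (slice C (Cod C g)) z \<pi> \<and> Comp (slice C (Dom C g)) e (pullback_arr C g y) = k"
      then obtain t where yt: "y = (z, \<pi>, t)" and
        t: "t \<in> Arr C" "Dom C t = Dom C z" "Cod C t = Dom C \<pi>" "\<pi> \<bullet> t = z"
        unfolding Hom_slice by blast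
      note [simp] = t(1-3)
      obtain v where v: "v \<in> Arr C" "Dom C v = Dom C (pullback_obj C g z)"
        "Cod C v = Dom C (pullback_obj C g \<pi>)" "pullback_obj C g \<pi> \<bullet> v = pullback_obj C g z" "pullback_top \<pi> \<bullet> v = t \<bullet> pullback_top z"
        "pullback_arr C g (z, \<pi>, t) = (pullback_obj C g z, pullback_obj C g \<pi>, v)"
        by (rule pullback_arr_obtain[OF \<pi> t(1,3,4)])
      note [simp] = v(1-3)
      have ev: "\<epsilon> \<bullet> c \<bullet> v = h" using y by (simp add: yt v(6) e_def kh slice_def)
      have "t = s"
        by (rule dependent_product_cancel[OF dp Z t s, of "c \<bullet> v" w])
          (use v w ew ev in \<open>auto simp: comp_reduce[OF c(7)] comp_reduce[OF c(8)]\<close>)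
      then show "y = (z, \<pi>, s)" by (simp add: yt)
    qed
  qed
  moreover have "e \<in> Hom (slice C (Dom C g)) (pullback_obj C g \<pi>) f"
    unfolding Hom_slice e_def by (simp add: comp_reduce[OF \<epsilon>(4)])
  ultimately have "couniversal (slice C (Cod C g)) (slice C (Dom C g)) (pullback_obj C g) (pullback_arr C g) f \<pi> e"
    unfolding couniversal_def by (auto simp: slice_def)
  then show ?thesis by blast
qed

end

section \<open>Reedy fibrations and levelwise pullbacks\<close>

context type_theoretic_fibration_category
begin

section \<open>The category of Reedy fibrant objects in components, and gap maps\<close>

abbreviation K where "K \<equiv> reedy_fibrant_cat C"

lemma Obj_reedy: "Obj K = Fib C"
  using Fib_Arr
  by (auto simp: reedy_fibrant_cat_def cat.defs fibcat.defs full_subcat_def arrow_cat_def reedy_fibrant_iff)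

lemma Arr_reedy:
  "(\<alpha>, \<beta>, f1, f0) \<in> Arr K \<longleftrightarrow> \<alpha> \<in> Fib C \<and> \<beta> \<in> Fib C \<and>
    f1 \<in> Arr C \<and> Dom C f1 = Dom C \<alpha> \<and> Cod C f1 = Dom C \<beta> \<and>
    f0 \<in> Arr C \<and> Dom C f0 = Cod C \<alpha> \<and> Cod C f0 = Cod C \<beta> \<and> f0 \<bullet> \<alpha> = \<beta> \<bullet> f1"
  using Fib_Arr
  by (auto simp: reedy_fibrant_cat_def cat.defs fibcat.defs full_subcat_def arrow_cat_def reedy_fibrant_iff Hom_def)

lemma reedy_fields [simp]:
  "Dom K (\<alpha>, \<beta>, f1, f0) = \<alpha>"
  "Cod K (\<alpha>, \<beta>, f1, f0) = \<beta>"
  "Ident K \<alpha> = (\<alpha>, \<alpha>, Ident C (Dom C \<alpha>), Ident C (Cod C \<alpha>))"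
  "Comp K (\<beta>', \<gamma>, g1, g0) (\<alpha>, \<beta>, f1, f0) = (\<alpha>, \<gamma>, g1 \<bullet> f1, g0 \<bullet> f0)"
  "One K = Ident C (One C)"
  by (simp_all add: reedy_fibrant_cat_def cat.defs fibcat.defs full_subcat_def arrow_cat_def)

lemma Hom_reedy:
  "Hom K \<alpha> \<beta> = {(\<alpha>, \<beta>, f1, f0) |f1 f0. (\<alpha>, \<beta>, f1, f0) \<in> Arr K}"
  unfolding Hom_def by auto

lemma Fib_reedy:
  "Fib K = Arr K \<inter> reedy_fibrations C"
  by (auto simp: reedy_fibrant_cat_def cat.defs fibcat.defs Let_def)

lemma FibD [simp]: "f \<in> Fib C \<Longrightarrow> f \<in> Arr C"
  using Fib_Arr by auto

lemma category_reedy: "category K" (is "category ?K")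
proof
  fix f assume "f \<in> Arr ?K"
  then show "Dom ?K f \<in> Obj ?K" "Cod ?K f \<in> Obj ?K"
    by (cases f; simp add: Arr_reedy Obj_reedy)+
next
  fix A assume "A \<in> Obj ?K"
  then show "Ident ?K A \<in> Hom ?K A A"
    by (simp add: Obj_reedy Hom_reedy Arr_reedy)
next
  fix f A B g D
  assume "f \<in> Hom ?K A B" "g \<in> Hom ?K B D"
  then obtain f1 f0 g1 g0 where e: "f = (A, B, f1, f0)" "g = (B, D, g1, g0)" and
    a: "(A, B, f1, f0) \<in> Arr ?K" "(B, D, g1, g0) \<in> Arr ?K"
    unfolding Hom_reedy by blast
  from a show "Comp ?K g f \<in> Hom ?K A D"
    by (simp add: e Hom_reedy Arr_reedy comp_rewrite[of g0 B D g1 f1])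
next
  fix f A B
  assume "f \<in> Hom ?K A B"
  then obtain f1 f0 where e: "f = (A, B, f1, f0)" and a: "(A, B, f1, f0) \<in> Arr ?K"
    unfolding Hom_reedy by blast
  from a show "Comp ?K f (Ident ?K A) = f" "Comp ?K (Ident ?K B) f = f"
    by (simp_all add: e Arr_reedy)
next
  fix f A B g D h E
  assume "f \<in> Hom ?K A B" "g \<in> Hom ?K B D" "h \<in> Hom ?K D E"
  then obtain f1 f0 g1 g0 h1 h0 where e: "f = (A, B, f1, f0)" "g = (B, D, g1, g0)" "h = (D, E, h1, h0)" and
    a: "(A, B, f1, f0) \<in> Arr ?K" "(B, D, g1, g0) \<in> Arr ?K" "(D, E, h1, h0) \<in> Arr ?K"
    unfolding Hom_reedy by blast
  from a show "Comp ?K (Comp ?K h g) f = Comp ?K h (Comp ?K g f)"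
    by (simp add: e Arr_reedy)
qed

sublocale reedy: category K
  by (rule category_reedy)

text \<open>The gap maps into two pullbacks differ by an isomorphism, which is a fibration. The
  quantifier over all pullbacks in \<open>reedy_fibrations\<close> can therefore be checked on a
  single one, as \<open>reedyI\<close> does.\<close>

lemma Fib_transport:
  assumes P: "pullback C f g p q" and P': "pullback C f g p' q'"
    and k: "k \<in> Fib C" "Cod C k = Dom C p"
    and k': "k' \<in> Arr C" "Cod C k' = Dom C p'" "Dom C k' = Dom C k" "p' \<bullet> k' = p \<bullet> k" "q' \<bullet> k' = q \<bullet> k"
  shows "k' \<in> Fib C"
proof -
  note [simp] = pullback_arrs[OF P] pullback_arrs[OF P'] k'(1-3) k
  obtain c d where c [simp]: "c \<in> Arr C" "Dom C c = Dom C p" "Cod C c = Dom C p'"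
    "d \<in> Arr C" "Dom C d = Dom C p'" "Cod C d = Dom C p"
    "p' \<bullet> c = p" "q' \<bullet> c = q" "d \<bullet> c = Ident C (Dom C p)" "c \<bullet> d = Ident C (Dom C p')"
    by (rule pullback_iso[OF P P'])
  have "iso C c"
    by (rule isoI[of c "Dom C p" "Dom C p'" d]) (auto simp: Hom_def)
  then have "c \<bullet> k \<in> Fib C" using Fib_Comp[OF k(1) Fib_iso] by simp
  moreover have "k' = c \<bullet> k"
    by (rule pullback_cancel[OF P'])
      (simp_all add: k'(4,5) comp_reduce[OF c(7)] comp_reduce[OF c(8)])
  ultimately show ?thesis by simp
qed

lemma reedyI:
  assumes a: "(\<alpha>, \<beta>, f1, f0) \<in> Arr K" and f0: "f0 \<in> Fib C"
    and P: "pullback C f0 \<beta> p q"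
    and k: "k \<in> Fib C" "Dom C k = Dom C \<alpha>" "Cod C k = Dom C p" "p \<bullet> k = \<alpha>" "q \<bullet> k = f1"
  shows "(\<alpha>, \<beta>, f1, f0) \<in> Fib K"
proof -
  have "k' \<in> Fib C" if "pullback C f0 \<beta> p' q'" "k' \<in> Hom C (Dom C \<alpha>) (Dom C p')" "p' \<bullet> k' = \<alpha>" "q' \<bullet> k' = f1"
    for p' q' k'
    by (rule Fib_transport[OF P that(1) k(1,3)]) (use that(2-) k in \<open>auto simp: Hom_def\<close>)
  then show ?thesis using a f0
    unfolding Fib_reedy reedy_fibrations_def by (auto simp: arrow_cat_def Arr_reedy Hom_def)
qed

lemma reedy_Fib_arr:
  assumes "(\<alpha>, \<beta>, f1, f0) \<in> Fib K"
  shows "(\<alpha>, \<beta>, f1, f0) \<in> Arr K" "f0 \<in> Fib C"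
  using assms unfolding Fib_reedy reedy_fibrations_def by auto

lemma reedy_gap:
  assumes F: "(\<alpha>, \<beta>, f1, f0) \<in> Fib K" and P: "pullback C f0 \<beta> p q"
  obtains k where "k \<in> Fib C" "Dom C k = Dom C \<alpha>" "Cod C k = Dom C p" "p \<bullet> k = \<alpha>" "q \<bullet> k = f1"
proof -
  note a = reedy_Fib_arr(1)[OF F, unfolded Arr_reedy]
  note [simp] = pullback_arrs[OF P]
  obtain k where k: "k \<in> Arr C" "Dom C k = Dom C \<alpha>" "Cod C k = Dom C p" "p \<bullet> k = \<alpha>" "q \<bullet> k = f1"
    by (rule pullback_obtain[OF P, of \<alpha> f1]) (use a in auto)
  then have "k \<in> Hom C (Dom C \<alpha>) (Dom C p)" by (auto simp: Hom_def)
  then have "k \<in> Fib C"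
    using F P k(4,5) unfolding Fib_reedy reedy_fibrations_def by blast
  then show ?thesis using that k by blast
qed

lemma reedy_gap_obtain:
  assumes F: "(\<alpha>, \<beta>, f1, f0) \<in> Fib K"
  obtains p q k where "pullback C f0 \<beta> p q" "p \<in> Fib C" "q \<in> Fib C"
    "k \<in> Fib C" "Dom C k = Dom C \<alpha>" "Cod C k = Dom C p" "p \<bullet> k = \<alpha>" "q \<bullet> k = f1"
proof -
  note a = reedy_Fib_arr(1)[OF F, unfolded Arr_reedy] and f0 = reedy_Fib_arr(2)[OF F]
  obtain p q where P: "pullback C f0 \<beta> p q" using pullback_exists[of \<beta> f0] a by auto
  obtain k where k: "k \<in> Fib C" "Dom C k = Dom C \<alpha>" "Cod C k = Dom C p" "p \<bullet> k = \<alpha>" "q \<bullet> k = f1"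
    by (rule reedy_gap[OF F P])
  show ?thesis
    by (rule that[OF P _ _ k]) (use a f0 pullback_Fib[OF _ P] pullback_Fib[OF _ pullback_sym[OF P]] in auto)
qed

text \<open>The top component is the gap map followed by a projection that is a pullback of
  \<open>f0\<close>. This makes pullbacks and dependent products along the top component
  available.\<close>

lemma reedy_top_Fib:
  assumes F: "(\<alpha>, \<beta>, f1, f0) \<in> Fib K"
  shows "f1 \<in> Fib C"
proof -
  obtain p q k where P: "pullback C f0 \<beta> p q" and "q \<in> Fib C"
    "k \<in> Fib C" "Cod C k = Dom C p" "q \<bullet> k = f1"
    by (rule reedy_gap_obtain[OF F])
  then show ?thesis using Fib_Comp[of k q] pullback_arrs[OF P] by auto
qed

section \<open>Levelwise pullbacks of Reedy fibrations\<close>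

text \<open>With \<open>W\<close> the pullback of \<open>p0\<close> along \<open>\<alpha>\<close> and \<open>R\<close> the pullback of \<open>g0\<close> along \<open>\<gamma>\<close>, the gap map
  into \<open>W\<close> is a pullback of the gap map of \<open>g\<close> into \<open>R\<close>.\<close>

lemma reedy_pullback_Fib:
  assumes f: "(\<alpha>, \<gamma>, f1, f0) \<in> Arr K"
    and g: "(\<beta>, \<gamma>, g1, g0) \<in> Fib K"
    and P0: "pullback C f0 g0 p0 q0" and P1: "pullback C f1 g1 p1 q1"
    and \<pi>: "\<pi> \<in> Arr C" "Dom C \<pi> = Dom C p1" "Cod C \<pi> = Dom C p0" "p0 \<bullet> \<pi> = \<alpha> \<bullet> p1" "q0 \<bullet> \<pi> = \<beta> \<bullet> q1"
  shows "(\<pi>, \<alpha>, p1, p0) \<in> Fib K" "(\<pi>, \<beta>, q1, q0) \<in> Arr K"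
proof -
  have fa: "f1 \<in> Arr C" "Dom C f1 = Dom C \<alpha>" "Cod C f1 = Dom C \<gamma>" "f0 \<in> Arr C" "Dom C f0 = Cod C \<alpha>"
     "Cod C f0 = Cod C \<gamma>" "\<alpha> \<in> Fib C" "\<gamma> \<in> Fib C" "f0 \<bullet> \<alpha> = \<gamma> \<bullet> f1"
    using f unfolding Arr_reedy by blast+
  have ga: "g1 \<in> Arr C" "Dom C g1 = Dom C \<beta>" "Cod C g1 = Dom C \<gamma>" "g0 \<in> Arr C" "Dom C g0 = Cod C \<beta>"
     "Cod C g0 = Cod C \<gamma>" "\<beta> \<in> Fib C" "g0 \<bullet> \<beta> = \<gamma> \<bullet> g1"
    using reedy_Fib_arr(1)[OF g] unfolding Arr_reedy by blast+
  note g0 = reedy_Fib_arr(2)[OF g]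
  obtain r s j where R: "pullback C g0 \<gamma> r s" and j: "j \<in> Fib C" "Dom C j = Dom C \<beta>" "Cod C j = Dom C r"
    "r \<bullet> j = \<beta>" "s \<bullet> j = g1"
    by (rule reedy_gap_obtain[OF g])
  note [simp] = fa(1-8) ga(1-7) g0 \<pi>(1-3) j(1-3)
  note [simp] = pullback_arrs(3-4,6-8)[OF P0] pullback_arrs(3-4,6-8)[OF P1] pullback_arrs(3-4,6-8)[OF R]
  have p0: "p0 \<in> Fib C" by (rule pullback_Fib[OF g0 P0])
  obtain u v where W: "pullback C p0 \<alpha> u v" using pullback_exists[of \<alpha> p0] by auto
  note [simp] = pullback_arrs(3-4,6-8)[OF W]
  have v: "v \<in> Fib C" by (rule pullback_Fib[OF p0 pullback_sym[OF W]])
  have u: "u \<in> Fib C" by (rule pullback_Fib[OF _ W]) simp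
  obtain k where k: "k \<in> Arr C" "Dom C k = Dom C \<pi>" "Cod C k = Dom C u" "u \<bullet> k = \<pi>" "v \<bullet> k = p1"
    by (rule pullback_obtain[OF W, of \<pi> p1]) (simp_all add: \<pi>)
  note [simp] = k(1-3)
  \<comment> \<open>The comparison map \<open>d\<close> from \<open>W\<close> to \<open>R\<close>
    acts by \<open>q0\<close> at level 0 and by \<open>f1\<close> on the part over \<gamma>; it is
    the map along which the gap map \<open>j\<close> of \<open>g\<close> will be pulled
    back.\<close>
  have "g0 \<bullet> q0 \<bullet> u = \<gamma> \<bullet> f1 \<bullet> v"
    using comp_rewrite[OF pullback_comm[OF P0], of u] comp_rewrite[OF fa(9), of v] pullback_comm[OF W]
    by simp
  then obtain d where d: "d \<in> Arr C" "Dom C d = Dom C u" "Cod C d = Dom C r" "r \<bullet> d = q0 \<bullet> u" "s \<bullet> d = f1 \<bullet> v"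
    by - (rule pullback_obtain[OF R, of "q0 \<bullet> u" "f1 \<bullet> v"], auto)
  note [simp] = d(1-3)
  have "pullback C d j k q1"
  proof (rule pullbackI)
    show "d \<bullet> k = j \<bullet> q1"
    proof (rule pullback_cancel[OF R])
      show "r \<bullet> d \<bullet> k = r \<bullet> j \<bullet> q1"
        by (simp add: comp_rewrite[OF d(4)] comp_reduce[OF j(4)] k \<pi>)
      show "s \<bullet> d \<bullet> k = s \<bullet> j \<bullet> q1"
        by (simp add: comp_rewrite[OF d(5)] comp_reduce[OF j(5)] k pullback_comm[OF P1])
    qed simp_all
  next
    fix x y
    assume xy [simp]: "x \<in> Arr C" "y \<in> Arr C" "Dom C x = Dom C y" "Cod C x = Dom C d" "Cod C y = Dom C j"
      and e: "d \<bullet> x = j \<bullet> y"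
    have rd: "r \<bullet> d \<bullet> x = \<beta> \<bullet> y" and sd: "s \<bullet> d \<bullet> x = g1 \<bullet> y"
      by (simp_all add: e comp_reduce[OF j(4)] comp_reduce[OF j(5)])
    have "f1 \<bullet> v \<bullet> x = g1 \<bullet> y"
      using sd by (simp add: comp_rewrite[OF d(5)])
    then obtain t where t: "t \<in> Arr C" "Dom C t = Dom C x" "Cod C t = Dom C p1" "p1 \<bullet> t = v \<bullet> x" "q1 \<bullet> t = y"
      by - (rule pullback_obtain[OF P1, of "v \<bullet> x" y], auto)
    note [simp] = t(1-3)
    have "k \<bullet> t = x"
    proof (rule pullback_cancel[OF W])
      have "\<pi> \<bullet> t = u \<bullet> x"
      proof (rule pullback_cancel[OF P0])
        show "p0 \<bullet> \<pi> \<bullet> t = p0 \<bullet> u \<bullet> x"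
          by (simp add: comp_rewrite[OF \<pi>(4)] t comp_rewrite[OF pullback_comm[OF W]])
        show "q0 \<bullet> \<pi> \<bullet> t = q0 \<bullet> u \<bullet> x"
          using rd by (simp add: comp_rewrite[OF \<pi>(5)] t comp_rewrite[OF d(4)])
      qed simp_all
      then show "u \<bullet> k \<bullet> t = u \<bullet> x" by (simp add: comp_reduce[OF k(4)])
      show "v \<bullet> k \<bullet> t = v \<bullet> x" by (simp add: comp_reduce[OF k(5)] t)
    qed simp_all
    then show "\<exists>t. t \<in> Arr C \<and> Dom C t = Dom C x \<and> Cod C t = Dom C k \<and> k \<bullet> t = x \<and> q1 \<bullet> t = y"
      by (intro exI[of _ t]) (simp add: t)
  next
    fix s t
    assume [simp]: "s \<in> Arr C" "t \<in> Arr C" "Dom C s = Dom C t" "Cod C s = Dom C k" "Cod C t = Dom C k"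
      and e: "k \<bullet> s = k \<bullet> t" "q1 \<bullet> s = q1 \<bullet> t"
    have "v \<bullet> k \<bullet> s = v \<bullet> k \<bullet> t" by (simp add: e)
    then have "p1 \<bullet> s = p1 \<bullet> t" by (simp add: comp_reduce[OF k(5)])
    with e(2) show "s = t" by - (rule pullback_cancel[OF P1], simp_all)
  qed simp_all
  from pullback_Fib[OF j(1) this] have kF: "k \<in> Fib C" .
  \<comment> \<open>Fibrancy of the new object: \<open>u\<close> is a pullback of the fibration
    \<alpha>, and \<open>k\<close> is the gap map just shown to be a fibration.\<close>
  have \<pi>F: "\<pi> \<in> Fib C" using Fib_Comp[OF kF u] k by simp
  show "(\<pi>, \<beta>, q1, q0) \<in> Arr K"
    using \<pi> \<pi>F unfolding Arr_reedy by simp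
  have "(\<pi>, \<alpha>, p1, p0) \<in> Arr K"
    using \<pi> \<pi>F unfolding Arr_reedy by simp
  then show "(\<pi>, \<alpha>, p1, p0) \<in> Fib K"
    by (rule reedyI[OF _ p0 W kF]) (simp_all add: k)
qed

text \<open>The mediating arrows of the two levels form a commutative square, because its two
  composites into the bottom pullback agree after \<open>p0\<close> and after
  \<open>q0\<close>.\<close>

lemma reedy_pullbackI:
  assumes f: "(\<alpha>, \<gamma>, f1, f0) \<in> Arr K"
    and g: "(\<beta>, \<gamma>, g1, g0) \<in> Arr K"
    and p: "(\<pi>, \<alpha>, p1, p0) \<in> Arr K"
    and q: "(\<pi>, \<beta>, q1, q0) \<in> Arr K"
    and P0: "pullback C f0 g0 p0 q0" and P1: "pullback C f1 g1 p1 q1"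
  shows "pullback K (\<alpha>, \<gamma>, f1, f0) (\<beta>, \<gamma>, g1, g0) (\<pi>, \<alpha>, p1, p0) (\<pi>, \<beta>, q1, q0)"
proof (rule reedy.pullbackI)
  note fa = f[unfolded Arr_reedy] and ga = g[unfolded Arr_reedy] and pa = p[unfolded Arr_reedy]
    and qa = q[unfolded Arr_reedy]
  fix x y
  assume x: "x \<in> Arr K" and y: "y \<in> Arr K"
    and xy: "Dom K x = Dom K y"
     "Cod K x = Dom K (\<alpha>, \<gamma>, f1, f0)"
     "Cod K y = Dom K (\<beta>, \<gamma>, g1, g0)"
    and e: "Comp K (\<alpha>, \<gamma>, f1, f0) x = Comp K (\<beta>, \<gamma>, g1, g0) y"
  obtain \<tau> x1 x0 y1 y0 where xe: "x = (\<tau>, \<alpha>, x1, x0)" and ye: "y = (\<tau>, \<beta>, y1, y0)"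
    using xy by (cases x, cases y) auto
  note xa = x[unfolded xe Arr_reedy] and ya = y[unfolded ye Arr_reedy]
  have e1: "f1 \<bullet> x1 = g1 \<bullet> y1" and e0: "f0 \<bullet> x0 = g0 \<bullet> y0" using e by (simp_all add: xe ye)
  obtain u1 where u1: "u1 \<in> Arr C" "Dom C u1 = Dom C \<tau>" "Cod C u1 = Dom C \<pi>" "p1 \<bullet> u1 = x1" "q1 \<bullet> u1 = y1"
    by (rule pullback_obtain[OF P1, of x1 y1]) (use e1 xa ya fa ga pa in auto)
  obtain u0 where u0: "u0 \<in> Arr C" "Dom C u0 = Cod C \<tau>" "Cod C u0 = Cod C \<pi>" "p0 \<bullet> u0 = x0" "q0 \<bullet> u0 = y0"
    by (rule pullback_obtain[OF P0, of x0 y0]) (use e0 xa ya fa ga pa in auto)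
  have "u0 \<bullet> \<tau> = \<pi> \<bullet> u1"
  proof (rule pullback_cancel[OF P0])
    show "p0 \<bullet> u0 \<bullet> \<tau> = p0 \<bullet> \<pi> \<bullet> u1"
      using u0 u1 pa xa by (simp add: comp_reduce[of p0 u0 x0] comp_rewrite[of p0 \<pi> \<alpha> p1])
    show "q0 \<bullet> u0 \<bullet> \<tau> = q0 \<bullet> \<pi> \<bullet> u1"
      using u0 u1 qa ya by (simp add: comp_reduce[of q0 u0 y0] comp_rewrite[of q0 \<pi> \<beta> q1])
  qed (use u0 u1 pa xa in simp_all)
  then have "(\<tau>, \<pi>, u1, u0) \<in> Arr K"
    using u0 u1 pa xa by (simp add: Arr_reedy)
  then show "\<exists>u. u \<in> Arr K \<and> Dom K u = Dom K x \<and>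
      Cod K u = Dom K (\<pi>, \<alpha>, p1, p0) \<and>
      Comp K (\<pi>, \<alpha>, p1, p0) u = x \<and> Comp K (\<pi>, \<beta>, q1, q0) u = y"
    by (intro exI[of _ "(\<tau>, \<pi>, u1, u0)"]) (simp add: xe ye u0 u1)
next
  note pa = p[unfolded Arr_reedy]
  fix u v
  assume u: "u \<in> Arr K" and v: "v \<in> Arr K"
    and uv: "Dom K u = Dom K v"
      "Cod K u = Dom K (\<pi>, \<alpha>, p1, p0)"
      "Cod K v = Dom K (\<pi>, \<alpha>, p1, p0)"
    and e: "Comp K (\<pi>, \<alpha>, p1, p0) u = Comp K (\<pi>, \<alpha>, p1, p0) v"
      "Comp K (\<pi>, \<beta>, q1, q0) u = Comp K (\<pi>, \<beta>, q1, q0) v"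
  obtain \<tau> u1 u0 v1 v0 where ue: "u = (\<tau>, \<pi>, u1, u0)" and ve: "v = (\<tau>, \<pi>, v1, v0)"
    using uv by (cases u, cases v) auto
  note ua = u[unfolded ue Arr_reedy] and va = v[unfolded ve Arr_reedy]
  have "u1 = v1" by (rule pullback_cancel[OF P1]) (use ua va pa e in \<open>simp_all add: ue ve\<close>)
  moreover have "u0 = v0" by (rule pullback_cancel[OF P0]) (use ua va pa e in \<open>simp_all add: ue ve\<close>)
  ultimately show "u = v" by (simp add: ue ve)
qed (use f g p q pullback_comm[OF P0] pullback_comm[OF P1] in simp_all)

lemma reedy_pullback_exists:
  assumes f: "(\<alpha>, \<gamma>, f1, f0) \<in> Arr K"
    and g: "(\<beta>, \<gamma>, g1, g0) \<in> Fib K"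
  obtains \<pi> p1 p0 q1 q0 where "pullback C f0 g0 p0 q0" "pullback C f1 g1 p1 q1"
    "pullback K (\<alpha>, \<gamma>, f1, f0) (\<beta>, \<gamma>, g1, g0) (\<pi>, \<alpha>, p1, p0) (\<pi>, \<beta>, q1, q0)"
proof -
  note fa = f[unfolded Arr_reedy] and ga = reedy_Fib_arr(1)[OF g, unfolded Arr_reedy]
  obtain p0 q0 where P0: "pullback C f0 g0 p0 q0"
    using pullback_exists[of g0 f0] reedy_Fib_arr(2)[OF g] fa ga by auto
  obtain p1 q1 where P1: "pullback C f1 g1 p1 q1"
    using pullback_exists[of g1 f1] reedy_top_Fib[OF g] fa ga by auto
  note [simp] = pullback_arrs(3-4,6-8)[OF P0] pullback_arrs(3-4,6-8)[OF P1]
  have "f0 \<bullet> \<alpha> \<bullet> p1 = g0 \<bullet> \<beta> \<bullet> q1"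
    using fa ga pullback_comm[OF P1]
    by (simp add: comp_rewrite[of f0 \<alpha> \<gamma> f1 p1] comp_rewrite[of g0 \<beta> \<gamma> g1 q1])
  then obtain \<pi> where \<pi>: "\<pi> \<in> Arr C" "Dom C \<pi> = Dom C p1" "Cod C \<pi> = Dom C p0" "p0 \<bullet> \<pi> = \<alpha> \<bullet> p1" "q0 \<bullet> \<pi> = \<beta> \<bullet> q1"
    using fa ga by - (rule pullback_obtain[OF P0, of "\<alpha> \<bullet> p1" "\<beta> \<bullet> q1"], auto)
  note F = reedy_pullback_Fib[OF f g P0 P1 \<pi>]
  show ?thesis
    by (rule that[OF P0 P1]) (rule reedy_pullbackI[OF f reedy_Fib_arr(1)[OF g] reedy_Fib_arr(1)[OF F(1)] F(2) P0 P1])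
qed

text \<open>A pullback in \<open>K\<close> is only known up to isomorphism. It is compared with the
  levelwise one, and the two components of the comparison transport the pullback squares of
  \<open>C\<close>.\<close>

lemma reedy_pullbackD:
  assumes g: "(\<beta>, \<gamma>, g1, g0) \<in> Fib K"
    and P: "pullback K (\<alpha>, \<gamma>, f1, f0) (\<beta>, \<gamma>, g1, g0) (\<pi>, \<alpha>, p1, p0) (\<pi>, \<beta>, q1, q0)"
  shows "pullback C f0 g0 p0 q0" "pullback C f1 g1 p1 q1" "(\<pi>, \<alpha>, p1, p0) \<in> Fib K"
proof -
  note f = reedy.pullback_arrs(1)[OF P] and p = reedy.pullback_arrs(3)[OF P] and q = reedy.pullback_arrs(4)[OF P]
  obtain \<pi>' p1' p0' q1' q0' where P0: "pullback C f0 g0 p0' q0'" and P1: "pullback C f1 g1 p1' q1'" and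
    P': "pullback K (\<alpha>, \<gamma>, f1, f0) (\<beta>, \<gamma>, g1, g0) (\<pi>', \<alpha>, p1', p0') (\<pi>', \<beta>, q1', q0')"
    by (rule reedy_pullback_exists[OF f g])
  note p' = reedy.pullback_arrs(3)[OF P']
  obtain c d where c: "c \<in> Arr K" "Dom K c = \<pi>"
    "Cod K c = \<pi>'"
    and d: "d \<in> Arr K" "Dom K d = \<pi>'"
    "Cod K d = \<pi>" and
    cd: "Comp K (\<pi>', \<alpha>, p1', p0') c = (\<pi>, \<alpha>, p1, p0)"
    "Comp K (\<pi>', \<beta>, q1', q0') c = (\<pi>, \<beta>, q1, q0)"
    "Comp K d c = Ident K \<pi>"
    "Comp K c d = Ident K \<pi>'"
    by (rule reedy.pullback_iso[OF P P']) auto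
  obtain c1 c0 where ce: "c = (\<pi>, \<pi>', c1, c0)" using c by (cases c) auto
  obtain d1 d0 where de: "d = (\<pi>', \<pi>, d1, d0)" using d by (cases d) auto
  note ca = c(1)[unfolded ce Arr_reedy] and da = d(1)[unfolded de Arr_reedy] and p'a = p'[unfolded Arr_reedy]
  have "pullback C f0 g0 (p0' \<bullet> c0) (q0' \<bullet> c0)"
    by (rule pullback_transport[OF P0, of c0 d0]) (use ca da p'a cd in \<open>auto simp: ce de\<close>)
  then show P0: "pullback C f0 g0 p0 q0" using cd by (simp add: ce)
  have "pullback C f1 g1 (p1' \<bullet> c1) (q1' \<bullet> c1)"
    by (rule pullback_transport[OF P1, of c1 d1]) (use ca da p'a cd in \<open>auto simp: ce de\<close>)
  then show P1: "pullback C f1 g1 p1 q1" using cd by (simp add: ce)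
  show "(\<pi>, \<alpha>, p1, p0) \<in> Fib K"
    by (rule reedy_pullback_Fib[OF f g P0 P1, of \<pi>]) (use p q in \<open>auto simp: Arr_reedy\<close>)
qed

lemma reedy_pullback_obtain:
  assumes P: "pullback K f g p q"
  obtains \<alpha> \<beta> \<gamma> \<pi> f1 f0 g1 g0 p1 p0 q1 q0 where "f = (\<alpha>, \<gamma>, f1, f0)" "g = (\<beta>, \<gamma>, g1, g0)"
    "p = (\<pi>, \<alpha>, p1, p0)" "q = (\<pi>, \<beta>, q1, q0)"
proof -
  note a = reedy.pullback_arrs[OF P]
  show ?thesis using a by (cases f; cases g; cases p; cases q) (auto intro: that)
qed

end

section \<open>The elementary axioms\<close>

lemma acyclic_cofibrationI:
  assumes "i \<in> Arr C"
    and "\<And>p u v. \<lbrakk>p \<in> Fib C; u \<in> Arr C; Dom C u = Dom C i; Cod C u = Dom C p;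
      v \<in> Arr C; Dom C v = Cod C i; Cod C v = Cod C p; Comp C p u = Comp C v i\<rbrakk> \<Longrightarrow>
      \<exists>l. l \<in> Arr C \<and> Dom C l = Cod C i \<and> Cod C l = Dom C p \<and> Comp C l i = u \<and> Comp C p l = v"
  shows "acyclic_cofibration C i"
  using assms unfolding acyclic_cofibration_def by (auto simp: Hom_def Bex_def)

lemma acyclic_cofibration_lift:
  assumes "acyclic_cofibration C i" "p \<in> Fib C" "u \<in> Arr C" "Dom C u = Dom C i" "Cod C u = Dom C p"
      "v \<in> Arr C" "Dom C v = Cod C i" "Cod C v = Cod C p" "Comp C p u = Comp C v i"
  obtains l where "l \<in> Arr C" "Dom C l = Cod C i" "Cod C l = Dom C p" "Comp C l i = u" "Comp C p l = v"
proof -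
  have "\<exists>l \<in> Hom C (Cod C i) (Dom C p). Comp C l i = u \<and> Comp C p l = v"
    using assms in_HomI[OF assms(3-5)] in_HomI[OF assms(6-8)] unfolding acyclic_cofibration_def by blast
  then show ?thesis using that by (auto simp: Hom_def)
qed

context type_theoretic_fibration_category
begin

section \<open>Terminal object, isomorphisms, composites and factorizations\<close>

lemma terminal_reedy: "terminal K (One K)"
proof -
  have T: "One C \<in> Obj C" using terminal_One by (simp add: terminal_def)
  have F: "Ident C (One C) \<in> Fib C" by (rule Fib_Ident[OF T])
  \<comment> \<open>\<open>K\<close> is full in the arrow category and contains its terminal object,
    so existence and uniqueness of maps to it are inherited.\<close>
  have H: "Hom K \<alpha> (Ident C (One C)) = Hom (arrow_cat C) \<alpha> (Ident C (One C))" if "\<alpha> \<in> Fib C" for \<alpha>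
    using that F by (auto simp: Hom_reedy Arr_reedy) (auto simp: Hom_def arrow_cat_def)
  have "\<alpha> \<in> Obj (arrow_cat C)" if "\<alpha> \<in> Fib C" for \<alpha> using that by (simp add: arrow_cat_def)
  then have "\<exists>!f. f \<in> Hom K \<alpha> (Ident C (One C))" if "\<alpha> \<in> Fib C" for \<alpha>
    using terminal_arrow_cat[OF category_axioms terminal_One] that
    unfolding terminal_def H[OF that] by blast
  then show ?thesis using F unfolding terminal_def reedy_fields Obj_reedy by blast
qed

text \<open>Fibrancy of the domain provides some Reedy fibration to the terminal object, and by
  uniqueness that arrow is \<open>f\<close>.\<close>

lemma reedy_Fib_One:
  assumes "f \<in> Arr K" "Cod K f = One K"
  shows "f \<in> Fib K"
proof -
  obtain \<alpha> f1 f0 where f: "f = (\<alpha>, Ident C (One C), f1, f0)" using assms(2) by (cases f) auto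
  have \<alpha>: "\<alpha> \<in> Fib C" using assms(1) by (simp add: f Arr_reedy)
  then obtain h where h: "h \<in> Hom (arrow_cat C) \<alpha> (Ident C (One C))" "h \<in> reedy_fibrations C"
    using reedy_fibrant_iff unfolding reedy_fibrant_def by blast
  have "f \<in> Hom (arrow_cat C) \<alpha> (Ident C (One C))"
    using assms(1) by (auto simp: f Arr_reedy arrow_cat_def Hom_def)
  moreover have "\<alpha> \<in> Obj (arrow_cat C)" using \<alpha> by (simp add: arrow_cat_def)
  ultimately have "f = h"
    using terminal_arrow_cat[OF category_axioms terminal_One] h(1) unfolding terminal_def by blast
  then show ?thesis using h(2) assms(1) by (simp add: Fib_reedy)
qed

lemma iso_reedyD:
  assumes "iso K (\<alpha>, \<beta>, f1, f0)"
  obtains g1 g0 where "(\<alpha>, \<beta>, f1, f0) \<in> Arr K" "(\<beta>, \<alpha>, g1, g0) \<in> Arr K"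
    "g1 \<bullet> f1 = Ident C (Dom C \<alpha>)" "f1 \<bullet> g1 = Ident C (Dom C \<beta>)"
    "g0 \<bullet> f0 = Ident C (Cod C \<alpha>)" "f0 \<bullet> g0 = Ident C (Cod C \<beta>)"
  using assms unfolding iso_def by (auto simp: Hom_reedy)

lemma reedy_Fib_iso:
  assumes "iso K f"
  shows "f \<in> Fib K"
proof -
  obtain \<alpha> \<beta> f1 f0 where f: "f = (\<alpha>, \<beta>, f1, f0)" by (cases f)
  obtain g1 g0 where a: "(\<alpha>, \<beta>, f1, f0) \<in> Arr K" and b: "(\<beta>, \<alpha>, g1, g0) \<in> Arr K"
    and g: "g1 \<bullet> f1 = Ident C (Dom C \<alpha>)" "f1 \<bullet> g1 = Ident C (Dom C \<beta>)"
    "g0 \<bullet> f0 = Ident C (Cod C \<alpha>)" "f0 \<bullet> g0 = Ident C (Cod C \<beta>)"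
    using assms unfolding f by (rule iso_reedyD)
  note aa = a[unfolded Arr_reedy] and ba = b[unfolded Arr_reedy]
  have f0: "f0 \<in> Fib C"
    by (rule Fib_iso, rule isoI[of f0 "Cod C \<alpha>" "Cod C \<beta>" g0]) (use aa ba g in \<open>auto simp: Hom_def\<close>)
  obtain p q where P: "pullback C f0 \<beta> p q" using pullback_exists[of \<beta> f0] aa by auto
  note [simp] = pullback_arrs(3-4,6-8)[OF P]
  obtain k where k: "k \<in> Arr C" "Dom C k = Dom C \<alpha>" "Cod C k = Dom C p" "p \<bullet> k = \<alpha>" "q \<bullet> k = f1"
    by (rule pullback_obtain[OF P, of \<alpha> f1]) (use aa in auto)
  have 1: "(g1 \<bullet> q) \<bullet> k = Ident C (Dom C \<alpha>)" using aa ba g k by simp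
  \<comment> \<open>The gap map of an isomorphism is inverted by going to the top of the codomain
    with \<open>q\<close> and back with \<open>g1\<close>.\<close>
  have 2: "k \<bullet> g1 \<bullet> q = Ident C (Dom C p)"
  proof (rule pullback_cancel[OF P])
    have "\<alpha> \<bullet> g1 \<bullet> q = g0 \<bullet> \<beta> \<bullet> q"
      using aa ba comp_rewrite[of g0 \<beta> \<alpha> g1 q] by simp
    also have "\<dots> = g0 \<bullet> f0 \<bullet> p" by (simp add: pullback_comm[OF P])
    also have "\<dots> = p" using aa ba comp_reduce[OF g(3), of p] by simp
    finally show "p \<bullet> k \<bullet> g1 \<bullet> q = p \<bullet> Ident C (Dom C p)"
      using k aa ba comp_reduce[OF k(4), of "g1 \<bullet> q"] by simp
    show "q \<bullet> k \<bullet> g1 \<bullet> q = q \<bullet> Ident C (Dom C p)"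
      using k aa ba comp_reduce[OF k(5), of "g1 \<bullet> q"] comp_reduce[OF g(2), of q] by simp
  qed (use k aa ba in simp_all)
  have "k \<in> Fib C"
    by (rule Fib_iso, rule isoI[of k "Dom C \<alpha>" "Dom C p" "g1 \<bullet> q"]) (use k aa ba 1 2 in \<open>auto simp: Hom_def\<close>)
  then show ?thesis unfolding f by (rule reedyI[OF a f0 P _ k(2-5)])
qed

text \<open>The gap map of the composite is the gap map of the first factor followed by a pullback of the
  gap map of the second.\<close>

lemma reedy_Fib_Comp:
  assumes "f \<in> Fib K" "g \<in> Fib K" "Cod K f = Dom K g"
  shows "Comp K g f \<in> Fib K"
proof -
  obtain \<alpha> \<beta> \<gamma> f1 f0 g1 g0 where e: "f = (\<alpha>, \<beta>, f1, f0)" "g = (\<beta>, \<gamma>, g1, g0)"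
    using assms(3) by (cases f, cases g) auto
  have F: "(\<alpha>, \<beta>, f1, f0) \<in> Fib K" and G: "(\<beta>, \<gamma>, g1, g0) \<in> Fib K" using assms e by auto
  note f = reedy_Fib_arr[OF F] and g = reedy_Fib_arr[OF G]
  note [simp] = f[unfolded Arr_reedy] g[unfolded Arr_reedy]
  have fc: "f0 \<bullet> \<alpha> = \<beta> \<bullet> f1" and gc: "g0 \<bullet> \<beta> = \<gamma> \<bullet> g1" by simp_all
  have gf: "g0 \<bullet> f0 \<in> Fib C" by (rule Fib_Comp) simp_all
  obtain p q where W: "pullback C (g0 \<bullet> f0) \<gamma> p q" using pullback_exists[of \<gamma> "g0 \<bullet> f0"] by auto
  obtain p' q' k' where W': "pullback C f0 \<beta> p' q'" and k': "k' \<in> Fib C" "Dom C k' = Dom C \<alpha>" "Cod C k' = Dom C p'"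
    "p' \<bullet> k' = \<alpha>" "q' \<bullet> k' = f1"
    by (rule reedy_gap_obtain[OF F])
  obtain r s j where R: "pullback C g0 \<gamma> r s" and j: "j \<in> Fib C" "Dom C j = Dom C \<beta>" "Cod C j = Dom C r"
    "r \<bullet> j = \<beta>" "s \<bullet> j = g1"
    by (rule reedy_gap_obtain[OF G])
  have [simp]: "p \<in> Arr C" "q \<in> Arr C" "Dom C q = Dom C p" "Cod C p = Cod C \<alpha>" "Cod C q = Dom C \<gamma>"
    using pullback_arrs[OF W] by simp_all
  note [simp] = pullback_arrs(3-4,6-8)[OF W'] pullback_arrs(3-4,6-8)[OF R] j(1-3) k'(1-3)
  have Wc: "g0 \<bullet> f0 \<bullet> p = \<gamma> \<bullet> q" using pullback_comm[OF W] by simp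
  \<comment> \<open>\<open>d\<close> goes from the base \<open>W\<close> of the gap map of the
    composite to the base \<open>R\<close> for \<open>g\<close>, and \<open>e\<close> below from the
    base \<open>W'\<close> for \<open>f\<close> to \<open>W\<close>; then \<open>e\<close> is the
    pullback of the gap map \<open>j\<close> along \<open>d\<close>.\<close>
  obtain d where d: "d \<in> Arr C" "Dom C d = Dom C p" "Cod C d = Dom C r" "r \<bullet> d = f0 \<bullet> p" "s \<bullet> d = q"
    by (rule pullback_obtain[OF R, of "f0 \<bullet> p" q]) (use Wc in simp_all)
  note [simp] = d(1-3)
  have "(g0 \<bullet> f0) \<bullet> p' = \<gamma> \<bullet> g1 \<bullet> q'"
    using comp_rewrite[OF gc, of q'] pullback_comm[OF W'] by simp
  then obtain e where e': "e \<in> Arr C" "Dom C e = Dom C p'" "Cod C e = Dom C p" "p \<bullet> e = p'" "q \<bullet> e = g1 \<bullet> q'"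
    by - (rule pullback_obtain[OF W, of p' "g1 \<bullet> q'"], simp_all)
  note [simp] = e'(1-3)
  have "pullback C d j e q'"
  proof (rule pullbackI)
    show "d \<bullet> e = j \<bullet> q'"
      by (rule pullback_cancel[OF R])
        (simp_all add: comp_rewrite[OF d(4)] comp_reduce[OF d(5)] comp_reduce[OF j(4)] comp_reduce[OF j(5)]
          e'(4,5) pullback_comm[OF W'])
  next
    fix x y
    assume xy [simp]: "x \<in> Arr C" "y \<in> Arr C" "Dom C x = Dom C y" "Cod C x = Dom C d" "Cod C y = Dom C j"
      and xe: "d \<bullet> x = j \<bullet> y"
    have "f0 \<bullet> p \<bullet> x = \<beta> \<bullet> y"
      using comp_rewrite[OF d(4), of x] comp_reduce[OF j(4), of y] xe by simp
    then obtain t where t: "t \<in> Arr C" "Dom C t = Dom C x" "Cod C t = Dom C p'" "p' \<bullet> t = p \<bullet> x" "q' \<bullet> t = y"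
      by - (rule pullback_obtain[OF W', of "p \<bullet> x" y], simp_all)
    note [simp] = t(1-3)
    have "q \<bullet> x = g1 \<bullet> y" 
      using comp_reduce[OF d(5), of x] comp_reduce[OF j(5), of y] xe by simp
    then have "e \<bullet> t = x"
      by - (rule pullback_cancel[OF W], simp_all add: comp_reduce[OF e'(4)] comp_rewrite[OF e'(5)] t)
    then show "\<exists>t. t \<in> Arr C \<and> Dom C t = Dom C x \<and> Cod C t = Dom C e \<and> e \<bullet> t = x \<and> q' \<bullet> t = y"
      by (intro exI[of _ t]) (simp add: t)
  next
    fix s t
    assume [simp]: "s \<in> Arr C" "t \<in> Arr C" "Dom C s = Dom C t" "Cod C s = Dom C e" "Cod C t = Dom C e"
      and e: "e \<bullet> s = e \<bullet> t" "q' \<bullet> s = q' \<bullet> t"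
    have "p \<bullet> e \<bullet> s = p \<bullet> e \<bullet> t" by (simp add: e)
    then have "p' \<bullet> s = p' \<bullet> t" by (simp add: comp_reduce[OF e'(4)])
    with e(2) show "s = t" by - (rule pullback_cancel[OF W'], simp_all)
  qed simp_all
  from pullback_Fib[OF j(1) this] have eF: "e \<in> Fib C" .
  have kF: "e \<bullet> k' \<in> Fib C" by (rule Fib_Comp[OF k'(1) eF]) simp
  have "Comp K g f \<in> Arr K" unfolding e using reedy.comp_simps[OF f(1) g(1)] by simp
  then show ?thesis unfolding e reedy_fields
    by (rule reedyI[OF _ gf W kF])
      (simp_all add: comp_reduce[OF e'(4)] comp_rewrite[OF e'(5)] k'(4,5))
qed

text \<open>The top is factored only after the bottom: the arrow to factor is the map
  \<open>k\<close> induced by \<open>i0 \<bullet> \<alpha>\<close> and \<open>f1\<close> into the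
  pullback of \<beta> along \<open>p0\<close>. Its fibration part \<open>j\<close> is then by
  construction the gap map of the second factor, and \<open>u \<bullet> j\<close> is fibrant as a
  composite of fibrations.\<close>

lemma reedy_factorization:
  assumes "f \<in> Arr K"
  obtains \<alpha> \<beta> \<gamma> i1 i0 p1 p0 where "f = Comp K (\<gamma>, \<beta>, p1, p0) (\<alpha>, \<gamma>, i1, i0)" "Dom K f = \<alpha>" "Cod K f = \<beta>"
    "(\<alpha>, \<gamma>, i1, i0) \<in> Arr K" "(\<gamma>, \<beta>, p1, p0) \<in> Fib K"
    "acyclic_cofibration C i1" "acyclic_cofibration C i0"
proof -
  obtain \<alpha> \<beta> f1 f0 where f: "f = (\<alpha>, \<beta>, f1, f0)" by (cases f)
  note [simp] = assms[unfolded f Arr_reedy]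
  obtain i0 p0 where i0: "acyclic_cofibration C i0" and p0: "p0 \<in> Fib C"
      "Dom C i0 = Cod C \<alpha>" "Cod C i0 = Dom C p0" "Cod C p0 = Cod C \<beta>" "f0 = p0 \<bullet> i0"
    using factorization[of f0] by auto
  have [simp]: "i0 \<in> Arr C" using i0 by (simp add: acyclic_cofibration_def)
  note [simp] = p0(1-4)
  obtain u v where W: "pullback C p0 \<beta> u v" using pullback_exists[of \<beta> p0] by auto
  have u: "u \<in> Fib C" by (rule pullback_Fib[OF _ W]) simp
  note [simp] = pullback_arrs(3-4,6-8)[OF W]
  have "p0 \<bullet> i0 \<bullet> \<alpha> = \<beta> \<bullet> f1" using p0(5) assms[unfolded f Arr_reedy] by simp
  then obtain k where k: "k \<in> Arr C" "Dom C k = Dom C \<alpha>" "Cod C k = Dom C u" "u \<bullet> k = i0 \<bullet> \<alpha>" "v \<bullet> k = f1"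
    by - (rule pullback_obtain[OF W, of "i0 \<bullet> \<alpha>" f1], simp_all)
  obtain i1 j where i1: "acyclic_cofibration C i1" and j: "j \<in> Fib C"
      "Dom C i1 = Dom C \<alpha>" "Cod C i1 = Dom C j" "Cod C j = Dom C u" "k = j \<bullet> i1"
    using factorization[of k] k by auto
  have [simp]: "i1 \<in> Arr C" using i1 by (simp add: acyclic_cofibration_def)
  note [simp] = j(1-4)
  have \<gamma>: "u \<bullet> j \<in> Fib C" by (rule Fib_Comp[OF j(1) u]) simp
  have I: "(\<alpha>, u \<bullet> j, i1, i0) \<in> Arr K" using \<gamma> k j(5) unfolding Arr_reedy by simp
  have "p0 \<bullet> u \<bullet> j = \<beta> \<bullet> v \<bullet> j" by (rule comp_rewrite[OF pullback_comm[OF W]]) simp_all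
  then have "(u \<bullet> j, \<beta>, v \<bullet> j, p0) \<in> Arr K" using \<gamma> unfolding Arr_reedy by simp
  then have P: "(u \<bullet> j, \<beta>, v \<bullet> j, p0) \<in> Fib K"
    by (rule reedyI[OF _ p0(1) W j(1)]) simp_all
  show ?thesis
    by (rule that[OF _ _ _ I P i1 i0]) (use k j(5) p0(5) in \<open>simp_all add: f\<close>)
qed

section \<open>Acyclic cofibrations, level by level\<close>

lemma acyclic_cofibration_reedyI:
  assumes i: "(\<alpha>, \<beta>, i1, i0) \<in> Arr K"
    and i1: "acyclic_cofibration C i1" and i0: "acyclic_cofibration C i0"
  shows "acyclic_cofibration K (\<alpha>, \<beta>, i1, i0)"
  unfolding acyclic_cofibration_def
proof (intro conjI allI impI)
  fix p u v
  assume *: "p \<in> Fib K \<and> u \<in> Hom K (Dom K (\<alpha>, \<beta>, i1, i0)) (Dom K p) \<and>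
       v \<in> Hom K (Cod K (\<alpha>, \<beta>, i1, i0)) (Cod K p) \<and> Comp K p u = Comp K v (\<alpha>, \<beta>, i1, i0)"
  obtain \<xi> \<eta> p1 p0 where p: "p = (\<xi>, \<eta>, p1, p0)" by (cases p)
  have P: "(\<xi>, \<eta>, p1, p0) \<in> Fib K" using * by (simp add: p)
  from * obtain u1 u0 v1 v0 where u: "u = (\<alpha>, \<xi>, u1, u0)" and ua: "(\<alpha>, \<xi>, u1, u0) \<in> Arr K"
    and v: "v = (\<beta>, \<eta>, v1, v0)" and va: "(\<beta>, \<eta>, v1, v0) \<in> Arr K"
    and e1: "p1 \<bullet> u1 = v1 \<bullet> i1" and e0: "p0 \<bullet> u0 = v0 \<bullet> i0"
    by (auto simp: p Hom_reedy)
  note [simp] = i[unfolded Arr_reedy] ua[unfolded Arr_reedy] va[unfolded Arr_reedy]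
    reedy_Fib_arr[OF P, unfolded Arr_reedy]
  obtain l0 where l0: "l0 \<in> Arr C" "Dom C l0 = Cod C \<beta>" "Cod C l0 = Cod C \<xi>" "l0 \<bullet> i0 = u0" "p0 \<bullet> l0 = v0"
    by (rule acyclic_cofibration_lift[OF i0, of p0 u0 v0]) (use e0 in simp_all)
  note [simp] = l0(1-3)
  obtain r s k where R: "pullback C p0 \<eta> r s" and k: "k \<in> Fib C" "Dom C k = Dom C \<xi>" "Cod C k = Dom C r"
    "r \<bullet> k = \<xi>" "s \<bullet> k = p1"
    by (rule reedy_gap_obtain[OF P])
  note [simp] = pullback_arrs(3-4,6-8)[OF R] k(1-3)
  \<comment> \<open>The bottom of the second lifting problem. Since \<open>m\<close> already
    contains \<open>l0 \<bullet> \<beta>\<close>, any lift \<open>l1\<close> of it through the gap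
    map \<open>k\<close> automatically forms a square with \<open>l0\<close>.\<close>
  obtain m where m: "m \<in> Arr C" "Dom C m = Dom C \<beta>" "Cod C m = Dom C r" "r \<bullet> m = l0 \<bullet> \<beta>" "s \<bullet> m = v1"
    by (rule pullback_obtain[OF R, of "l0 \<bullet> \<beta>" v1]) (simp_all add: comp_reduce[OF l0(5)])
  note [simp] = m(1-3)
  have ic: "i0 \<bullet> \<alpha> = \<beta> \<bullet> i1" and uc: "u0 \<bullet> \<alpha> = \<xi> \<bullet> u1" by simp_all
  have km: "k \<bullet> u1 = m \<bullet> i1"
  proof (rule pullback_cancel[OF R])
    have "l0 \<bullet> \<beta> \<bullet> i1 = \<xi> \<bullet> u1"
      using comp_reduce[OF l0(4), of \<alpha>] uc ic by simp
    then show "r \<bullet> k \<bullet> u1 = r \<bullet> m \<bullet> i1"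
      by (simp add: comp_reduce[OF k(4)] comp_rewrite[OF m(4)])
    show "s \<bullet> k \<bullet> u1 = s \<bullet> m \<bullet> i1"
      by (simp add: comp_reduce[OF k(5)] comp_reduce[OF m(5)] e1)
  qed simp_all
  obtain l1 where l1: "l1 \<in> Arr C" "Dom C l1 = Dom C \<beta>" "Cod C l1 = Dom C \<xi>" "l1 \<bullet> i1 = u1" "k \<bullet> l1 = m"
    by (rule acyclic_cofibration_lift[OF i1, of k u1 m]) (use km in simp_all)
  note [simp] = l1(1-3)
  have "\<xi> \<bullet> l1 = l0 \<bullet> \<beta>"
    using comp_reduce[OF k(4), of l1] l1(5) m(4) by simp
  then have L: "(\<beta>, \<xi>, l1, l0) \<in> Arr K" unfolding Arr_reedy by simp
  have "p1 \<bullet> l1 = v1" using comp_reduce[OF k(5), of l1] l1(5) m(5) by simp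
  then show "\<exists>l \<in> Hom K (Cod K (\<alpha>, \<beta>, i1, i0)) (Dom K p). Comp K l (\<alpha>, \<beta>, i1, i0) = u \<and> Comp K p l = v"
    using L l0 l1 by (intro bexI[of _ "(\<beta>, \<xi>, l1, l0)"]) (simp_all add: p u v Hom_reedy)
qed (rule i)

text \<open>The square from \<open>p\<close> to \<open>p\<close> with identities as structure maps
  is itself a pullback, so its gap map is an identity.\<close>

lemma reedy_Fib_Ident:
  assumes p: "p \<in> Fib C"
  shows "(Ident C (Dom C p), Ident C (Cod C p), p, p) \<in> Fib K"
proof -
  have a: "(Ident C (Dom C p), Ident C (Cod C p), p, p) \<in> Arr K"
    using p Fib_Ident unfolding Arr_reedy by simp
  show ?thesis
    by (rule reedyI[OF a p pullback_Ident_right, of "Ident C (Dom C p)"]) (use p Fib_Ident in simp_all)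
qed

text \<open>Pulling \<open>y\<close> back along the identity of the terminal object changes nothing,
  so the gap map is \<open>p\<close> itself.\<close>

lemma reedy_Fib_terminal:
  assumes p: "p \<in> Fib C" and x: "x \<in> Hom C (Dom C p) (One C)" and y: "y \<in> Hom C (Cod C p) (One C)"
  shows "(x, y, p, Ident C (One C)) \<in> Fib K"
proof -
  have T: "One C \<in> Obj C" using terminal_One by (simp add: terminal_def)
  note [simp] = p T in_HomD[OF x] in_HomD[OF y]
  have e: "y \<bullet> p = x" by (rule terminal_unique[OF terminal_One]) (auto simp: Hom_def)
  have a: "(x, y, p, Ident C (One C)) \<in> Arr K"
    using Fib_One[of x] Fib_One[of y] e unfolding Arr_reedy by simp
  have P: "pullback C (Ident C (One C)) y y (Ident C (Cod C p))"
    using pullback_sym[OF pullback_Ident_right[of y]] by simp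
  show ?thesis by (rule reedyI[OF a Fib_Ident[OF T] P p]) (simp_all add: e)
qed

text \<open>\<open>X \<mapsto> id\<^sub>X\<close> and \<open>X \<mapsto> (X \<rightarrow> 1)\<close> are right adjoint to the evaluations at \<open>0\<close> and \<open>1\<close> and preserve
  fibrations, so the evaluations preserve acyclic cofibrations.\<close>

lemma acyclic_cofibration_reedyD:
  assumes ac: "acyclic_cofibration K (\<alpha>, \<beta>, i1, i0)"
  shows "(\<alpha>, \<beta>, i1, i0) \<in> Arr K" "acyclic_cofibration C i1" "acyclic_cofibration C i0"
proof -
  show i: "(\<alpha>, \<beta>, i1, i0) \<in> Arr K" using ac unfolding acyclic_cofibration_def by blast
  have lift: "\<exists>l1 l0. (\<beta>, \<xi>, l1, l0) \<in> Arr K \<and> l1 \<bullet> i1 = u1 \<and> l0 \<bullet> i0 = u0 \<and> p1 \<bullet> l1 = v1 \<and> p0 \<bullet> l0 = v0"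
    if h: "(\<xi>, \<eta>, p1, p0) \<in> Fib K" "(\<alpha>, \<xi>, u1, u0) \<in> Arr K" "(\<beta>, \<eta>, v1, v0) \<in> Arr K"
      "p1 \<bullet> u1 = v1 \<bullet> i1" "p0 \<bullet> u0 = v0 \<bullet> i0" for \<xi> \<eta> p1 p0 u1 u0 v1 v0
  proof -
    obtain l where l: "l \<in> Arr K" "Dom K l = Cod K (\<alpha>, \<beta>, i1, i0)" "Cod K l = Dom K (\<xi>, \<eta>, p1, p0)"
      "Comp K l (\<alpha>, \<beta>, i1, i0) = (\<alpha>, \<xi>, u1, u0)" "Comp K (\<xi>, \<eta>, p1, p0) l = (\<beta>, \<eta>, v1, v0)"
      by (rule acyclic_cofibration_lift[OF ac h(1,2) _ _ h(3)]) (use h in simp_all)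
    then show ?thesis by (cases l) auto
  qed
  note [simp] = i[unfolded Arr_reedy]
  have ic: "i0 \<bullet> \<alpha> = \<beta> \<bullet> i1" by simp
  show "acyclic_cofibration C i0"
  proof (rule acyclic_cofibrationI)
    fix p u v
    assume p: "p \<in> Fib C" and [simp]: "u \<in> Arr C" "Dom C u = Dom C i0" "Cod C u = Dom C p"
      "v \<in> Arr C" "Dom C v = Cod C i0" "Cod C v = Cod C p" and e: "p \<bullet> u = v \<bullet> i0"
    note [simp] = p
    \<comment> \<open>The transposes of \<open>u\<close> and \<open>v\<close>: an arrow of
      \<open>K\<close> into an identity is determined by its bottom component, the top being the
      composite with the structure map.\<close>
    have U: "(\<alpha>, Ident C (Dom C p), u \<bullet> \<alpha>, u) \<in> Arr K" and V: "(\<beta>, Ident C (Cod C p), v \<bullet> \<beta>, v) \<in> Arr K"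
      using Fib_Ident unfolding Arr_reedy by simp_all
    have "p \<bullet> u \<bullet> \<alpha> = v \<bullet> i0 \<bullet> \<alpha>" by (rule comp_rewrite[OF e]) simp_all
    then have e1: "p \<bullet> u \<bullet> \<alpha> = (v \<bullet> \<beta>) \<bullet> i1" by simp
    obtain l1 l0 where l: "(\<beta>, Ident C (Dom C p), l1, l0) \<in> Arr K" "l0 \<bullet> i0 = u" "p \<bullet> l0 = v"
      using lift[OF reedy_Fib_Ident[OF p] U V e1 e] by blast
    from l(1) show "\<exists>l. l \<in> Arr C \<and> Dom C l = Cod C i0 \<and> Cod C l = Dom C p \<and> l \<bullet> i0 = u \<and> p \<bullet> l = v"
      unfolding Arr_reedy by (intro exI[of _ l0]) (simp add: l)
  qed simp
  show "acyclic_cofibration C i1"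
  proof (rule acyclic_cofibrationI)
    fix p u v
    assume p: "p \<in> Fib C" and [simp]: "u \<in> Arr C" "Dom C u = Dom C i1" "Cod C u = Dom C p"
      "v \<in> Arr C" "Dom C v = Cod C i1" "Cod C v = Cod C p" and e: "p \<bullet> u = v \<bullet> i1"
    have T: "One C \<in> Obj C" using terminal_One by (simp add: terminal_def)
    note [simp] = p T
    obtain x where x [simp]: "x \<in> Arr C" "Dom C x = Dom C p" "Cod C x = One C"
      by (rule terminal_obtain[OF terminal_One, of "Dom C p"]) simp
    obtain y where y [simp]: "y \<in> Arr C" "Dom C y = Cod C p" "Cod C y = One C"
      by (rule terminal_obtain[OF terminal_One, of "Cod C p"]) simp
    obtain a where a [simp]: "a \<in> Arr C" "Dom C a = Cod C \<alpha>" "Cod C a = One C"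
      by (rule terminal_obtain[OF terminal_One, of "Cod C \<alpha>"]) simp
    obtain b where b [simp]: "b \<in> Arr C" "Dom C b = Cod C \<beta>" "Cod C b = One C"
      by (rule terminal_obtain[OF terminal_One, of "Cod C \<beta>"]) simp
    have xF: "x \<in> Fib C" "y \<in> Fib C" using Fib_One by simp_all
    have ts: "h = k" if "h \<in> Arr C" "k \<in> Arr C" "Dom C h = Dom C k" "Cod C h = One C" "Cod C k = One C" for h k
      by (rule terminal_unique[OF terminal_One, of h "Dom C k"]) (use that in \<open>auto simp: Hom_def\<close>)
    have F: "(x, y, p, Ident C (One C)) \<in> Fib K"
      by (rule reedy_Fib_terminal[OF p]) (auto simp: Hom_def)
    \<comment> \<open>The transposes of \<open>u\<close> and \<open>v\<close>: the bottom components
      are maps to \<open>One C\<close>, so the squares commute by \<open>ts\<close>.\<close>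
    have U: "(\<alpha>, x, u, a) \<in> Arr K" using xF ts[of "a \<bullet> \<alpha>" "x \<bullet> u"] unfolding Arr_reedy by simp
    have V: "(\<beta>, y, v, b) \<in> Arr K" using xF ts[of "b \<bullet> \<beta>" "y \<bullet> v"] unfolding Arr_reedy by simp
    obtain l1 l0 where l: "(\<beta>, x, l1, l0) \<in> Arr K" "l1 \<bullet> i1 = u" "p \<bullet> l1 = v"
      using lift[OF F U V e] ts[of "Ident C (One C) \<bullet> a" "b \<bullet> i0"] by fastforce
    from l(1) show "\<exists>l. l \<in> Arr C \<and> Dom C l = Cod C i1 \<and> Cod C l = Dom C p \<and> l \<bullet> i1 = u \<and> p \<bullet> l = v"
      unfolding Arr_reedy by (intro exI[of _ l1]) (simp add: l)
  qed simp
qed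

text \<open>Pullbacks along Reedy fibrations and acyclic cofibrations both split into levels, so the
  axiom of \<open>C\<close> applies to \<open>k1\<close> and to \<open>k0\<close>
  separately.\<close>

lemma reedy_acyclic_cofibration_pullback:
  assumes a: "a \<in> Fib K" and b: "b \<in> Fib K" and ab: "Cod K a = Cod K b"
    and i: "acyclic_cofibration K i" "i \<in> Hom K (Dom K a) (Dom K b)" "Comp K b i = a"
    and P: "pullback K z a p q" and P': "pullback K z b p' q'"
    and k: "k \<in> Hom K (Dom K p) (Dom K p')" "Comp K p' k = p" "Comp K q' k = Comp K i q"
  shows "acyclic_cofibration K k"
proof -
  obtain \<alpha> \<gamma> \<zeta> \<pi> a1 a0 z1 z0 p1 p0 q1 q0 where e: "z = (\<zeta>, \<gamma>, z1, z0)" "a = (\<alpha>, \<gamma>, a1, a0)"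
    "p = (\<pi>, \<zeta>, p1, p0)" "q = (\<pi>, \<alpha>, q1, q0)"
    using P by (rule reedy_pullback_obtain)
  obtain \<beta> \<pi>' b1 b0 p1' p0' q1' q0' where e': "b = (\<beta>, \<gamma>, b1, b0)" "p' = (\<pi>', \<zeta>, p1', p0')" "q' = (\<pi>', \<beta>, q1', q0')"
    using P' by (rule reedy_pullback_obtain) (simp add: e)
  obtain i1 i0 where ie: "i = (\<alpha>, \<beta>, i1, i0)" using i(2) by (auto simp: e e' Hom_reedy)
  obtain k1 k0 where ke: "k = (\<pi>, \<pi>', k1, k0)" using k(1) by (auto simp: e e' Hom_reedy)
  note A = a[unfolded e] and B = b[unfolded e']
  note PC = reedy_pullbackD[OF A P[unfolded e]] and PC' = reedy_pullbackD[OF B P'[unfolded e e']]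
  note ic = acyclic_cofibration_reedyD[OF i(1)[unfolded ie]]
  have kA: "(\<pi>, \<pi>', k1, k0) \<in> Arr K" using k(1) by (simp add: ke Hom_reedy e e')
  note aa = reedy_Fib_arr[OF A, unfolded Arr_reedy] and bb = reedy_Fib_arr[OF B, unfolded Arr_reedy]
    and ii = ic(1)[unfolded Arr_reedy] and kk = kA[unfolded Arr_reedy]
    and zz = reedy.pullback_arrs(1)[OF P, unfolded e Arr_reedy]
    and pp = reedy_Fib_arr(1)[OF PC(3), unfolded Arr_reedy]
    and pp' = reedy_Fib_arr(1)[OF PC'(3), unfolded Arr_reedy]
  show ?thesis unfolding ke
  proof (rule acyclic_cofibration_reedyI[OF kA])
    show "acyclic_cofibration C k1"
      by (rule acyclic_cofibration_pullback[OF reedy_top_Fib[OF A] reedy_top_Fib[OF B] _ ic(2) _ _ _ _ PC(2) PC'(2)])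
        (use aa bb ii kk zz pp pp' i(3) k in \<open>auto simp: Hom_def e e' ie ke\<close>)
    show "acyclic_cofibration C k0"
      by (rule acyclic_cofibration_pullback[OF aa(2) bb(2) _ ic(3) _ _ _ _ PC(1) PC'(1)])
        (use aa bb ii kk zz pp pp' i(3) k in \<open>auto simp: Hom_def e e' ie ke\<close>)
  qed
qed

end

section \<open>Dependent products of Reedy fibrations\<close>

context pullback_along
begin

text \<open>The set \<open>F\<close> is part of the choice: the values of the adjoint are selected
  together with their counits, so that they can be required to be fibrations.\<close>

lemma partial_right_adjoint_of_dependent_products:
  assumes S: "S \<subseteq> {f \<in> Arr C. Cod C f = Dom C g}"
    and dp: "\<And>f. f \<in> S \<Longrightarrow> \<exists>\<pi> \<in> F. \<exists>p q \<epsilon>. dependent_product C g f \<pi> p q \<epsilon>"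
  shows "\<exists>Ro Ra \<phi>. partial_right_adjoint (slice C (Cod C g)) (slice C (Dom C g))
      (pullback_obj C g) (pullback_arr C g) S Ro Ra \<phi> \<and> (\<forall>f \<in> S. Ro f \<in> F)"
proof -
  have "\<exists>\<pi> e. \<pi> \<in> F \<and> couniversal (slice C (Cod C g)) (slice C (Dom C g))
      (pullback_obj C g) (pullback_arr C g) f \<pi> e" if "f \<in> S" for f
    using dp[OF that] couniversal_of_dependent_product by blast
  then obtain Ro e where R: "\<And>f. f \<in> S \<Longrightarrow> Ro f \<in> F" and
    u: "\<And>f. f \<in> S \<Longrightarrow> couniversal (slice C (Cod C g)) (slice C (Dom C g))
      (pullback_obj C g) (pullback_arr C g) f (Ro f) (e f)"
    by metis
  have "S \<subseteq> Obj (slice C (Dom C g))" using S by (auto simp: slice_def)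
  from partial_right_adjoint_of_couniversal[OF pullback_functor this u] R show ?thesis by blast
qed

end

context type_theoretic_fibration_category
begin

text \<open>Condition (4) for \<open>C\<close>, restated for arbitrary pullbacks; this is the form
  in which it is applied at each level.\<close>

lemma dependent_product_exists:
  assumes gF: "g \<in> Fib C" and f: "f \<in> Fib C" "Cod C f = Dom C g"
  obtains \<pi> p q \<epsilon> where "dependent_product C g f \<pi> p q \<epsilon>" "\<pi> \<in> Fib C"
proof -
  interpret pullback_along C g
  proof
    fix h assume "h \<in> Arr C" "Cod C h = Cod C g"
    from pullback_exists[OF gF this] show "\<exists>p q. pullback C g h p q" using pullback_sym by blast
  qed (use gF in simp)
  obtain Ro Ra \<phi> where R: "partial_right_adjoint (slice C (Cod C g)) (slice C (Dom C g))
          (pullback_obj C g) (pullback_arr C g) {f \<in> Fib C. Cod C f = Dom C g} Ro Ra \<phi>"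
    and RF: "Ro f \<in> Fib C"
    using Pi_exists[OF gF] f by blast
  obtain e where "couniversal (slice C (Cod C g)) (slice C (Dom C g))
      (pullback_obj C g) (pullback_arr C g) f (Ro f) e"
    using couniversal_of_partial_right_adjoint[OF R, of f] f by blast
  from dependent_product_of_couniversal[OF FibD[OF f(1)] f(2) this] RF that show ?thesis by blast
qed

text \<open>Over \<open>B\<close>, the product \<open>P\<close> has \<open>P\<^sub>0 = \<Pi>\<^bsub>g0\<^esub> E\<^sub>0\<close> at the bottom. A map into it from \<open>Z\<close> amounts to a map
  \<open>Z\<^sub>0 \<rightarrow> P\<^sub>0\<close>, which together with \<open>z1\<close> gives a map \<open>r\<close> from \<open>Z\<^sub>1\<close> to the pullback \<open>Q\<close> of \<open>P\<^sub>0\<close> along \<open>\<beta>\<close>,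
  and a lift of \<open>g1\<^sup>*Z\<^sub>1 \<rightarrow> g1\<^sup>*Q \<rightarrow> M\<close> along the gap map \<open>E\<^sub>1 \<rightarrow> M\<close> of \<open>f\<close>. Hence \<open>P\<^sub>1\<close> is the product along
  \<open>q : g1\<^sup>*Q \<rightarrow> Q\<close> of the pullback \<open>n\<close> of that gap map.\<close>

lemma reedy_dependent_product:
  assumes g: "(\<alpha>, \<beta>, g1, g0) \<in> Fib K" and f: "(\<eta>, \<alpha>, f1, f0) \<in> Fib K"
  shows "\<exists>\<pi> \<in> Fib K. \<exists>p q \<epsilon>. dependent_product K (\<alpha>, \<beta>, g1, g0) (\<eta>, \<alpha>, f1, f0) \<pi> p q \<epsilon>"
proof -
  have ga: "g1 \<in> Fib C" "Dom C g1 = Dom C \<alpha>" "Cod C g1 = Dom C \<beta>"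
    "g0 \<in> Fib C" "Dom C g0 = Cod C \<alpha>" "Cod C g0 = Cod C \<beta>" "\<alpha> \<in> Fib C" "\<beta> \<in> Fib C"
    and gc: "g0 \<bullet> \<alpha> = \<beta> \<bullet> g1"
    using reedy_Fib_arr[OF g] reedy_top_Fib[OF g] by (simp_all add: Arr_reedy)
  have fa: "f1 \<in> Fib C" "Dom C f1 = Dom C \<eta>" "Cod C f1 = Dom C \<alpha>"
    "f0 \<in> Fib C" "Dom C f0 = Cod C \<eta>" "Cod C f0 = Cod C \<alpha>" "\<eta> \<in> Fib C"
    and fc: "f0 \<bullet> \<eta> = \<alpha> \<bullet> f1"
    using reedy_Fib_arr[OF f] reedy_top_Fib[OF f] by (simp_all add: Arr_reedy)
  note [simp] = ga fa

  obtain \<pi>0 p0 q0 \<epsilon>0 where dp0: "dependent_product C g0 f0 \<pi>0 p0 q0 \<epsilon>0" and [simp]: "\<pi>0 \<in> Fib C"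
    by (rule dependent_product_exists[of g0 f0]) simp_all
  have G0: "pullback C g0 \<pi>0 p0 q0" and \<epsilon>0: "\<epsilon>0 \<in> Arr C" "Dom C \<epsilon>0 = Dom C p0" "Cod C \<epsilon>0 = Cod C \<eta>" "f0 \<bullet> \<epsilon>0 = p0"
    using dependent_productD[OF dp0] by simp_all
  have [simp]: "Cod C \<pi>0 = Cod C \<beta>" using pullback_arrs(5)[OF G0] by simp
  note [simp] = pullback_arrs(3-4,6-8)[OF G0] \<epsilon>0(1-3)

  obtain c b where Q: "pullback C \<pi>0 \<beta> c b" using pullback_exists[of \<beta> \<pi>0] by auto
  have [simp]: "c \<in> Fib C" "b \<in> Fib C"
    using pullback_Fib[OF _ Q] pullback_Fib[OF _ pullback_sym[OF Q]] by simp_all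
  note [simp] = pullback_arrs(3-4,6-8)[OF Q]
  obtain a q where G: "pullback C g1 b a q" using pullback_exists[of b g1] by auto
  note [simp] = pullback_arrs(3-4,6-8)[OF G]
  have [simp]: "q \<in> Fib C" using pullback_Fib[OF _ pullback_sym[OF G]] by simp
  obtain m0 m1 \<phi> where M: "pullback C f0 \<alpha> m0 m1" and \<phi>: "\<phi> \<in> Fib C" "Dom C \<phi> = Dom C \<eta>" "Cod C \<phi> = Dom C m0"
    "m0 \<bullet> \<phi> = \<eta>" "m1 \<bullet> \<phi> = f1"
    by (rule reedy_gap_obtain[OF f])
  note [simp] = pullback_arrs(3-4,6-8)[OF M] \<phi>(1-3)

  \<comment> \<open>\<open>t\<close> compares the pullback of \<open>Q\<close> along
    \<open>g1\<close> with the pullback of the bottom product along \<open>g0\<close>. Evaluating it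
    by \<open>\<epsilon>0\<close> and pairing the result with \<open>a\<close> gives the map
    \<open>e\<close> into the base \<open>M\<close> of the gap map \<phi>.\<close>
  have "g0 \<bullet> \<alpha> \<bullet> a = \<beta> \<bullet> g1 \<bullet> a" by (rule comp_rewrite[OF gc]) simp_all
  also have "\<dots> = \<beta> \<bullet> b \<bullet> q" by (simp add: pullback_comm[OF G])
  also have "\<dots> = \<pi>0 \<bullet> c \<bullet> q" by (rule comp_rewrite[OF pullback_comm[OF Q], symmetric]) simp_all
  finally obtain t where t: "t \<in> Arr C" "Dom C t = Dom C a" "Cod C t = Dom C p0" "p0 \<bullet> t = \<alpha> \<bullet> a" "q0 \<bullet> t = c \<bullet> q"
    by - (rule pullback_obtain[OF G0, of "\<alpha> \<bullet> a" "c \<bullet> q"], simp_all)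
  note [simp] = t(1-3)
  obtain e where e: "e \<in> Arr C" "Dom C e = Dom C a" "Cod C e = Dom C m0" "m0 \<bullet> e = \<epsilon>0 \<bullet> t" "m1 \<bullet> e = a"
    by (rule pullback_obtain[OF M, of "\<epsilon>0 \<bullet> t" a]) (simp_all add: comp_reduce[OF \<epsilon>0(4)] t)
  note [simp] = e(1-3)
  obtain n n' where N: "pullback C e \<phi> n n'" using pullback_exists[of \<phi> e] by auto
  note [simp] = pullback_arrs(3-4,6-8)[OF N]
  have [simp]: "n \<in> Fib C" by (rule pullback_Fib[OF _ N]) simp
  obtain \<rho> h h' \<epsilon>' where dp1: "dependent_product C q n \<rho> h h' \<epsilon>'" and [simp]: "\<rho> \<in> Fib C"
    by (rule dependent_product_exists[of q n]) simp_all
  have H: "pullback C q \<rho> h h'" and \<epsilon>': "\<epsilon>' \<in> Arr C" "Dom C \<epsilon>' = Dom C h" "Cod C \<epsilon>' = Dom C n" "n \<bullet> \<epsilon>' = h"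
    using dependent_productD[OF dp1] by simp_all
  have [simp]: "Cod C \<rho> = Dom C c" using pullback_arrs(5)[OF H] by simp
  note [simp] = pullback_arrs(3-4,6-8)[OF H] \<epsilon>'(1-3)

  have \<pi>F: "c \<bullet> \<rho> \<in> Fib C" by (rule Fib_Comp) simp_all
  \<comment> \<open>\<open>Q\<close> is the base of the gap map of the product, so that gap map is
    \<rho>, a fibration because it is a dependent product of one.\<close>
  have "(c \<bullet> \<rho>, \<beta>, b \<bullet> \<rho>, \<pi>0) \<in> Arr K"
    using \<pi>F comp_rewrite[OF pullback_comm[OF Q], of \<rho>] unfolding Arr_reedy by simp
  then have \<pi>: "(c \<bullet> \<rho>, \<beta>, b \<bullet> \<rho>, \<pi>0) \<in> Fib K"
    by (rule reedyI[OF _ _ Q, where k = \<rho>]) simp_all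
  have H': "pullback C g1 (b \<bullet> \<rho>) (a \<bullet> h) h'" by (rule pullback_paste[OF G H])
  have th: "p0 \<bullet> t \<bullet> h = \<alpha> \<bullet> a \<bullet> h" "q0 \<bullet> t \<bullet> h = (c \<bullet> \<rho>) \<bullet> h'"
    by (simp_all add: comp_rewrite[OF t(4)] comp_rewrite[OF t(5)] pullback_comm[OF H])
  note pb = reedy_pullback_Fib[OF reedy_Fib_arr(1)[OF \<pi>] g pullback_sym[OF G0] pullback_sym[OF H'], where \<pi> = "t \<bullet> h"]
  have pF: "(t \<bullet> h, c \<bullet> \<rho>, h', q0) \<in> Fib K" and qA: "(t \<bullet> h, \<alpha>, a \<bullet> h, p0) \<in> Arr K"
    using pb th by simp_all
  have P: "pullback K (\<alpha>, \<beta>, g1, g0) (c \<bullet> \<rho>, \<beta>, b \<bullet> \<rho>, \<pi>0) (t \<bullet> h, \<alpha>, a \<bullet> h, p0) (t \<bullet> h, c \<bullet> \<rho>, h', q0)"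
    by (rule reedy_pullbackI[OF reedy_Fib_arr(1)[OF g] reedy_Fib_arr(1)[OF \<pi>] qA reedy_Fib_arr(1)[OF pF] G0 H'])
  \<comment> \<open>The top component of the counit: \<open>\<epsilon>'\<close> ends in the pullback
    \<open>N\<close> of \<phi>, and \<open>n'\<close> projects from there to the top of
    \<eta>.\<close>
  have nn: "n' \<bullet> \<epsilon>' \<in> Arr C" "\<phi> \<bullet> n' \<bullet> \<epsilon>' = e \<bullet> h"
    using comp_rewrite[OF pullback_comm[OF N], of \<epsilon>'] by (simp_all add: \<epsilon>'(4))
  have "\<eta> \<bullet> n' \<bullet> \<epsilon>' = m0 \<bullet> e \<bullet> h"
    using comp_reduce[OF \<phi>(4), of "n' \<bullet> \<epsilon>'"] nn by simp
  then have "\<epsilon>0 \<bullet> t \<bullet> h = \<eta> \<bullet> n' \<bullet> \<epsilon>'" by (simp add: comp_rewrite[OF e(4)])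
  then have \<epsilon>A: "(t \<bullet> h, \<eta>, n' \<bullet> \<epsilon>', \<epsilon>0) \<in> Arr K"
    using qA unfolding Arr_reedy by simp
  have "f1 \<bullet> n' \<bullet> \<epsilon>' = m1 \<bullet> e \<bullet> h"
    using comp_reduce[OF \<phi>(5), of "n' \<bullet> \<epsilon>'"] nn by simp
  then have f\<epsilon>: "Comp K (\<eta>, \<alpha>, f1, f0) (t \<bullet> h, \<eta>, n' \<bullet> \<epsilon>', \<epsilon>0) = (t \<bullet> h, \<alpha>, a \<bullet> h, p0)"
    by (simp add: \<epsilon>0(4) comp_reduce[OF e(5)])

  have "dependent_product K (\<alpha>, \<beta>, g1, g0) (\<eta>, \<alpha>, f1, f0) (c \<bullet> \<rho>, \<beta>, b \<bullet> \<rho>, \<pi>0)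
    (t \<bullet> h, \<alpha>, a \<bullet> h, p0) (t \<bullet> h, c \<bullet> \<rho>, h', q0) (t \<bullet> h, \<eta>, n' \<bullet> \<epsilon>', \<epsilon>0)"
  proof (rule reedy.dependent_productI)
    fix z p' q' l
    assume P': "pullback K (\<alpha>, \<beta>, g1, g0) z p' q'" and l: "l \<in> Arr K" "Dom K l = Dom K p'"
      "Cod K l = Dom K (\<eta>, \<alpha>, f1, f0)" "Comp K (\<eta>, \<alpha>, f1, f0) l = p'"
    obtain \<zeta> \<upsilon> z1 z0 y1a y0a y1z y0z where z: "z = (\<zeta>, \<beta>, z1, z0)" and p': "p' = (\<upsilon>, \<alpha>, y1a, y0a)"
      and q': "q' = (\<upsilon>, \<zeta>, y1z, y0z)"
      using P' by (rule reedy_pullback_obtain) simp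
    obtain l1 l0 where le: "l = (\<upsilon>, \<eta>, l1, l0)" using l by (cases l) (auto simp: p')
    note Y = reedy_pullbackD[OF g reedy.pullback_sym[OF P'[unfolded z p' q']]]
    note Y0 = pullback_sym[OF Y(1)] and Y1 = pullback_sym[OF Y(2)]
    have za: "z1 \<in> Arr C" "Dom C z1 = Dom C \<zeta>" "Cod C z1 = Dom C \<beta>"
      "z0 \<in> Arr C" "Dom C z0 = Cod C \<zeta>" "Cod C z0 = Cod C \<beta>" "\<zeta> \<in> Fib C" and zc: "z0 \<bullet> \<zeta> = \<beta> \<bullet> z1"
      using reedy.pullback_arrs(2)[OF P'] by (simp_all add: z Arr_reedy)
    have ya: "y1a \<in> Arr C" "Dom C y1a = Dom C \<upsilon>" "Cod C y1a = Dom C \<alpha>"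
      "y0a \<in> Arr C" "Dom C y0a = Cod C \<upsilon>" "Cod C y0a = Cod C \<alpha>" "\<upsilon> \<in> Fib C" and yac: "y0a \<bullet> \<upsilon> = \<alpha> \<bullet> y1a"
      using reedy.pullback_arrs(3)[OF P'] by (simp_all add: p' Arr_reedy)
    have yz: "y1z \<in> Arr C" "Dom C y1z = Dom C \<upsilon>" "Cod C y1z = Dom C \<zeta>"
      "y0z \<in> Arr C" "Dom C y0z = Cod C \<upsilon>" "Cod C y0z = Cod C \<zeta>" and yzc: "y0z \<bullet> \<upsilon> = \<zeta> \<bullet> y1z"
      using reedy.pullback_arrs(4)[OF P'] by (simp_all add: q' Arr_reedy)
    have la: "l1 \<in> Arr C" "Dom C l1 = Dom C \<upsilon>" "Cod C l1 = Dom C \<eta>"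
      "l0 \<in> Arr C" "Dom C l0 = Cod C \<upsilon>" "Cod C l0 = Cod C \<eta>" and lc: "l0 \<bullet> \<upsilon> = \<eta> \<bullet> l1"
      using l(1) by (simp_all add: le Arr_reedy)
    have fl: "f1 \<bullet> l1 = y1a" "f0 \<bullet> l0 = y0a" using l(4) by (simp_all add: le p')
    note [simp] = za ya yz la

    obtain s0 w0 where s0: "s0 \<in> Arr C" "Dom C s0 = Cod C \<zeta>" "Cod C s0 = Dom C \<pi>0" "\<pi>0 \<bullet> s0 = z0"
      and w0: "w0 \<in> Arr C" "Dom C w0 = Cod C \<upsilon>" "Cod C w0 = Dom C p0" "p0 \<bullet> w0 = y0a" "q0 \<bullet> w0 = s0 \<bullet> y0z" "\<epsilon>0 \<bullet> w0 = l0"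
      by (rule dependent_product_obtain[OF dp0 Y0, of l0]) (simp_all add: fl)
    note [simp] = s0(1-3) w0(1-3)
    \<comment> \<open>\<open>r\<close> combines \<open>z1\<close> with the bottom transpose already
      found; the top transpose has to be a lift of \<open>r\<close> through \<rho>.\<close>
    obtain r where r: "r \<in> Arr C" "Dom C r = Dom C \<zeta>" "Cod C r = Dom C c" "c \<bullet> r = s0 \<bullet> \<zeta>" "b \<bullet> r = z1"
      by (rule pullback_obtain[OF Q, of "s0 \<bullet> \<zeta>" z1]) (simp_all add: comp_reduce[OF s0(4)] zc)
    note [simp] = r(1-3)
    obtain x where x: "x \<in> Arr C" "Dom C x = Dom C \<upsilon>" "Cod C x = Dom C a" "a \<bullet> x = y1a" "q \<bullet> x = r \<bullet> y1z"
      by (rule pullback_obtain[OF G, of y1a "r \<bullet> y1z"])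
        (simp_all add: comp_reduce[OF r(5)] pullback_comm[OF Y1])
    note [simp] = x(1-3)
    have X: "pullback C q r x y1z"
      by (rule pullback_unpaste[OF G _ _ _ _ _ _ x(4,5)]) (simp_all add: r Y1)
    \<comment> \<open>Used twice: to compute \<open>e \<bullet> x\<close> at level 0, and to see
      that \<open>w1\<close> and \<open>w0\<close> form a square.\<close>
    have tx: "t \<bullet> x = w0 \<bullet> \<upsilon>"
    proof (rule pullback_cancel[OF G0])
      show "p0 \<bullet> t \<bullet> x = p0 \<bullet> w0 \<bullet> \<upsilon>"
        by (simp add: comp_rewrite[OF t(4)] comp_reduce[OF w0(4)] x(4) yac)
      show "q0 \<bullet> t \<bullet> x = q0 \<bullet> w0 \<bullet> \<upsilon>"
        by (simp add: comp_rewrite[OF t(5)] comp_rewrite[OF w0(5)] x(5) yzc comp_rewrite[OF r(4)])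
    qed simp_all
    \<comment> \<open>\<open>x\<close> and \<open>l1\<close> agree in \<open>M\<close>, so together
      they are a map \<open>k\<close> into \<open>N\<close> over the pullback of \<open>Q\<close>
      along \<open>g1\<close>. This is the test map to which the product along \<open>q\<close> is
      applied.\<close>
    have "e \<bullet> x = \<phi> \<bullet> l1"
    proof (rule pullback_cancel[OF M])
      show "m0 \<bullet> e \<bullet> x = m0 \<bullet> \<phi> \<bullet> l1"
        by (simp add: comp_rewrite[OF e(4)] tx comp_reduce[OF w0(6)] lc comp_reduce[OF \<phi>(4)])
      show "m1 \<bullet> e \<bullet> x = m1 \<bullet> \<phi> \<bullet> l1"
        by (simp add: comp_reduce[OF e(5)] x(4) comp_reduce[OF \<phi>(5)] fl)
    qed simp_all
    then obtain k where k: "k \<in> Arr C" "Dom C k = Dom C \<upsilon>" "Cod C k = Dom C n" "n \<bullet> k = x" "n' \<bullet> k = l1"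
      by - (rule pullback_obtain[OF N, of x l1], simp_all)
    note [simp] = k(1-3)
    obtain s1 w1 where s1: "s1 \<in> Arr C" "Dom C s1 = Dom C \<zeta>" "Cod C s1 = Dom C \<rho>" "\<rho> \<bullet> s1 = r"
      and w1: "w1 \<in> Arr C" "Dom C w1 = Dom C \<upsilon>" "Cod C w1 = Dom C h" "h \<bullet> w1 = x" "h' \<bullet> w1 = s1 \<bullet> y1z" "\<epsilon>' \<bullet> w1 = k"
      by (rule dependent_product_obtain[OF dp1 X, of k]) (simp_all add: k)
    note [simp] = s1(1-3) w1(1-3)
    have S: "(\<zeta>, c \<bullet> \<rho>, s1, s0) \<in> Arr K" using \<pi>F unfolding Arr_reedy by (simp add: s1 r)
    have W: "(\<upsilon>, t \<bullet> h, w1, w0) \<in> Arr K"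
      using qA unfolding Arr_reedy by (simp add: w1 tx)
    show "\<exists>s w. s \<in> Arr K \<and> Dom K s = Dom K z \<and> Cod K s = Dom K (c \<bullet> \<rho>, \<beta>, b \<bullet> \<rho>, \<pi>0) \<and>
        Comp K (c \<bullet> \<rho>, \<beta>, b \<bullet> \<rho>, \<pi>0) s = z \<and>
        w \<in> Arr K \<and> Dom K w = Dom K p' \<and> Cod K w = Dom K (t \<bullet> h, \<alpha>, a \<bullet> h, p0) \<and>
        Comp K (t \<bullet> h, \<alpha>, a \<bullet> h, p0) w = p' \<and>
        Comp K (t \<bullet> h, c \<bullet> \<rho>, h', q0) w = Comp K s q' \<and> Comp K (t \<bullet> h, \<eta>, n' \<bullet> \<epsilon>', \<epsilon>0) w = l"
      by (rule exI[of _ "(\<zeta>, c \<bullet> \<rho>, s1, s0)"], rule exI[of _ "(\<upsilon>, t \<bullet> h, w1, w0)"])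
        (simp add: S W z p' q' le s1 s0 r w1 w0 x k)
  next
    fix z p' q' s s' v w
    assume P': "pullback K (\<alpha>, \<beta>, g1, g0) z p' q'"
      and s: "s \<in> Arr K" "Dom K s = Dom K z" "Cod K s = Dom K (c \<bullet> \<rho>, \<beta>, b \<bullet> \<rho>, \<pi>0)"
        "Comp K (c \<bullet> \<rho>, \<beta>, b \<bullet> \<rho>, \<pi>0) s = z"
      and s': "s' \<in> Arr K" "Dom K s' = Dom K z" "Cod K s' = Dom K (c \<bullet> \<rho>, \<beta>, b \<bullet> \<rho>, \<pi>0)"
        "Comp K (c \<bullet> \<rho>, \<beta>, b \<bullet> \<rho>, \<pi>0) s' = z"
      and v: "v \<in> Arr K" "Dom K v = Dom K p'" "Cod K v = Dom K (t \<bullet> h, \<alpha>, a \<bullet> h, p0)"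
        "Comp K (t \<bullet> h, \<alpha>, a \<bullet> h, p0) v = p'" "Comp K (t \<bullet> h, c \<bullet> \<rho>, h', q0) v = Comp K s q'"
      and w: "w \<in> Arr K" "Dom K w = Dom K p'" "Cod K w = Dom K (t \<bullet> h, \<alpha>, a \<bullet> h, p0)"
        "Comp K (t \<bullet> h, \<alpha>, a \<bullet> h, p0) w = p'" "Comp K (t \<bullet> h, c \<bullet> \<rho>, h', q0) w = Comp K s' q'"
      and vw: "Comp K (t \<bullet> h, \<eta>, n' \<bullet> \<epsilon>', \<epsilon>0) v = Comp K (t \<bullet> h, \<eta>, n' \<bullet> \<epsilon>', \<epsilon>0) w"
    obtain \<zeta> \<upsilon> z1 z0 y1a y0a y1z y0z where z: "z = (\<zeta>, \<beta>, z1, z0)" and p': "p' = (\<upsilon>, \<alpha>, y1a, y0a)"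
      and q': "q' = (\<upsilon>, \<zeta>, y1z, y0z)"
      using P' by (rule reedy_pullback_obtain) simp
    note Y = reedy_pullbackD[OF g reedy.pullback_sym[OF P'[unfolded z p' q']]]
    note Y0 = pullback_sym[OF Y(1)] and Y1 = pullback_sym[OF Y(2)]
    obtain s1 s0 s1' s0' where se: "s = (\<zeta>, c \<bullet> \<rho>, s1, s0)" "s' = (\<zeta>, c \<bullet> \<rho>, s1', s0')"
      using s s' by (cases s, cases s') (auto simp: z)
    obtain v1 v0 w1 w0 where ve: "v = (\<upsilon>, t \<bullet> h, v1, v0)" "w = (\<upsilon>, t \<bullet> h, w1, w0)"
      using v w by (cases v, cases w) (auto simp: p')
    have za: "z1 \<in> Arr C" "Dom C z1 = Dom C \<zeta>" "Cod C z1 = Dom C \<beta>"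
      "z0 \<in> Arr C" "Dom C z0 = Cod C \<zeta>" "Cod C z0 = Cod C \<beta>" "\<zeta> \<in> Fib C"
      using reedy.pullback_arrs(2)[OF P'] by (simp_all add: z Arr_reedy)
    have ya: "y1a \<in> Arr C" "Dom C y1a = Dom C \<upsilon>" "Cod C y1a = Dom C \<alpha>"
      "y0a \<in> Arr C" "Dom C y0a = Cod C \<upsilon>" "Cod C y0a = Cod C \<alpha>" "\<upsilon> \<in> Fib C"
      using reedy.pullback_arrs(3)[OF P'] by (simp_all add: p' Arr_reedy)
    have yz: "y1z \<in> Arr C" "Dom C y1z = Dom C \<upsilon>" "Cod C y1z = Dom C \<zeta>"
      "y0z \<in> Arr C" "Dom C y0z = Cod C \<upsilon>" "Cod C y0z = Cod C \<zeta>"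
      using reedy.pullback_arrs(4)[OF P'] by (simp_all add: q' Arr_reedy)
    have sa: "s1 \<in> Arr C" "Dom C s1 = Dom C \<zeta>" "Cod C s1 = Dom C \<rho>"
      "s0 \<in> Arr C" "Dom C s0 = Cod C \<zeta>" "Cod C s0 = Dom C \<pi>0" and sc: "s0 \<bullet> \<zeta> = c \<bullet> \<rho> \<bullet> s1"
      and sa': "s1' \<in> Arr C" "Dom C s1' = Dom C \<zeta>" "Cod C s1' = Dom C \<rho>"
      "s0' \<in> Arr C" "Dom C s0' = Cod C \<zeta>" "Cod C s0' = Dom C \<pi>0" and sc': "s0' \<bullet> \<zeta> = c \<bullet> \<rho> \<bullet> s1'"
      using s(1) s'(1) by (simp_all add: se Arr_reedy)
    have va: "v1 \<in> Arr C" "Dom C v1 = Dom C \<upsilon>" "Cod C v1 = Dom C h"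
      "v0 \<in> Arr C" "Dom C v0 = Cod C \<upsilon>" "Cod C v0 = Dom C p0"
      and wa: "w1 \<in> Arr C" "Dom C w1 = Dom C \<upsilon>" "Cod C w1 = Dom C h"
      "w0 \<in> Arr C" "Dom C w0 = Cod C \<upsilon>" "Cod C w0 = Dom C p0"
      using v(1) w(1) by (simp_all add: ve Arr_reedy)
    note [simp] = za ya yz sa sa' va wa
    have bs: "b \<bullet> \<rho> \<bullet> s1 = z1" "\<pi>0 \<bullet> s0 = z0" and bs': "b \<bullet> \<rho> \<bullet> s1' = z1" "\<pi>0 \<bullet> s0' = z0"
      using s(4) s'(4) by (simp_all add: se z)
    have v2: "a \<bullet> h \<bullet> v1 = y1a" "p0 \<bullet> v0 = y0a" "h' \<bullet> v1 = s1 \<bullet> y1z" "q0 \<bullet> v0 = s0 \<bullet> y0z"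
      and w2: "a \<bullet> h \<bullet> w1 = y1a" "p0 \<bullet> w0 = y0a" "h' \<bullet> w1 = s1' \<bullet> y1z" "q0 \<bullet> w0 = s0' \<bullet> y0z"
      using v(4,5) w(4,5) by (simp_all add: se ve p' q')
    have vw2: "n' \<bullet> \<epsilon>' \<bullet> v1 = n' \<bullet> \<epsilon>' \<bullet> w1" "\<epsilon>0 \<bullet> v0 = \<epsilon>0 \<bullet> w0"
      using vw by (simp_all add: ve)

    have s0: "s0 = s0'"
      by (rule dependent_product_cancel[OF dp0 Y0 _ _ _ bs(2) _ _ _ bs'(2) _ _ _ v2(2,4) _ _ _ w2(2,4) vw2(2)]) simp_all
    \<comment> \<open>With equal bottoms and the same \<open>z1\<close>, both top transposes lie
      over the same map into \<open>Q\<close>; only then are they comparable by the product along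
      \<open>q\<close>.\<close>
    have r: "\<rho> \<bullet> s1 = \<rho> \<bullet> s1'"
      by (rule pullback_cancel[OF Q]) (use sc sc' s0 in \<open>simp_all add: bs bs'\<close>)
    have qh: "q \<bullet> h \<bullet> v1 = (\<rho> \<bullet> s1) \<bullet> y1z" "q \<bullet> h \<bullet> w1 = (\<rho> \<bullet> s1') \<bullet> y1z"
      by (simp_all add: comp_rewrite[OF pullback_comm[OF H]] v2 w2)
    have hv: "h \<bullet> v1 = h \<bullet> w1"
      by (rule pullback_cancel[OF G]) (use qh r in \<open>simp_all add: v2 w2\<close>)
    have X: "pullback C q (\<rho> \<bullet> s1) (h \<bullet> v1) y1z"
      by (rule pullback_unpaste[OF G _ _ _ _ _ _ v2(1) qh(1)]) (simp_all add: bs Y1)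
    have "\<epsilon>' \<bullet> v1 = \<epsilon>' \<bullet> w1"
      by (rule pullback_cancel[OF N]) (simp_all add: comp_reduce[OF \<epsilon>'(4)] hv vw2)
    then have "s1 = s1'"
      by - (rule dependent_product_cancel[OF dp1 X, of s1 s1' v1 w1], simp_all add: r hv v2 w2)
    then show "s = s'" using s0 by (simp add: se)
  qed (use f g P \<epsilon>A f\<epsilon> reedy_Fib_arr(1)[OF f] in simp_all)
  then show ?thesis using \<pi> by blast
qed

section \<open>Condition (4) for \<open>K\<close> and the conjunction of all axioms\<close>

lemma reedy_Pi_exists:
  assumes "g \<in> Fib K"
  shows "\<exists>Ro Ra \<phi>. partial_right_adjoint (slice K (Cod K g)) (slice K (Dom K g))
          (pullback_obj K g) (pullback_arr K g) {f \<in> Fib K. Cod K f = Dom K g} Ro Ra \<phi> \<and>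
        (\<forall>f \<in> {f \<in> Fib K. Cod K f = Dom K g}. Ro f \<in> Fib K)"
proof -
  obtain \<alpha> \<beta> g1 g0 where ge: "g = (\<alpha>, \<beta>, g1, g0)" by (cases g)
  note gF = assms[unfolded ge]
  interpret pullback_along K g
  proof
    show "g \<in> Arr K" using assms by (simp add: Fib_reedy)
    fix z assume z: "z \<in> Arr K" "Cod K z = Cod K g"
    obtain \<zeta> z1 z0 where ze: "z = (\<zeta>, \<beta>, z1, z0)" using z(2) by (cases z) (auto simp: ge)
    show "\<exists>p q. pullback K g z p q"
      by (rule reedy_pullback_exists[OF z(1)[unfolded ze] gF]) (use reedy.pullback_sym ge ze in blast)
  qed
  show ?thesis
  proof (rule partial_right_adjoint_of_dependent_products)
    show "{f \<in> Fib K. Cod K f = Dom K g} \<subseteq> {f \<in> Arr K. Cod K f = Dom K g}"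
      by (auto simp: Fib_reedy)
    fix f assume "f \<in> {f \<in> Fib K. Cod K f = Dom K g}"
    then obtain \<eta> f1 f0 where "f = (\<eta>, \<alpha>, f1, f0)" "f \<in> Fib K" by (cases f) (auto simp: ge)
    then show "\<exists>\<pi> \<in> Fib K. \<exists>p q \<epsilon>. dependent_product K g f \<pi> p q \<epsilon>"
      using reedy_dependent_product[OF gF] by (simp add: ge)
  qed
qed

lemma type_theoretic_fibration_category_reedy: "type_theoretic_fibration_category K"
proof unfold_locales
  show "terminal K (One K)" by (rule terminal_reedy)
  show "Fib K \<subseteq> Arr K" by (auto simp: Fib_reedy)
  show iso: "f \<in> Fib K" if "iso K f" for f using that by (rule reedy_Fib_iso)
  show "Ident K A \<in> Fib K" if "A \<in> Obj K" for A
    by (rule iso, rule reedy.isoI[of _ A A "Ident K A"])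
      (use that reedy.Ident_Hom[OF that] reedy.Ident_Comp in \<open>auto simp del: reedy_fields\<close>)
  show "Comp K g f \<in> Fib K" if "f \<in> Fib K" "g \<in> Fib K" "Cod K f = Dom K g" for f g
    using that by (rule reedy_Fib_Comp)
  show "f \<in> Fib K" if "f \<in> Arr K" "Cod K f = One K" for f
    using that by (rule reedy_Fib_One)
  show "\<exists>p q. pullback K f g p q" if g: "g \<in> Fib K" and f: "f \<in> Arr K" "Cod K f = Cod K g" for f g
  proof -
    obtain \<alpha> \<beta> \<gamma> f1 f0 g1 g0 where e: "f = (\<alpha>, \<gamma>, f1, f0)" "g = (\<beta>, \<gamma>, g1, g0)"
      using f(2) by (cases f, cases g) auto
    show ?thesis by (rule reedy_pullback_exists[OF f(1)[unfolded e] g[unfolded e]]) (use e in blast)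
  qed
  show "p \<in> Fib K" if g: "g \<in> Fib K" and P: "pullback K f g p q" for f g p q
    using P by (rule reedy_pullback_obtain) (use g P reedy_pullbackD(3) in blast)
  show "\<exists>Pi_obj Pi_arr \<phi>. partial_right_adjoint (slice K (Cod K g)) (slice K (Dom K g))
          (pullback_obj K g) (pullback_arr K g) {f \<in> Fib K. Cod K f = Dom K g} Pi_obj Pi_arr \<phi> \<and>
        (\<forall>f \<in> Fib K. Cod K f = Dom K g \<longrightarrow> Pi_obj f \<in> Fib K)" if "g \<in> Fib K" for g
    using reedy_Pi_exists[OF that] by blast
  show "\<exists>i p. acyclic_cofibration K i \<and> p \<in> Fib K \<and>
        Dom K i = Dom K f \<and> Cod K i = Dom K p \<and> Cod K p = Cod K f \<and> f = Comp K p i" if "f \<in> Arr K" for f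
    using that by (rule reedy_factorization) (metis acyclic_cofibration_reedyI reedy_fields(1,2))
  show "acyclic_cofibration K k"
    if "a \<in> Fib K" "b \<in> Fib K" "Cod K a = Cod K b" "acyclic_cofibration K i" "i \<in> Hom K (Dom K a) (Dom K b)"
      "Comp K b i = a" "z \<in> Arr K" "Cod K z = Cod K a" "pullback K z a p q" "pullback K z b p' q'"
      "k \<in> Hom K (Dom K p) (Dom K p')" "Comp K p' k = p" "Comp K q' k = Comp K i q" for a b i z p q p' q' k
    using that(1-6,9-) by (rule reedy_acyclic_cofibration_pullback)
qed

end

theorem theorem8p8:
  fixes C :: "('o, 'a) fibcat"
  assumes "type_theoretic_fibration_category C"
  shows "type_theoretic_fibration_category (reedy_fibrant_cat C)"
  using assms by (rule type_theoretic_fibration_category.type_theoretic_fibration_category_reedy)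

end
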